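(* Let $X_1$ and $X_2$ be infinitesimal generators of a $\mathbb{T}^2$-action on a smooth manifold $M$, and let $h_1,h_2\in C^\infty(M)$ be $\mathbb{T}^2$-invariant functions that are independent on a $\mathbb{T}^2$-saturated open neighborhood $V$ of $\operatorname{supp}(X_1)\cup\operatorname{supp}(X_2)$. Let $\mathcal{L}$ be the foliation of $V$ given by the common level sets of $h_1$ and $h_2$, and $\mathcal{O}$ the (possibly singular) foliation of $V$ by the orbits of the $\mathbb{T}^2$-action. Suppose that there exists a regular foliation $\mathcal{S}$ on $V$ compatible with $\mathcal{L}$ and $\mathcal{O}$. Then there exists a Poisson structure $\pi$ on $M$ such that the $\mathbb{T}^2$-action is Hamiltonian on $(M,\pi)$ with momentum map $\mathbb{J}:M\to(\mathbb{R}^2)^*$ given by $\mathbb{J}(x)(\xi):=\xi_1h_1(x)+\xi_2h_2(x)$, $\xi=(\xi_1,\xi_2)\in\mathbb{R}^2$.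
   Context: Here $\mathbb{R}^2=\mathrm{Lie}(\mathbb{T}^2)$, $X_1,X_2$ are the infinitesimal generators corresponding to its standard basis, and $\xi_M=\xi_1X_1+\xi_2X_2$. Functions $h_1,h_2$ are independent on $V$ if $\mathrm{d}h_1\wedge\mathrm{d}h_2\ne0$ at every point of $V$. $\operatorname{supp}(X)$ is the closure of $\{X\neq0\}$. A foliation $\mathcal{S}$ of $V$ is compatible with $\mathcal{L}$ and $\mathcal{O}$ if: (1) $T\mathcal{S}+T\mathcal{L}=TV$; (2) $T\mathcal{O}\subset T\mathcal{S}$, where $T\mathcal{O}$ is spanned by $X_1,X_2$; (3) on the open set where $X_1\wedge X_2\neq0$, $T\mathcal{O}=T\mathcal{S}\cap T\mathcal{L}$. A Poisson structure is a bivector field $\pi$ with $[\pi,\pi]=0$ (Schouten–Nijenhuis bracket), and $\pi^\sharp\alpha=\mathbf{i}_\alpha\pi=\pi(\alpha,\cdot)$. The action is Hamiltonian on $(M,\pi)$ with momentum map $\mathbb{J}$ if, for every $\xi\in\mathbb{R}^2$, $\pi^\sharp\mathrm{d}\mathbb{J}_\xi=\xi_M$, where $\mathbb{J}_\xi(x)=\mathbb{J}(x)(\xi)$. *)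

theory Defs
  imports "HOL-Analysis.Analysis"
begin

section \<open>Smooth maps between Euclidean spaces\<close>

text \<open>Only used for open \<open>S\<close>.\<close>

primrec Ck_on :: "nat \<Rightarrow> 'a::euclidean_space set \<Rightarrow> ('a \<Rightarrow> 'b::real_normed_vector) \<Rightarrow> bool" where
  "Ck_on 0 S f \<longleftrightarrow> continuous_on S f"
| "Ck_on (Suc k) S f \<longleftrightarrow> (\<forall>x\<in>S. f differentiable (at x)) \<and>
     (\<forall>v. Ck_on k S (\<lambda>x. frechet_derivative f (at x) v))"

definition smooth_on :: "'a::euclidean_space set \<Rightarrow> ('a \<Rightarrow> 'b::real_normed_vector) \<Rightarrow> bool" where
  "smooth_on S f \<longleftrightarrow> (\<forall>k. Ck_on k S f)"

section \<open>Smooth manifolds\<close>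

text \<open>A manifold is a type \<open>'m\<close> (a Hausdorff, second countable space) together with a smooth
  atlas \<open>A\<close> modelled on the Euclidean space \<open>'e\<close>. A chart is a pair of its domain and its
  coordinate map; the values of the coordinate map outside the domain are irrelevant.\<close>

type_synonym ('m, 'e) chart = "'m set \<times> ('m \<Rightarrow> 'e)"

abbreviation dom_of :: "('m, 'e) chart \<Rightarrow> 'm set" where "dom_of c \<equiv> fst c"
abbreviation map_of_chart :: "('m, 'e) chart \<Rightarrow> 'm \<Rightarrow> 'e" where "map_of_chart c \<equiv> snd c"

definition chart_inv :: "('m, 'e) chart \<Rightarrow> 'e \<Rightarrow> 'm" where
  "chart_inv c = inv_into (dom_of c) (map_of_chart c)"

definition is_chart :: "('m::topological_space, 'e::euclidean_space) chart \<Rightarrow> bool" where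
  "is_chart c \<longleftrightarrow> open (dom_of c) \<and> open (map_of_chart c ` dom_of c) \<and>
     homeomorphism (dom_of c) (map_of_chart c ` dom_of c) (map_of_chart c) (chart_inv c)"

definition transition :: "('m, 'e) chart \<Rightarrow> ('m, 'e) chart \<Rightarrow> 'e \<Rightarrow> 'e" where
  "transition c d = map_of_chart d \<circ> chart_inv c"

definition overlap :: "('m, 'e) chart \<Rightarrow> ('m, 'e) chart \<Rightarrow> 'e set" where
  "overlap c d = map_of_chart c ` (dom_of c \<inter> dom_of d)"

definition smoothly_related ::
  "('m, 'e::euclidean_space) chart \<Rightarrow> ('m, 'e) chart \<Rightarrow> bool" where
  "smoothly_related c d \<longleftrightarrow>
     smooth_on (overlap c d) (transition c d) \<and> smooth_on (overlap d c) (transition d c)"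

definition smooth_atlas :: "('m::topological_space, 'e::euclidean_space) chart set \<Rightarrow> bool" where
  "smooth_atlas A \<longleftrightarrow> (\<forall>c\<in>A. is_chart c) \<and> (\<Union>c\<in>A. dom_of c) = UNIV \<and>
     (\<forall>c\<in>A. \<forall>d\<in>A. smoothly_related c d)"

definition smooth_function ::
  "('m, 'e::euclidean_space) chart set \<Rightarrow> ('m \<Rightarrow> real) \<Rightarrow> bool" where
  "smooth_function A f \<longleftrightarrow> (\<forall>c\<in>A. smooth_on (map_of_chart c ` dom_of c) (f \<circ> chart_inv c))"

section \<open>Tangent and cotangent vectors\<close>

text \<open>One chart of the atlas is selected around every point \<open>x\<close>, and the tangent space at \<open>x\<close> is
  identified with \<open>'e\<close> through that chart. Hence a vector field is a function \<open>'m \<Rightarrow> 'e\<close>, a covector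
  at \<open>x\<close> is an element of \<open>'e \<Rightarrow>\<^sub>L real\<close>, and so on. The selected charts need not vary continuously
  with \<open>x\<close>, so smoothness of a tensor field is always expressed through its components in the
  charts of the atlas.\<close>

definition chart_at :: "('m, 'e) chart set \<Rightarrow> 'm \<Rightarrow> ('m, 'e) chart" where
  "chart_at A x = (SOME c. c \<in> A \<and> x \<in> dom_of c)"

text \<open>The differential at \<open>x\<close> of a map into a vector space which is smooth near \<open>x\<close>. With
  \<open>f = map_of_chart c\<close> it turns a tangent vector at \<open>x\<close> into its components in the chart \<open>c\<close>.\<close>

definition differential ::
  "('m, 'e::euclidean_space) chart set \<Rightarrow> ('m \<Rightarrow> 'b::real_normed_vector) \<Rightarrow> 'm \<Rightarrow> 'e \<Rightarrow>\<^sub>L 'b" where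
  "differential A f x =
     Blinfun (frechet_derivative (f \<circ> chart_inv (chart_at A x)) (at (map_of_chart (chart_at A x) x)))"

definition wedge_vectors :: "'e::euclidean_space \<Rightarrow> 'e \<Rightarrow> ('e \<Rightarrow>\<^sub>L real) \<Rightarrow> ('e \<Rightarrow>\<^sub>L real) \<Rightarrow> real" where
  "wedge_vectors v w = (\<lambda>\<alpha> \<beta>. blinfun_apply \<alpha> v * blinfun_apply \<beta> w - blinfun_apply \<alpha> w * blinfun_apply \<beta> v)"

definition wedge_covectors :: "('e::euclidean_space \<Rightarrow>\<^sub>L real) \<Rightarrow> ('e \<Rightarrow>\<^sub>L real) \<Rightarrow> 'e \<Rightarrow> 'e \<Rightarrow> real" where
  "wedge_covectors \<alpha> \<beta> = (\<lambda>v w. blinfun_apply \<alpha> v * blinfun_apply \<beta> w - blinfun_apply \<alpha> w * blinfun_apply \<beta> v)"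

definition independent_functions_on ::
  "('m, 'e::euclidean_space) chart set \<Rightarrow> 'm set \<Rightarrow> ('m \<Rightarrow> real) \<Rightarrow> ('m \<Rightarrow> real) \<Rightarrow> bool" where
  "independent_functions_on A V h1 h2 \<longleftrightarrow>
     (\<forall>x\<in>V. wedge_covectors (differential A h1 x) (differential A h2 x) \<noteq> (\<lambda>v w. 0))"

definition vf_support :: "('m::topological_space \<Rightarrow> 'e::zero) \<Rightarrow> 'm set" where
  "vf_support X = closure {x. X x \<noteq> 0}"

section \<open>Poisson structures\<close>

text \<open>Components of \<open>P\<close> in a chart \<open>c\<close>: evaluation on the constant-coefficient one-forms of \<open>c\<close>.\<close>

definition bivector_field ::
  "('m, 'e::euclidean_space) chart set \<Rightarrow> ('m \<Rightarrow> ('e \<Rightarrow>\<^sub>L real) \<Rightarrow> ('e \<Rightarrow>\<^sub>L real) \<Rightarrow> real) \<Rightarrow> bool" where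
  "bivector_field A P \<longleftrightarrow>
     (\<forall>x. bilinear (P x) \<and> (\<forall>\<alpha>. P x \<alpha> \<alpha> = 0)) \<and>
     (\<forall>c\<in>A. \<forall>\<alpha> \<beta>. smooth_on (map_of_chart c ` dom_of c)
        ((\<lambda>x. P x (\<alpha> o\<^sub>L differential A (map_of_chart c) x)
                  (\<beta> o\<^sub>L differential A (map_of_chart c) x)) \<circ> chart_inv c))"

definition pairing ::
  "('m, 'e::euclidean_space) chart set \<Rightarrow> ('m \<Rightarrow> ('e \<Rightarrow>\<^sub>L real) \<Rightarrow> ('e \<Rightarrow>\<^sub>L real) \<Rightarrow> real) \<Rightarrow>
     ('m \<Rightarrow> real) \<Rightarrow> ('m \<Rightarrow> real) \<Rightarrow> 'm \<Rightarrow> real" where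
  "pairing A P f g x = P x (differential A f x) (differential A g x)"

text \<open>The Schouten--Nijenhuis bracket of two bivector fields is the trivector field determined by
  \[ [P,Q](df,dg,dh) = \sum_{cyc} P(d(Q(df,dg)),dh) + Q(d(P(df,dg)),dh), \]
  up to an overall sign that depends on the author. Its value on three covectors at \<open>x\<close> is computed
  with functions having these differentials at \<open>x\<close>; we take those that are linear in the selected
  chart around \<open>x\<close>. They are meaningful only near \<open>x\<close>, which suffices since the right-hand side
  at \<open>x\<close> only depends on germs at \<open>x\<close>.\<close>

definition schouten_bracket ::
  "('m, 'e::euclidean_space) chart set \<Rightarrow>
     ('m \<Rightarrow> ('e \<Rightarrow>\<^sub>L real) \<Rightarrow> ('e \<Rightarrow>\<^sub>L real) \<Rightarrow> real) \<Rightarrow>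
     ('m \<Rightarrow> ('e \<Rightarrow>\<^sub>L real) \<Rightarrow> ('e \<Rightarrow>\<^sub>L real) \<Rightarrow> real) \<Rightarrow>
     'm \<Rightarrow> ('e \<Rightarrow>\<^sub>L real) \<Rightarrow> ('e \<Rightarrow>\<^sub>L real) \<Rightarrow> ('e \<Rightarrow>\<^sub>L real) \<Rightarrow> real" where
  "schouten_bracket A P Q x \<alpha> \<beta> \<gamma> =
     (let f = blinfun_apply \<alpha> \<circ> map_of_chart (chart_at A x);
          g = blinfun_apply \<beta> \<circ> map_of_chart (chart_at A x);
          h = blinfun_apply \<gamma> \<circ> map_of_chart (chart_at A x)
      in pairing A P (pairing A Q f g) h x + pairing A Q (pairing A P f g) h x
       + pairing A P (pairing A Q g h) f x + pairing A Q (pairing A P g h) f x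
       + pairing A P (pairing A Q h f) g x + pairing A Q (pairing A P h f) g x)"

definition poisson_structure ::
  "('m, 'e::euclidean_space) chart set \<Rightarrow> ('m \<Rightarrow> ('e \<Rightarrow>\<^sub>L real) \<Rightarrow> ('e \<Rightarrow>\<^sub>L real) \<Rightarrow> real) \<Rightarrow> bool" where
  "poisson_structure A P \<longleftrightarrow>
     bivector_field A P \<and> schouten_bracket A P P = (\<lambda>x \<alpha> \<beta> \<gamma>. 0)"

text \<open>\<open>sharp (P x) \<alpha>\<close> is the vector \<open>P x \<alpha> (\<cdot>)\<close>, using that a finite-dimensional space is its bidual.\<close>

definition sharp ::
  "(('e::euclidean_space \<Rightarrow>\<^sub>L real) \<Rightarrow> ('e \<Rightarrow>\<^sub>L real) \<Rightarrow> real) \<Rightarrow> ('e \<Rightarrow>\<^sub>L real) \<Rightarrow> 'e" where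
  "sharp p \<alpha> = (THE v. \<forall>\<beta>. p \<alpha> \<beta> = blinfun_apply \<beta> v)"

section \<open>Torus actions\<close>

definition torus :: "(complex \<times> complex) set" where
  "torus = sphere 0 1 \<times> sphere 0 1"

definition torus_mult :: "complex \<times> complex \<Rightarrow> complex \<times> complex \<Rightarrow> complex \<times> complex" where
  "torus_mult g k = (fst g * fst k, snd g * snd k)"

definition torus_exp :: "real \<times> real \<Rightarrow> complex \<times> complex" where
  "torus_exp \<xi> = (cis (fst \<xi>), cis (snd \<xi>))"

text \<open>Smooth left actions of the torus. Since \<open>torus_exp\<close> is a surjective local diffeomorphism,
  smoothness on \<open>torus \<times> M\<close> is smoothness of the composition with \<open>torus_exp\<close>.\<close>

definition smooth_torus_action ::
  "('m::topological_space, 'e::euclidean_space) chart set \<Rightarrow> (complex \<times> complex \<Rightarrow> 'm \<Rightarrow> 'm) \<Rightarrow> bool" where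
  "smooth_torus_action A act \<longleftrightarrow>
     (\<forall>x. act (1, 1) x = x) \<and>
     (\<forall>g\<in>torus. \<forall>k\<in>torus. \<forall>x. act (torus_mult g k) x = act g (act k x)) \<and>
     continuous_on (torus \<times> UNIV) (\<lambda>(g, x). act g x) \<and>
     (\<forall>c\<in>A. \<forall>d\<in>A.
        smooth_on {(\<xi>, p). p \<in> map_of_chart c ` dom_of c \<and> act (torus_exp \<xi>) (chart_inv c p) \<in> dom_of d}
          (\<lambda>(\<xi>, p). map_of_chart d (act (torus_exp \<xi>) (chart_inv c p))))"

definition generator ::
  "('m, 'e::euclidean_space) chart set \<Rightarrow> (complex \<times> complex \<Rightarrow> 'm \<Rightarrow> 'm) \<Rightarrow> real \<times> real \<Rightarrow> 'm \<Rightarrow> 'e" where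
  "generator A act \<xi> x =
     vector_derivative (\<lambda>t. map_of_chart (chart_at A x) (act (torus_exp (t *\<^sub>R \<xi>)) x)) (at 0)"

definition xi_M ::
  "('m, 'e::euclidean_space) chart set \<Rightarrow> (complex \<times> complex \<Rightarrow> 'm \<Rightarrow> 'm) \<Rightarrow> real \<times> real \<Rightarrow> 'm \<Rightarrow> 'e" where
  "xi_M A act \<xi> x = fst \<xi> *\<^sub>R generator A act (1, 0) x + snd \<xi> *\<^sub>R generator A act (0, 1) x"

definition torus_invariant :: "(complex \<times> complex \<Rightarrow> 'm \<Rightarrow> 'm) \<Rightarrow> ('m \<Rightarrow> real) \<Rightarrow> bool" where
  "torus_invariant act f \<longleftrightarrow> (\<forall>g\<in>torus. \<forall>x. f (act g x) = f x)"

definition torus_saturated :: "(complex \<times> complex \<Rightarrow> 'm \<Rightarrow> 'm) \<Rightarrow> 'm set \<Rightarrow> bool" where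
  "torus_saturated act V \<longleftrightarrow> (\<forall>g\<in>torus. \<forall>x\<in>V. act g x \<in> V)"

definition hamiltonian_with_momentum ::
  "('m, 'e::euclidean_space) chart set \<Rightarrow> ('m \<Rightarrow> ('e \<Rightarrow>\<^sub>L real) \<Rightarrow> ('e \<Rightarrow>\<^sub>L real) \<Rightarrow> real) \<Rightarrow>
     (complex \<times> complex \<Rightarrow> 'm \<Rightarrow> 'm) \<Rightarrow> ('m \<Rightarrow> (real \<times> real) \<Rightarrow>\<^sub>L real) \<Rightarrow> bool" where
  "hamiltonian_with_momentum A P act J \<longleftrightarrow>
     (\<forall>\<xi>. smooth_function A (\<lambda>x. blinfun_apply (J x) \<xi>) \<and>
        (\<forall>x. sharp (P x) (differential A (\<lambda>y. blinfun_apply (J y) \<xi>) x) = xi_M A act \<xi> x))"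

section \<open>Foliations\<close>

text \<open>A regular foliation of the open set \<open>V\<close> is given by a foliated atlas \<open>F\<close>: smooth charts of the
  manifold covering \<open>V\<close> whose transition maps locally preserve the decomposition of the model space
  into the translates of a fixed linear subspace \<open>W\<close>. With \<open>W = \<real>\<^sup>k \<times> 0\<close> this is the usual local form
  \<open>(u, w) \<mapsto> (a(u, w), b(w))\<close> of the transition maps; the plaques of a chart are the connected
  components of the preimages of the translates of \<open>W\<close>, and the rank is \<open>dim W\<close>.\<close>

definition regular_foliation ::
  "('m::topological_space, 'e::euclidean_space) chart set \<Rightarrow> 'm set \<Rightarrow> 'e set \<Rightarrow> ('m, 'e) chart set \<Rightarrow> bool" where
  "regular_foliation A V W F \<longleftrightarrow>
     subspace W \<and>
     (\<forall>c\<in>F. is_chart c \<and> (\<forall>d\<in>A. smoothly_related c d)) \<and>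
     (\<Union>c\<in>F. dom_of c) = V \<and>
     (\<forall>c\<in>F. \<forall>d\<in>F. \<forall>p\<in>overlap c d. \<exists>N. open N \<and> p \<in> N \<and> N \<subseteq> overlap c d \<and>
        (\<forall>q\<in>N. \<forall>r\<in>N. q - r \<in> W \<longrightarrow> transition c d q - transition c d r \<in> W))"

definition foliation_tangent ::
  "('m, 'e::euclidean_space) chart set \<Rightarrow> 'e set \<Rightarrow> ('m, 'e) chart set \<Rightarrow> 'm \<Rightarrow> 'e set" where
  "foliation_tangent A W F x =
     {v. \<exists>c\<in>F. x \<in> dom_of c \<and> blinfun_apply (differential A (map_of_chart c) x) v \<in> W}"

text \<open>The tangent spaces of the fibres of the submersion \<open>(h1, h2)\<close>.\<close>

definition level_tangent ::
  "('m, 'e::euclidean_space) chart set \<Rightarrow> ('m \<Rightarrow> real) \<Rightarrow> ('m \<Rightarrow> real) \<Rightarrow> 'm \<Rightarrow> 'e set" where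
  "level_tangent A h1 h2 x =
     {v. blinfun_apply (differential A h1 x) v = 0 \<and> blinfun_apply (differential A h2 x) v = 0}"

definition orbit_tangent :: "('m \<Rightarrow> 'e::euclidean_space) \<Rightarrow> ('m \<Rightarrow> 'e) \<Rightarrow> 'm \<Rightarrow> 'e set" where
  "orbit_tangent X1 X2 x = span {X1 x, X2 x}"

definition compatible_foliation ::
  "('m, 'e::euclidean_space) chart set \<Rightarrow> 'm set \<Rightarrow> ('m \<Rightarrow> real) \<Rightarrow> ('m \<Rightarrow> real) \<Rightarrow>
     ('m \<Rightarrow> 'e) \<Rightarrow> ('m \<Rightarrow> 'e) \<Rightarrow> 'e set \<Rightarrow> ('m, 'e) chart set \<Rightarrow> bool" where
  "compatible_foliation A V h1 h2 X1 X2 W F \<longleftrightarrow>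
     (\<forall>x\<in>V. {s + l |s l. s \<in> foliation_tangent A W F x \<and> l \<in> level_tangent A h1 h2 x} = UNIV) \<and>
     (\<forall>x\<in>V. orbit_tangent X1 X2 x \<subseteq> foliation_tangent A W F x) \<and>
     (\<forall>x\<in>V. wedge_vectors (X1 x) (X2 x) \<noteq> (\<lambda>\<alpha> \<beta>. 0) \<longrightarrow>
        orbit_tangent X1 X2 x = foliation_tangent A W F x \<inter> level_tangent A h1 h2 x)"

end

theory Submission
  imports Defs
begin

text \<open>Choose vector fields \<open>Y\<^sub>1\<close>, \<open>Y\<^sub>2\<close> on \<open>V\<close>, tangent to the foliation \<open>S\<close>, with \<open>Y\<^sub>i(h\<^sub>j) = \<delta>\<^sub>i\<^sub>j\<close>: such
  fields exist locally because \<open>S\<close> is transverse to the level sets, and they are glued by a partition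
  of unity. Since the generators \<open>X\<^sub>1\<close>, \<open>X\<^sub>2\<close> are tangent to \<open>S\<close>, the action preserves the tangent spaces of
  \<open>S\<close>, so averaging over the two circle factors in turn makes the \<open>Y\<^sub>i\<close> invariant without losing
  these properties. Put \<open>\<pi> = Y\<^sub>1 \<and> X\<^sub>1 + Y\<^sub>2 \<and> X\<^sub>2\<close>, extended by zero. As \<open>X\<^sub>i(h\<^sub>j) = 0\<close>, contracting with
  \<open>dh\<^sub>i\<close> gives \<open>X\<^sub>i\<close>. All brackets among the four fields vanish except \<open>[Y\<^sub>1, Y\<^sub>2]\<close>, so \<open>[\<pi>, \<pi>]\<close> is a multiple
  of \<open>[Y\<^sub>1, Y\<^sub>2] \<and> X\<^sub>1 \<and> X\<^sub>2\<close>; and \<open>[Y\<^sub>1, Y\<^sub>2]\<close> is tangent both to \<open>S\<close> and to the level sets, hence lies in the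
  span of \<open>X\<^sub>1\<close>, \<open>X\<^sub>2\<close> wherever \<open>X\<^sub>1 \<and> X\<^sub>2 \<noteq> 0\<close>.\<close>

section \<open>Calculus of smooth maps\<close>

text \<open>Invariance is what gives [X_i, Y_j] = 0: a field preserved by a flow commutes with its
  generator. The conditions on the Y_i are affine at each point, which is why they survive both a
  partition of unity and an average. Averaging one circle at a time needs integrals in one real
  variable only. Tangency to S is treated by scalar equations: if \<open>c\<close> is a foliated
  chart with model subspace \<open>W\<close>, the functions \<open>l \<bullet> c\<close> with
  \<open>l\<close> orthogonal to \<open>W\<close> are local first integrals, and the tangent vectors
  of S are those annihilated by all their differentials. One lemma then serves for S and for the
  level sets: if f has constant derivative along Y_1 and along Y_2, then [Y_1, Y_2] annihilates f.
  The Y_i are not made to commute; where X_1 and X_2 are dependent, the factor formed by them is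
  already zero. The obstacle throughout is that tangent vectors are read in selected charts that
  jump from point to point, so a field is differentiated only through its components
  \<open>differential A (map_of_chart c) x (Y x)\<close> in a fixed chart. The extension by zero is
  smooth because the supports of X_1 and X_2 are closed and lie in V.\<close>

abbreviation fd :: "('a::real_normed_vector \<Rightarrow> 'b::real_normed_vector) \<Rightarrow> 'a \<Rightarrow> 'a \<Rightarrow> 'b" where
  "fd f x \<equiv> frechet_derivative f (at x)"

lemma fd_eq: "(f has_derivative f') (at x) \<Longrightarrow> fd f x = f'"
  using frechet_derivative_at by metis

lemma fd_eq_on_open:
  assumes "open S" "x \<in> S" "\<And>y. y \<in> S \<Longrightarrow> f y = g y"
  shows "fd f x = fd g x"
proof -
  have "(f has_derivative D) (at x) \<longleftrightarrow> (g has_derivative D) (at x)" for D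
    using assms by (intro iffI) (auto elim!: has_derivative_transform_within_open)
  then show ?thesis by (simp add: frechet_derivative_def)
qed

text \<open>\<open>frechet_derivative\<close> is a Hilbert choice, so a derivative formula valid
  only on \<open>S\<close> does not match the definition of \<open>Ck_on\<close> literally. On an
  open set derivatives depend on germs; the inner congruence uses this to let any explicit
  derivative stand in for the chosen one.\<close>

lemma Ck_on_SucI:
  assumes "open S" "\<And>x. x \<in> S \<Longrightarrow> (f has_derivative f' x) (at x)"
    and "\<And>v. Ck_on k S (\<lambda>x. f' x v)"
  shows "Ck_on (Suc k) S f"
proof -
  have cong: "Ck_on k S g" if "Ck_on k S f" "\<And>x. x \<in> S \<Longrightarrow> f x = g x" for f g :: "'a \<Rightarrow> 'b"
    using that
  proof (induction k arbitrary: f g)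
    case 0
    then show ?case by (auto intro: continuous_on_eq)
  next
    case (Suc k)
    have "(g has_derivative fd f x) (at x)" if "x \<in> S" for x
      using Suc.prems(1) that Suc.prems(2) frechet_derivative_works
      by (intro has_derivative_transform_within_open[OF _ assms(1) that Suc.prems(2)]) auto
    moreover have "fd f x = fd g x" if "x \<in> S" for x
      using fd_eq_on_open[OF assms(1) that] Suc.prems by blast
    ultimately show ?case
      using Suc.IH[of "\<lambda>x. fd f x v" "\<lambda>x. fd g x v" for v] Suc.prems
      by (auto simp: differentiable_def)
  qed
  show ?thesis
    using assms fd_eq[OF assms(2)]
    by (auto simp: differentiable_def intro!: cong[OF assms(3)])
qed

lemma Ck_on_SucD:
  assumes "Ck_on (Suc k) S f"
  shows "x \<in> S \<Longrightarrow> (f has_derivative fd f x) (at x)" "Ck_on k S (\<lambda>x. fd f x v)"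
  using assms frechet_derivative_works by auto

lemma Ck_on_lower: "Ck_on (Suc k) S f \<Longrightarrow> Ck_on k S f"
proof (induction k arbitrary: f)
  case 0
  then show ?case
    by (auto intro!: continuous_at_imp_continuous_on differentiable_imp_continuous_within)
qed simp

lemma Ck_on_le: "Ck_on k S f \<Longrightarrow> j \<le> k \<Longrightarrow> Ck_on j S f"
  by (induction k) (auto elim!: le_SucE dest: Ck_on_lower simp del: Ck_on.simps(2))

lemma Ck_on_subset: "Ck_on k S f \<Longrightarrow> T \<subseteq> S \<Longrightarrow> Ck_on k T f"
  by (induction k arbitrary: f) (auto intro: continuous_on_subset)

lemma Ck_on_local:
  assumes "\<And>x. x \<in> S \<Longrightarrow> \<exists>U. open U \<and> x \<in> U \<and> Ck_on k U f"
  shows "Ck_on k S f"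
  using assms
proof (induction k arbitrary: f)
  case 0
  then show ?case
    by (auto intro!: continuous_at_imp_continuous_on simp: continuous_on_eq_continuous_at)
      (metis continuous_on_eq_continuous_at)
next
  case (Suc k)
  have "\<exists>U. open U \<and> x \<in> U \<and> Ck_on k U (\<lambda>x. fd f x v)" if "x \<in> S" for x v
    using Suc.prems[OF that] by auto
  then show ?case
    using Suc.IH Suc.prems by fastforce
qed

lemma Ck_on_cong:
  assumes "open S" "Ck_on k S f" "\<And>x. x \<in> S \<Longrightarrow> f x = g x"
  shows "Ck_on k S g"
proof (cases k)
  case 0
  then show ?thesis using assms by (auto intro: continuous_on_eq)
next
  case (Suc j)
  have "(g has_derivative fd f x) (at x)" if "x \<in> S" for x
    using assms that Suc Ck_on_SucD(1)
    by (metis has_derivative_transform_within_open)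
  then show ?thesis
    using Ck_on_SucI[OF assms(1)] assms(2) Suc by (metis Ck_on_SucD(2))
qed

lemma Ck_on_const: "open S \<Longrightarrow> Ck_on k S (\<lambda>x. c)"
  by (induction k arbitrary: c) (auto intro!: Ck_on_SucI[where f' = "\<lambda>x v. 0"] simp del: Ck_on.simps(2))

lemma Ck_on_bounded_linear_comp:
  assumes "open S" "bounded_linear L" "Ck_on k S f"
  shows "Ck_on k S (\<lambda>x. L (f x))"
  using assms(3)
proof (induction k arbitrary: f)
  case 0
  then show ?case by (auto intro: bounded_linear.continuous_on[OF assms(2)])
next
  case (Suc k)
  note D = Ck_on_SucD[OF Suc.prems]
  show ?case
    by (rule Ck_on_SucI[OF assms(1), where f' = "\<lambda>x v. L (fd f x v)"])
      (auto intro!: D Suc.IH bounded_linear.has_derivative[OF assms(2)])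
qed

lemma Ck_on_bounded_linear:
  assumes "open S" "bounded_linear L"
  shows "Ck_on k S L"
proof (cases k)
  case 0
  then show ?thesis by (auto intro: linear_continuous_on assms)
next
  case (Suc j)
  show ?thesis unfolding Suc
    by (rule Ck_on_SucI[OF assms(1), where f' = "\<lambda>x v. L v"])
      (auto intro!: bounded_linear_imp_has_derivative assms Ck_on_const)
qed

lemma Ck_on_add:
  assumes "open S" "Ck_on k S f" "Ck_on k S g"
  shows "Ck_on k S (\<lambda>x. f x + g x)"
  using assms(2,3)
proof (induction k arbitrary: f g)
  case 0
  then show ?case unfolding Ck_on.simps by (intro continuous_on_add)
next
  case (Suc k)
  note D = Ck_on_SucD[OF Suc.prems(1)] Ck_on_SucD[OF Suc.prems(2)]
  show ?case
    by (rule Ck_on_SucI[OF assms(1), where f' = "\<lambda>x v. fd f x v + fd g x v"])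
      (auto intro!: has_derivative_add D Suc.IH)
qed

lemma Ck_on_bilinear:
  assumes "open S" "bounded_bilinear B" "Ck_on k S f" "Ck_on k S g"
  shows "Ck_on k S (\<lambda>x. B (f x) (g x))"
  using assms(3,4)
proof (induction k arbitrary: f g)
  case 0
  then show ?case by (auto intro: bounded_bilinear.continuous_on[OF assms(2)])
next
  case (Suc k)
  note D = Ck_on_SucD[OF Suc.prems(1)] Ck_on_SucD[OF Suc.prems(2)]
  show ?case
    by (rule Ck_on_SucI[OF assms(1), where f' = "\<lambda>x v. B (f x) (fd g x v) + B (fd f x v) (g x)"])
      (auto intro!: bounded_bilinear.FDERIV[OF assms(2)] Ck_on_add[OF assms(1)] D Suc.IH Ck_on_lower[OF Suc.prems(1)] Ck_on_lower[OF Suc.prems(2)])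
qed

lemma Ck_on_sum:
  assumes "open S" "\<And>i. i \<in> I \<Longrightarrow> Ck_on k S (f i)"
  shows "Ck_on k S (\<lambda>x. \<Sum>i\<in>I. f i x)"
  using assms(2)
  by (induction I rule: infinite_finite_induct) (auto intro: Ck_on_const Ck_on_add assms(1))

lemma linear_basis_expansion:
  fixes L :: "'a::euclidean_space \<Rightarrow> 'b::real_vector"
  assumes "linear L"
  shows "L v = (\<Sum>b\<in>Basis. (v \<bullet> b) *\<^sub>R L b)"
proof -
  have "L v = L (\<Sum>b\<in>Basis. (v \<bullet> b) *\<^sub>R b)" by (simp add: euclidean_representation)
  also have "\<dots> = (\<Sum>b\<in>Basis. (v \<bullet> b) *\<^sub>R L b)"
    using assms by (simp add: linear_sum linear_scale)
  finally show ?thesis .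
qed

text \<open>The induction hypothesis covers derivatives of \<open>f\<close> in fixed directions,
  whereas in the chain rule the direction \<open>fd g x v\<close> moves with \<open>x\<close>.
  Expanding it in the basis leaves scalar coefficients times compositions of lower order.\<close>

lemma Ck_on_compose:
  fixes f :: "'b::euclidean_space \<Rightarrow> 'c::real_normed_vector" and g :: "'a::euclidean_space \<Rightarrow> 'b"
  assumes "open S" "Ck_on k T f" "Ck_on k S g" "g ` S \<subseteq> T"
  shows "Ck_on k S (\<lambda>x. f (g x))"
  using assms(2,3)
proof (induction k arbitrary: f)
  case 0
  then show ?case using assms(4) by (auto intro: continuous_on_compose2)
next
  case (Suc k)
  note D = Ck_on_SucD[OF Suc.prems(1)] Ck_on_SucD[OF Suc.prems(2)]
  have g: "g x \<in> T" if "x \<in> S" for x using assms(4) that by auto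
  have 1: "((\<lambda>x. f (g x)) has_derivative (\<lambda>v. fd f (g x) (fd g x v))) (at x)" if "x \<in> S" for x
    using diff_chain_at[OF D(3)[OF that] D(1)[OF g[OF that]]] by (simp add: o_def)
  have 2: "fd f (g x) (fd g x v) = (\<Sum>b\<in>Basis. (fd g x v \<bullet> b) *\<^sub>R fd f (g x) b)" if "x \<in> S" for x v
    using has_derivative_linear[OF D(1)[OF g[OF that]]] by (rule linear_basis_expansion)
  show ?case
  proof (rule Ck_on_SucI[OF assms(1) 1])
    have "Ck_on k S (\<lambda>x. \<Sum>b\<in>Basis. (fd g x v \<bullet> b) *\<^sub>R fd f (g x) b)" for v
      by (intro Ck_on_sum Ck_on_bilinear[OF assms(1) bounded_bilinear_scaleR] assms(1)
          Ck_on_bounded_linear_comp[OF assms(1) bounded_linear_inner_left] D Suc.IH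
          Ck_on_lower[OF Suc.prems(2)])
    then show "Ck_on k S (\<lambda>x. fd f (g x) (fd g x v))" for v
      by (rule Ck_on_cong[OF assms(1)]) (simp add: 2)
  qed
qed

lemma Ck_on_inverse:
  fixes f :: "'a::euclidean_space \<Rightarrow> real"
  assumes "open S" "Ck_on k S f" "\<And>x. x \<in> S \<Longrightarrow> f x \<noteq> 0"
  shows "Ck_on k S (\<lambda>x. inverse (f x))"
  using assms(2)
proof (induction k)
  case 0
  then show ?case unfolding Ck_on.simps using assms(3) by (intro continuous_on_inverse) auto
next
  case (Suc k)
  note D = Ck_on_SucD[OF Suc.prems]
  note M = Ck_on_bilinear[OF assms(1) bounded_bilinear_mult]
  have *: "Ck_on k S (\<lambda>x. - (inverse (f x) * fd f x v * inverse (f x)))" for v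
    by (intro Ck_on_bounded_linear_comp[OF assms(1) bounded_linear_minus[OF bounded_linear_ident]] M
        Suc.IH D Ck_on_lower[OF Suc.prems])
  show ?case
    by (rule Ck_on_SucI[OF assms(1) Deriv.has_derivative_inverse[OF assms(3) D(1)] *])
qed

lemma smooth_on_imp_Ck_on: "smooth_on S f \<Longrightarrow> Ck_on k S f"
  by (simp add: smooth_on_def)

lemma smooth_on_has_derivative: "smooth_on S f \<Longrightarrow> x \<in> S \<Longrightarrow> (f has_derivative fd f x) (at x)"
  by (rule Ck_on_SucD(1)[OF smooth_on_imp_Ck_on])

lemma smooth_on_differentiable: "smooth_on S f \<Longrightarrow> x \<in> S \<Longrightarrow> f differentiable (at x)"
  using smooth_on_has_derivative differentiable_def by blast

lemma smooth_on_fd: "smooth_on S f \<Longrightarrow> smooth_on S (\<lambda>x. fd f x v)"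
  unfolding smooth_on_def[of S "\<lambda>x. fd f x v"] by (intro allI Ck_on_SucD(2) smooth_on_imp_Ck_on)

lemma smooth_on_imp_continuous_on: "smooth_on S f \<Longrightarrow> continuous_on S f"
  using smooth_on_imp_Ck_on[of S f 0] by simp

lemma smooth_onI:
  assumes "open S" "\<And>x. x \<in> S \<Longrightarrow> (f has_derivative f' x) (at x)"
    and "\<And>v. smooth_on S (\<lambda>x. f' x v)"
  shows "smooth_on S f"
  unfolding smooth_on_def
  by (rule allI, rule Ck_on_lower, rule Ck_on_SucI[OF assms(1,2) smooth_on_imp_Ck_on[OF assms(3)]])

lemma smooth_on_subset: "smooth_on S f \<Longrightarrow> T \<subseteq> S \<Longrightarrow> smooth_on T f"
  unfolding smooth_on_def by (auto intro: Ck_on_subset)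

lemma smooth_on_local:
  assumes "\<And>x. x \<in> S \<Longrightarrow> \<exists>U. open U \<and> x \<in> U \<and> smooth_on U f"
  shows "smooth_on S f"
  unfolding smooth_on_def
proof (rule allI, rule Ck_on_local)
  fix k x assume "x \<in> S"
  then show "\<exists>U. open U \<and> x \<in> U \<and> Ck_on k U f"
    using assms smooth_on_imp_Ck_on by metis
qed

lemma smooth_on_cong:
  "open S \<Longrightarrow> smooth_on S f \<Longrightarrow> (\<And>x. x \<in> S \<Longrightarrow> f x = g x) \<Longrightarrow> smooth_on S g"
  unfolding smooth_on_def by (rule allI, rule Ck_on_cong[of S _ f]) auto

lemma smooth_on_const: "open S \<Longrightarrow> smooth_on S (\<lambda>x. c)"
  by (simp add: smooth_on_def Ck_on_const)

lemma smooth_on_bounded_linear_comp: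
  "open S \<Longrightarrow> bounded_linear L \<Longrightarrow> smooth_on S f \<Longrightarrow> smooth_on S (\<lambda>x. L (f x))"
  by (simp add: smooth_on_def Ck_on_bounded_linear_comp)

lemma smooth_on_bounded_linear: "open S \<Longrightarrow> bounded_linear L \<Longrightarrow> smooth_on S L"
  by (simp add: smooth_on_def Ck_on_bounded_linear)

lemma smooth_on_add: "open S \<Longrightarrow> smooth_on S f \<Longrightarrow> smooth_on S g \<Longrightarrow> smooth_on S (\<lambda>x. f x + g x)"
  by (simp add: smooth_on_def Ck_on_add)

lemma smooth_on_bilinear:
  "open S \<Longrightarrow> bounded_bilinear B \<Longrightarrow> smooth_on S f \<Longrightarrow> smooth_on S g \<Longrightarrow> smooth_on S (\<lambda>x. B (f x) (g x))"
  by (simp add: smooth_on_def Ck_on_bilinear)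

lemma smooth_on_sum:
  "open S \<Longrightarrow> (\<And>i. i \<in> I \<Longrightarrow> smooth_on S (f i)) \<Longrightarrow> smooth_on S (\<lambda>x. \<Sum>i\<in>I. f i x)"
  by (simp add: smooth_on_def Ck_on_sum)

lemma smooth_on_inverse:
  "open S \<Longrightarrow> smooth_on S f \<Longrightarrow> (\<And>x. x \<in> S \<Longrightarrow> f x \<noteq> 0) \<Longrightarrow> smooth_on S (\<lambda>x. inverse (f x) :: real)"
  by (simp add: smooth_on_def Ck_on_inverse)

lemma smooth_on_compose:
  fixes f :: "'b::euclidean_space \<Rightarrow> 'c::real_normed_vector" and g :: "'a::euclidean_space \<Rightarrow> 'b"
  shows "open S \<Longrightarrow> smooth_on T f \<Longrightarrow> smooth_on S g \<Longrightarrow> g ` S \<subseteq> T \<Longrightarrow> smooth_on S (\<lambda>x. f (g x))"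
  unfolding smooth_on_def by (rule allI, rule Ck_on_compose[where T = T]) auto

lemma smooth_on_Pair:
  assumes "open S" "smooth_on S f" "smooth_on S g"
  shows "smooth_on S (\<lambda>x. (f x, g x))"
proof -
  have "smooth_on S (\<lambda>x. (f x, 0) + (0, g x))"
    by (rule smooth_on_add[OF assms(1)
          smooth_on_bounded_linear_comp[OF assms(1) bounded_linear_Pair[OF bounded_linear_ident bounded_linear_zero] assms(2)]
          smooth_on_bounded_linear_comp[OF assms(1) bounded_linear_Pair[OF bounded_linear_zero bounded_linear_ident] assms(3)]])
  then show ?thesis by simp
qed

lemma smooth_on_scaleR:
  assumes "open S" "smooth_on S f" "smooth_on S g"
  shows "smooth_on S (\<lambda>x. f x *\<^sub>R g x)"
  using smooth_on_bilinear[OF assms(1) bounded_bilinear_scaleR assms(2,3)] .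

lemma smooth_on_mult:
  fixes f g :: "'a::euclidean_space \<Rightarrow> real"
  assumes "open S" "smooth_on S f" "smooth_on S g"
  shows "smooth_on S (\<lambda>x. f x * g x)"
  using smooth_on_bilinear[OF assms(1) bounded_bilinear_mult assms(2,3)] .

lemma smooth_on_minus:
  assumes "open S" "smooth_on S f"
  shows "smooth_on S (\<lambda>x. - f x)"
  using smooth_on_bounded_linear_comp[OF assms(1) bounded_linear_minus[OF bounded_linear_ident] assms(2)] .

lemma smooth_on_diff:
  assumes "open S" "smooth_on S f" "smooth_on S g"
  shows "smooth_on S (\<lambda>x. f x - g x)"
  using smooth_on_add[OF assms(1,2) smooth_on_minus[OF assms(1,3)]] by simp

text \<open>Base point and direction both vary. Components of generators and of pulled back fields
  have this form.\<close>

lemma smooth_on_fd_apply: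
  fixes f :: "'b::euclidean_space \<Rightarrow> 'c::real_normed_vector" and u w :: "'a::euclidean_space \<Rightarrow> 'b"
  assumes "open S" "smooth_on T f" "smooth_on S u" "u ` S \<subseteq> T" "smooth_on S w"
  shows "smooth_on S (\<lambda>x. fd f (u x) (w x))"
proof (rule smooth_on_cong[OF assms(1)])
  show "smooth_on S (\<lambda>x. \<Sum>b\<in>Basis. (w x \<bullet> b) *\<^sub>R fd f (u x) b)"
    using assms
    by (intro smooth_on_sum smooth_on_scaleR smooth_on_compose[OF _ smooth_on_fd]
        smooth_on_bounded_linear_comp[OF _ bounded_linear_inner_left]) auto
  show "(\<Sum>b\<in>Basis. (w x \<bullet> b) *\<^sub>R fd f (u x) b) = fd f (u x) (w x)" if "x \<in> S" for x
    using assms that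
    by (intro linear_basis_expansion[symmetric] has_derivative_linear[OF smooth_on_has_derivative]) auto
qed

lemma fd_compose:
  fixes f :: "'b::euclidean_space \<Rightarrow> 'c::real_normed_vector" and g :: "'a::euclidean_space \<Rightarrow> 'b"
  assumes "f differentiable (at (g x))" "g differentiable (at x)"
  shows "fd (\<lambda>x. f (g x)) x v = fd f (g x) (fd g x v)"
  using frechet_derivative_compose[OF assms(2,1)] by (simp add: o_def)

section \<open>Differentiation under the integral sign and symmetry of second derivatives\<close>

lemma has_derivative_integral:
  fixes F :: "real \<times> 'a::euclidean_space \<Rightarrow> 'b::banach"
  assumes "open \<Omega>" "open U" "Ck_on 1 \<Omega> F" "{a..b} \<times> U \<subseteq> \<Omega>" "p \<in> U"
  shows "((\<lambda>p. integral {a..b} (\<lambda>t. F (t, p))) has_derivative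
     (\<lambda>v. integral {a..b} (\<lambda>t. fd F (t, p) (0, v)))) (at p)"
proof -
  obtain r where r: "r > 0" "ball p r \<subseteq> U"
    using assms(2,5) open_contains_ball by blast
  note D = Ck_on_SucD[OF assms(3)[unfolded One_nat_def]]
  have dF: "((\<lambda>p. F (t, p)) has_derivative (\<lambda>v. fd F (t, q) (0, v))) (at q)" if "(t, q) \<in> \<Omega>" for t q
    by (rule has_derivative_compose[OF has_derivative_Pair[OF has_derivative_const has_derivative_ident] D(1)[OF that]])
  have bl: "bounded_linear (\<lambda>v. fd F (t, q) (0, v))" if "(t, q) \<in> \<Omega>" for t q
    using dF[OF that] by (rule has_derivative_bounded_linear)
  \<comment> \<open>\<open>leibniz_rule\<close> asks for a continuous family of bounded linear maps.
    In finite dimension continuity of \<open>L\<close> follows from that of its values on basis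
    vectors, each of which is a partial derivative of \<open>F\<close>.\<close>
  define L where "L = (\<lambda>q t. Blinfun (\<lambda>v. fd F (t, q) (0, v)))"
  have L: "blinfun_apply (L q t) v = fd F (t, q) (0, v)" if "(t, q) \<in> \<Omega>" for t q v
    using bl[OF that] by (simp add: L_def bounded_linear_Blinfun_apply)
  have sub: "(t, q) \<in> \<Omega>" if "q \<in> ball p r" "t \<in> {a..b}" for q t
    using assms(4) r(2) that by blast
  have contF: "continuous_on \<Omega> F" using Ck_on_lower[of 0 \<Omega> F] assms(3) by simp
  have cont: "continuous_on (ball p r \<times> {a..b}) (\<lambda>z. L (fst z) (snd z))"
  proof (rule continuous_on_blinfun_componentwise)
    fix i :: 'a
    have "continuous_on \<Omega> (\<lambda>z. fd F z (0, i))" using D(2) by simp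
    then have "continuous_on (ball p r \<times> {a..b}) (\<lambda>z. fd F (snd z, fst z) (0, i))"
    proof (rule continuous_on_compose2)
      show "continuous_on (ball p r \<times> {a..b}) (\<lambda>z. (snd z, fst z))"
        by (intro continuous_intros)
    qed (use sub in auto)
    then show "continuous_on (ball p r \<times> {a..b}) (\<lambda>z. blinfun_apply (L (fst z) (snd z)) i)"
      by (rule continuous_on_eq) (auto simp: L sub)
  qed
  have int: "L p integrable_on {a..b}"
  proof (rule integrable_continuous_real)
    show "continuous_on {a..b} (L p)"
      by (rule continuous_on_compose2[OF cont continuous_on_Pair[OF continuous_on_const continuous_on_id],
          of p "{a..b}", simplified fst_conv snd_conv]) (use r in auto)
  qed
  have "((\<lambda>p. integral (cbox a b) (\<lambda>t. F (t, p))) has_derivative blinfun_apply (integral (cbox a b) (L p)))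
     (at p within ball p r)"
  proof (rule leibniz_rule)
    show "((\<lambda>x. F (t, x)) has_derivative blinfun_apply (L q t)) (at q within ball p r)"
      if "q \<in> ball p r" "t \<in> cbox a b" for q t
    proof -
      have "(t, q) \<in> \<Omega>" using sub that by simp
      then have "blinfun_apply (L q t) = (\<lambda>v. fd F (t, q) (0, v))" using L by (intro ext) auto
      then show ?thesis using dF[OF \<open>(t, q) \<in> \<Omega>\<close>] by (simp add: has_derivative_at_withinI)
    qed
    show "(\<lambda>t. F (t, q)) integrable_on cbox a b" if "q \<in> ball p r" for q
    proof (unfold interval_cbox[symmetric], rule integrable_continuous_real)
      show "continuous_on {a..b} (\<lambda>t. F (t, q))"
        using sub that
        by (intro continuous_on_compose2[OF contF continuous_on_Pair[OF continuous_on_id continuous_on_const]])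
          auto
    qed
    show "continuous_on (ball p r \<times> cbox a b) (\<lambda>(x, t). L x t)"
      using cont by (simp add: case_prod_beta')
  qed (use r in auto)
  moreover have "blinfun_apply (integral {a..b} (L p)) = (\<lambda>v. integral {a..b} (\<lambda>t. fd F (t, p) (0, v)))"
  proof
    show "blinfun_apply (integral {a..b} (L p)) v = integral {a..b} (\<lambda>t. fd F (t, p) (0, v))" for v
      unfolding blinfun_apply_integral[OF int]
      by (rule integral_cong) (use L sub r in auto)
  qed
  ultimately show ?thesis
    using r at_within_open[of p "ball p r"] by simp
qed

text \<open>One order of differentiability is spent: the base case obtains continuity of the
  integral from its differentiability. For smooth integrands the loss is harmless.\<close>

lemma Ck_on_integral:
  fixes F :: "real \<times> 'a::euclidean_space \<Rightarrow> 'b::banach"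
  assumes "open \<Omega>" "open U" "Ck_on (Suc k) \<Omega> F" "{a..b} \<times> U \<subseteq> \<Omega>"
  shows "Ck_on k U (\<lambda>p. integral {a..b} (\<lambda>t. F (t, p)))"
  using assms(3)
proof (induction k arbitrary: F)
  case 0
  then have "Ck_on 1 \<Omega> F" by (simp only: One_nat_def)
  then have "isCont (\<lambda>p. integral {a..b} (\<lambda>t. F (t, p))) p" if "p \<in> U" for p
    using has_derivative_continuous[OF has_derivative_integral[OF assms(1,2) _ assms(4) that]] by blast
  then show ?case
    by (simp add: continuous_at_imp_continuous_on)
next
  case (Suc k)
  note D = Ck_on_SucD[OF Suc.prems]
  have F1: "Ck_on 1 \<Omega> F"
    by (rule Ck_on_le[OF Suc.prems]) simp
  show ?case
    by (rule Ck_on_SucI[OF assms(2) has_derivative_integral[OF assms(1,2) F1 assms(4)] Suc.IH[OF D(2)]])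
qed

lemma smooth_on_integral:
  fixes F :: "real \<times> 'a::euclidean_space \<Rightarrow> 'b::banach"
  assumes "open \<Omega>" "open U" "smooth_on \<Omega> F" "{a..b} \<times> U \<subseteq> \<Omega>"
  shows "smooth_on U (\<lambda>p. integral {a..b} (\<lambda>t. F (t, p)))"
  unfolding smooth_on_def
  by (rule allI, rule Ck_on_integral[OF assms(1,2) smooth_on_imp_Ck_on[OF assms(3)] assms(4)])

text \<open>Differentiate \<open>g (s, t) - g (0, t) = \<integral>\<^sub>0\<^sup>s \<partial>\<^sub>1 g (\<sigma>, t) d\<sigma>\<close> under the integral sign with respect
  to \<open>t\<close> at \<open>0\<close>, and the result with respect to \<open>s\<close> at \<open>0\<close>.\<close>

lemma mixed_derivative_plane:
  fixes g :: "real \<times> real \<Rightarrow> 'b::banach"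
  assumes "open S" "smooth_on S g" "0 \<in> S"
  shows "fd (\<lambda>z. fd g z (1, 0)) 0 (0, 1) = fd (\<lambda>z. fd g z (0, 1)) 0 (1, 0)"
proof -
  obtain A B where AB: "open A" "open B" "0 \<in> A" "0 \<in> B" "A \<times> B \<subseteq> S"
    using open_prod_elim[OF assms(1,3)] unfolding zero_prod_def by (metis mem_Sigma_iff)
  obtain e where e: "e > 0" "cball 0 e \<subseteq> A"
    using AB open_contains_cball by blast
  have sub: "{0..s} \<times> B \<subseteq> S" if "s \<le> e" for s
  proof -
    have "{0..s} \<subseteq> A" using e that by (auto simp: subset_iff dist_norm)
    then show ?thesis using AB by blast
  qed
  define F where "F = (\<lambda>z. fd g z (1, 0))"
  define G where "G = (\<lambda>z. fd g z (0, 1))"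
  have F: "smooth_on S F" and G: "smooth_on S G"
    unfolding F_def G_def by (intro smooth_on_fd assms)+
  have D1: "((\<lambda>s. k (s, p)) has_vector_derivative fd k (s, p) (1, 0)) (at s)"
    if "smooth_on S k" "(s, p) \<in> S" for k :: "real \<times> real \<Rightarrow> 'b" and s p
  proof -
    note K = smooth_on_has_derivative[OF that]
    have "((\<lambda>s. k (s, p)) has_derivative (\<lambda>v. fd k (s, p) (v, 0))) (at s)"
      by (rule has_derivative_compose[OF has_derivative_Pair[OF has_derivative_ident has_derivative_const] K])
    moreover have "(\<lambda>v. fd k (s, p) (v, 0)) = (\<lambda>v. v *\<^sub>R fd k (s, p) (1, 0))"
    proof
      show "fd k (s, p) (v, 0) = v *\<^sub>R fd k (s, p) (1, 0)" for v
        using linear_scale[OF has_derivative_linear[OF K], of v "(1, 0)"] by simp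
    qed
    ultimately show ?thesis by (simp only: has_vector_derivative_def)
  qed
  have D2: "((\<lambda>p. k (s, p)) has_vector_derivative fd k (s, p) (0, 1)) (at p)"
    if "smooth_on S k" "(s, p) \<in> S" for k :: "real \<times> real \<Rightarrow> 'b" and s p
  proof -
    note K = smooth_on_has_derivative[OF that]
    have "((\<lambda>p. k (s, p)) has_derivative (\<lambda>v. fd k (s, p) (0, v))) (at p)"
      by (rule has_derivative_compose[OF has_derivative_Pair[OF has_derivative_const has_derivative_ident] K])
    moreover have "(\<lambda>v. fd k (s, p) (0, v)) = (\<lambda>v. v *\<^sub>R fd k (s, p) (0, 1))"
    proof
      show "fd k (s, p) (0, v) = v *\<^sub>R fd k (s, p) (0, 1)" for v
        using linear_scale[OF has_derivative_linear[OF K], of v "(0, 1)"] by simp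
    qed
    ultimately show ?thesis by (simp only: has_vector_derivative_def)
  qed
  have I: "integral {0..s} (\<lambda>t. F (t, p)) = g (s, p) - g (0, p)" if "0 \<le> s" "s \<le> e" "p \<in> B" for s p
  proof (rule integral_unique, rule fundamental_theorem_of_calculus)
    fix t assume "t \<in> {0..s}"
    then have "(t, p) \<in> S" using sub[of s] that by auto
    then show "((\<lambda>s. g (s, p)) has_vector_derivative F (t, p)) (at t within {0..s})"
      unfolding F_def by (rule has_vector_derivative_at_within[OF D1[OF assms(2)]])
  qed (use that in auto)
  have J: "integral {0..s} (\<lambda>t. fd F (t, 0) (0, 1)) = G (s, 0) - G (0, 0)" if "0 \<le> s" "s \<le> e" for s
  proof -
    have "((\<lambda>p. integral {0..s} (\<lambda>t. F (t, p))) has_derivative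
       (\<lambda>v. integral {0..s} (\<lambda>t. fd F (t, 0) (0, v)))) (at 0)"
      by (rule has_derivative_integral[OF assms(1) AB(2) smooth_on_imp_Ck_on[OF F] sub[OF that(2)] AB(4)])
    then have 1: "((\<lambda>p. g (s, p) - g (0, p)) has_derivative
       (\<lambda>v. integral {0..s} (\<lambda>t. fd F (t, 0) (0, v)))) (at 0)"
      by (rule has_derivative_transform_within_open[OF _ AB(2,4)]) (use I that in auto)
    have "(s, 0) \<in> S" "(0, 0) \<in> S" using sub[OF that(2)] AB that by auto
    then have "((\<lambda>p. g (s, p) - g (0, p)) has_vector_derivative (G (s, 0) - G (0, 0))) (at 0)"
      unfolding G_def by (intro has_vector_derivative_diff D2[OF assms(2)])
    then have 2: "((\<lambda>p. g (s, p) - g (0, p)) has_derivative (\<lambda>v. v *\<^sub>R (G (s, 0) - G (0, 0)))) (at 0)"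
      by (simp add: has_vector_derivative_def)
    show ?thesis using fun_cong[OF has_derivative_unique[OF 1 2], of 1] by simp
  qed
  \<comment> \<open>The integral over \<open>{0..s}\<close> informs only about s \<ge> 0, so the
    comparison in \<open>s\<close> is between one-sided derivatives at the endpoint 0 of
    \<open>{0..e}\<close>, which are still unique.\<close>
  have S0: "(s, 0) \<in> S" if "s \<in> {0..e}" for s using sub[of e] AB that by auto
  have "continuous_on S (\<lambda>z. fd F z (0, 1))"
    by (intro smooth_on_imp_continuous_on smooth_on_fd F)
  then have "continuous_on {0..e} (\<lambda>s. fd F (s, 0) (0, 1))"
    by (rule continuous_on_compose2) (use S0 in \<open>auto intro!: continuous_intros\<close>)
  then have "((\<lambda>s. integral {0..s} (\<lambda>t. fd F (t, 0) (0, 1))) has_vector_derivative fd F (0, 0) (0, 1))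
     (at 0 within {0..e})"
    using e by (intro integral_has_vector_derivative) auto
  then have 1: "((\<lambda>s. G (s, 0) - G (0, 0)) has_vector_derivative fd F (0, 0) (0, 1)) (at 0 within {0..e})"
    by (rule has_vector_derivative_transform[rotated 2]) (use e J in auto)
  have "((\<lambda>s. G (s, 0) - G (0, 0)) has_vector_derivative fd G (0, 0) (1, 0) - 0) (at 0)"
    using S0[of 0] e by (intro has_vector_derivative_diff D1[OF G]) auto
  then have 2: "((\<lambda>s. G (s, 0) - G (0, 0)) has_vector_derivative fd G (0, 0) (1, 0)) (at 0 within {0..e})"
    by (simp add: has_vector_derivative_at_within)
  show ?thesis
    using vector_derivative_unique_within_closed_interval[of 0 e 0, OF _ _ 1[unfolded interval_cbox] 2[unfolded interval_cbox]] e
    by (simp add: F_def G_def zero_prod_def)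
qed

text \<open>Pull \<open>f\<close> back along the affine map (s, t) \<mapsto> x + s v + t w: the
  derivatives in the directions \<open>v\<close> and \<open>w\<close> become the two partial
  derivatives in the plane.\<close>

lemma smooth_on_fd_commute:
  fixes f :: "'a::euclidean_space \<Rightarrow> 'b::banach"
  assumes "open S" "smooth_on S f" "x \<in> S"
  shows "fd (\<lambda>y. fd f y v) x w = fd (\<lambda>y. fd f y w) x v"
proof -
  define A where "A = (\<lambda>z::real \<times> real. x + (fst z *\<^sub>R v + snd z *\<^sub>R w))"
  define \<Omega> where "\<Omega> = A -` S"
  have dA: "(A has_derivative (\<lambda>z. fst z *\<^sub>R v + snd z *\<^sub>R w)) (at z)" for z
    unfolding A_def by (auto intro!: derivative_eq_intros)
  have "continuous_on UNIV A" unfolding A_def by (intro continuous_intros)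
  then have o: "open \<Omega>" unfolding \<Omega>_def using assms(1) by (simp add: open_vimage)
  have sA: "smooth_on \<Omega> A"
    by (rule smooth_onI[OF o dA]) (rule smooth_on_const[OF o])
  have g: "smooth_on \<Omega> (\<lambda>z. f (A z))"
    by (rule smooth_on_compose[OF o assms(2) sA]) (auto simp: \<Omega>_def)
  have 0: "0 \<in> \<Omega>" "A 0 = x" using assms(3) by (auto simp: \<Omega>_def A_def)
  have chain: "fd (\<lambda>z. k (A z)) z u = fd k (A z) (fst u *\<^sub>R v + snd u *\<^sub>R w)"
    if "smooth_on S k" "z \<in> \<Omega>" for k :: "'a \<Rightarrow> 'b" and z u
    using fd_compose[of k A z] smooth_on_differentiable[OF that(1), of "A z"] that(2)
      smooth_on_differentiable[OF sA that(2)] fd_eq[OF dA] by (simp add: \<Omega>_def)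
  have "fd (\<lambda>z. fd (\<lambda>z. f (A z)) z (1, 0)) 0 (0, 1) = fd (\<lambda>z. fd f (A z) v) 0 (0, 1)"
    by (rule fun_cong[OF fd_eq_on_open[OF o 0(1)]]) (simp add: chain assms)
  also have "\<dots> = fd (\<lambda>y. fd f y v) x w"
    using chain[OF smooth_on_fd[OF assms(2)] 0(1)] by (simp add: 0)
  finally have 1: "fd (\<lambda>z. fd (\<lambda>z. f (A z)) z (1, 0)) 0 (0, 1) = fd (\<lambda>y. fd f y v) x w" .
  have "fd (\<lambda>z. fd (\<lambda>z. f (A z)) z (0, 1)) 0 (1, 0) = fd (\<lambda>z. fd f (A z) w) 0 (1, 0)"
    by (rule fun_cong[OF fd_eq_on_open[OF o 0(1)]]) (simp add: chain assms)
  also have "\<dots> = fd (\<lambda>y. fd f y w) x v"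
    using chain[OF smooth_on_fd[OF assms(2)] 0(1)] by (simp add: 0)
  finally show ?thesis
    using 1 mixed_derivative_plane[OF o g 0(1)] by simp
qed

section \<open>Bump functions\<close>

text \<open>The classical flat function exp(-1/t) is the case n = 0. The powers of 1/t are carried
  along so that derivatives stay in the linear span of the family.\<close>

definition flat_exp :: "nat \<Rightarrow> real \<Rightarrow> real" where
  "flat_exp n t = (if t > 0 then exp (- inverse t) * inverse t ^ n else 0)"

lemma tendsto_flat_exp: "(flat_exp n \<longlongrightarrow> 0) (at 0)"
proof (rule filterlim_split_at_real)
  show "(flat_exp n \<longlongrightarrow> 0) (at_left 0)"
    by (rule tendsto_eventually) (auto simp: flat_exp_def eventually_at_filter)
  have "((\<lambda>t. inverse t ^ n / exp (inverse t)) \<longlongrightarrow> (0::real)) (at_right 0)"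
    by (rule filterlim_compose[OF tendsto_power_div_exp_0 filterlim_inverse_at_top_right])
  then show "(flat_exp n \<longlongrightarrow> 0) (at_right 0)"
    by (rule Lim_transform_eventually)
      (auto simp: flat_exp_def eventually_at_filter exp_minus field_simps)
qed

lemma flat_exp_has_derivative:
  "(flat_exp n has_real_derivative (flat_exp (n + 2) t - n * flat_exp (n + 1) t)) (at t)"
proof (cases t "0::real" rule: linorder_cases)
  case less
  have "((\<lambda>t. 0) has_real_derivative (flat_exp (n + 2) t - n * flat_exp (n + 1) t)) (at t)"
    using less by (simp add: flat_exp_def)
  then show ?thesis
    by (rule has_field_derivative_transform_within_open[of _ _ _ "{..<0}"])
      (use less in \<open>auto simp: flat_exp_def\<close>)
next
  case greater
  have "((\<lambda>t. exp (- inverse t) * inverse t ^ n) has_real_derivative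
      exp (- inverse t) * (inverse t * inverse t) * inverse t ^ n
      - exp (- inverse t) * (real n * (inverse t ^ (n - Suc 0) * (inverse t * inverse t)))) (at t)"
    using greater by (auto intro!: derivative_eq_intros)
  then have "((\<lambda>t. exp (- inverse t) * inverse t ^ n) has_real_derivative
      (flat_exp (n + 2) t - n * flat_exp (n + 1) t)) (at t)"
    using greater by (cases n) (simp_all add: flat_exp_def algebra_simps)
  then show ?thesis
    by (rule has_field_derivative_transform_within_open[of _ _ _ "{0<..}"])
      (use greater in \<open>auto simp: flat_exp_def\<close>)
next
  case equal
  \<comment> \<open>At 0 the difference quotient of \<open>flat_exp n\<close> is
    \<open>flat_exp (Suc n)\<close>, and both terms of the claimed derivative are 0 there.\<close>
  have "((\<lambda>h. flat_exp n h / h) \<longlongrightarrow> 0) (at 0)"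
    by (rule Lim_transform_eventually[OF tendsto_flat_exp[of "Suc n"]])
      (auto simp: flat_exp_def eventually_at_filter field_simps)
  then show ?thesis
    using equal by (simp add: has_field_derivative_iff) (simp add: flat_exp_def)
qed

lemma smooth_on_flat_exp: "smooth_on UNIV (flat_exp n)"
  unfolding smooth_on_def
proof
  show "Ck_on k UNIV (flat_exp n)" for k
  proof (induction k arbitrary: n)
    case 0
    show ?case
      by (metis Ck_on.simps(1) DERIV_isCont continuous_at_imp_continuous_on flat_exp_has_derivative)
  next
    case (Suc k)
    have D: "(flat_exp n has_derivative (\<lambda>v. v * (flat_exp (n + 2) t + (- real n) * flat_exp (n + 1) t))) (at t)" for t
      using flat_exp_has_derivative[of n t] by (simp add: has_field_derivative_def mult_commute_abs)
    have "Ck_on k UNIV (\<lambda>t. v * (flat_exp (n + 2) t + (- real n) * flat_exp (n + 1) t))" for v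
      by (rule Ck_on_bounded_linear_comp[OF open_UNIV bounded_linear_mult_right Ck_on_add[OF open_UNIV Suc.IH
            Ck_on_bounded_linear_comp[OF open_UNIV bounded_linear_mult_right Suc.IH]]])
    then show ?case
      by (rule Ck_on_SucI[OF open_UNIV D])
  qed
qed

lemma bump_function:
  fixes p :: "'a::euclidean_space"
  assumes "r > 0"
  obtains \<phi> :: "'a \<Rightarrow> real" where "smooth_on UNIV \<phi>"
    "\<And>q. dist p q \<le> r \<Longrightarrow> \<phi> q = 1" "\<And>q. 2 * r \<le> dist p q \<Longrightarrow> \<phi> q = 0"
proof -
  \<comment> \<open>\<open>s\<close> is a smooth step, equal to 0 for t \<le> 0 and to 1 for t \<ge>
    1. \<open>u\<close> is affine in the squared distance, hence smooth also at \<open>p\<close>,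
    with value 1 at distance r and 0 at distance 2 r; the constant 3 is 4 - 1.\<close>
  define s where "s = (\<lambda>t. flat_exp 0 t * inverse (flat_exp 0 t + flat_exp 0 (1 + (- 1) * t)))"
  define u where "u = (\<lambda>q. (4 * r\<^sup>2 - (q - p) \<bullet> (q - p)) * inverse (3 * r\<^sup>2))"
  have pos: "flat_exp 0 t + flat_exp 0 (1 + (- 1) * t) > 0" for t
    by (auto simp: flat_exp_def intro: add_pos_pos)
  have 1: "smooth_on UNIV (\<lambda>t::real. 1 + (- 1) * t)"
    by (rule smooth_on_add[OF open_UNIV smooth_on_const[OF open_UNIV]
          smooth_on_bounded_linear[OF open_UNIV bounded_linear_mult_right]])
  have 2: "smooth_on UNIV (\<lambda>t. flat_exp 0 (1 + (- 1) * t))"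
    by (rule smooth_on_compose[OF open_UNIV smooth_on_flat_exp 1]) simp
  have s: "smooth_on UNIV s"
    unfolding s_def
    by (rule smooth_on_mult[OF open_UNIV smooth_on_flat_exp smooth_on_inverse[OF open_UNIV
            smooth_on_add[OF open_UNIV smooth_on_flat_exp 2]]]) (metis pos less_irrefl)
  have 3: "smooth_on UNIV (\<lambda>q. q - p)"
    by (rule smooth_on_diff[OF open_UNIV smooth_on_bounded_linear[OF open_UNIV bounded_linear_ident]
          smooth_on_const[OF open_UNIV]])
  have 4: "smooth_on UNIV (\<lambda>q. (q - p) \<bullet> (q - p))"
    by (rule smooth_on_bilinear[OF open_UNIV bounded_bilinear_inner 3 3])
  have "smooth_on UNIV (\<lambda>q. 4 * r\<^sup>2 - (q - p) \<bullet> (q - p))"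
    by (rule smooth_on_diff[OF open_UNIV smooth_on_const[OF open_UNIV] 4])
  then have u: "smooth_on UNIV u"
    unfolding u_def by (rule smooth_on_mult[OF open_UNIV _ smooth_on_const[OF open_UNIV]])
  have uq: "u q = (4 * r\<^sup>2 - (dist p q)\<^sup>2) / (3 * r\<^sup>2)" for q
  proof -
    have "(q - p) \<bullet> (q - p) = (dist p q)\<^sup>2"
      by (metis dist_norm norm_minus_commute power2_norm_eq_inner)
    then show ?thesis by (simp only: u_def divide_inverse)
  qed
  show thesis
  proof (rule that[of "\<lambda>q. s (u q)"])
    show "smooth_on UNIV (\<lambda>q. s (u q))"
      by (rule smooth_on_compose[OF open_UNIV s u]) simp
    show "s (u q) = 1" if "dist p q \<le> r" for q
    proof -
      have "(dist p q)\<^sup>2 \<le> r\<^sup>2" using that by (simp add: power_mono)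
      then have "u q \<ge> 1" using assms by (simp add: uq field_simps)
      then show ?thesis by (simp add: s_def flat_exp_def)
    qed
    show "s (u q) = 0" if "2 * r \<le> dist p q" for q
    proof -
      have "(2 * r)\<^sup>2 \<le> (dist p q)\<^sup>2" using that assms by (intro power_mono) auto
      then have "u q \<le> 0" using assms by (simp add: uq field_simps)
      then show ?thesis by (simp add: s_def flat_exp_def)
    qed
  qed
qed

section \<open>The Jacobi identity in coordinates\<close>

text \<open>The bivector Y1 \<and> X1 + Y2 \<and> X2. Covectors are plain functions so that bundled
  linear maps and bare derivatives \<open>fd F p\<close> can both be inserted, and the type of
  points is free so that the formula serves on the manifold and in coordinates.\<close>

definition wedge_sum ::
  "('p \<Rightarrow> 'a) \<Rightarrow> ('p \<Rightarrow> 'a) \<Rightarrow> ('p \<Rightarrow> 'a) \<Rightarrow> ('p \<Rightarrow> 'a) \<Rightarrow>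
   'p \<Rightarrow> ('a \<Rightarrow> real) \<Rightarrow> ('a \<Rightarrow> real) \<Rightarrow> real" where
  "wedge_sum X1 X2 Y1 Y2 x \<alpha> \<beta> =
     \<alpha> (Y1 x) * \<beta> (X1 x) - \<alpha> (X1 x) * \<beta> (Y1 x) + (\<alpha> (Y2 x) * \<beta> (X2 x) - \<alpha> (X2 x) * \<beta> (Y2 x))"

text \<open>\<open>XX\<close> and \<open>YX\<close> say that every bracket other than that of
  \<open>Y1\<close> and \<open>Y2\<close> vanishes, \<open>R\<close> is this remaining bracket, and
  the last assumption is the vanishing of R \<and> X1 \<and> X2 on f, g, h. For constant covectors
  the product rule brings in only first derivatives of the four fields, and after substitution a
  polynomial identity remains.\<close>

lemma coord_jacobi:
  fixes X1 X2 Y1 Y2 :: "'a::real_normed_vector \<Rightarrow> 'a" and f g h :: "'a \<Rightarrow>\<^sub>L real"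
  assumes diff: "X1 differentiable (at p)" "X2 differentiable (at p)"
      "Y1 differentiable (at p)" "Y2 differentiable (at p)"
    and XX: "fd X2 p (X1 p) = fd X1 p (X2 p)"
    and YX: "fd Y1 p (X1 p) = fd X1 p (Y1 p)" "fd Y1 p (X2 p) = fd X2 p (Y1 p)"
      "fd Y2 p (X1 p) = fd X1 p (Y2 p)" "fd Y2 p (X2 p) = fd X2 p (Y2 p)"
    and YY: "fd Y2 p (Y1 p) = fd Y1 p (Y2 p) + R"
    and R: "f R * (g (X1 p) * h (X2 p) - g (X2 p) * h (X1 p))
      + g R * (h (X1 p) * f (X2 p) - h (X2 p) * f (X1 p))
      + h R * (f (X1 p) * g (X2 p) - f (X2 p) * g (X1 p)) = 0"
  defines "P \<equiv> wedge_sum X1 X2 Y1 Y2"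
  shows "P p (fd (\<lambda>q. P q f g) p) h + P p (fd (\<lambda>q. P q g h) p) f + P p (fd (\<lambda>q. P q h f) p) g = 0"
proof -
  have D: "fd (\<lambda>q. P q a b) p v =
      a (fd Y1 p v) * b (X1 p) + a (Y1 p) * b (fd X1 p v) - (a (fd X1 p v) * b (Y1 p) + a (X1 p) * b (fd Y1 p v))
    + (a (fd Y2 p v) * b (X2 p) + a (Y2 p) * b (fd X2 p v) - (a (fd X2 p v) * b (Y2 p) + a (X2 p) * b (fd Y2 p v)))"
    for a b :: "'a \<Rightarrow>\<^sub>L real" and v
  proof -
    note d = diff[unfolded frechet_derivative_works]
    have "((\<lambda>q. P q a b) has_derivative (\<lambda>v.
      a (Y1 p) * b (fd X1 p v) + a (fd Y1 p v) * b (X1 p) - (a (X1 p) * b (fd Y1 p v) + a (fd X1 p v) * b (Y1 p))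
    + (a (Y2 p) * b (fd X2 p v) + a (fd Y2 p v) * b (X2 p) - (a (X2 p) * b (fd Y2 p v) + a (fd X2 p v) * b (Y2 p)))))
       (at p)"
      unfolding P_def wedge_sum_def
      by (intro has_derivative_add has_derivative_diff has_derivative_mult
          bounded_linear.has_derivative[OF blinfun.bounded_linear_right] d)
    from fd_eq[OF this] show ?thesis by (simp add: algebra_simps)
  qed
  show ?thesis
    using R unfolding P_def wedge_sum_def D[unfolded P_def wedge_sum_def] XX YX YY blinfun.add_right by algebra
qed

section \<open>Smooth functions on manifolds\<close>

text \<open>Foliated charts are required to be smoothly related to the atlas, not to belong to it,
  so the calculus has to accept every compatible chart.\<close>

definition compat_chart :: "('m::topological_space, 'e::euclidean_space) chart set \<Rightarrow> ('m, 'e) chart \<Rightarrow> bool" where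
  "compat_chart A c \<longleftrightarrow> is_chart c \<and> (\<forall>d\<in>A. smoothly_related c d)"

lemma
  assumes "is_chart c"
  shows open_chart_dom: "open (dom_of c)"
    and chart_inv_map: "x \<in> dom_of c \<Longrightarrow> chart_inv c (map_of_chart c x) = x"
    and continuous_on_chart: "continuous_on (dom_of c) (map_of_chart c)"
    and continuous_on_chart_inv: "continuous_on (map_of_chart c ` dom_of c) (chart_inv c)"
    and open_chart_image: "open U \<Longrightarrow> U \<subseteq> dom_of c \<Longrightarrow> open (map_of_chart c ` U)"
proof -
  have h: "homeomorphism (dom_of c) (map_of_chart c ` dom_of c) (map_of_chart c) (chart_inv c)"
    and o: "open (dom_of c)" "open (map_of_chart c ` dom_of c)"
    using assms by (auto simp: is_chart_def)
  show "open (dom_of c)" by (rule o)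
  show "x \<in> dom_of c \<Longrightarrow> chart_inv c (map_of_chart c x) = x"
    using h by (simp add: homeomorphism_def)
  show "continuous_on (dom_of c) (map_of_chart c)"
    "continuous_on (map_of_chart c ` dom_of c) (chart_inv c)"
    using h by (simp_all add: homeomorphism_def)
  show "open U \<Longrightarrow> U \<subseteq> dom_of c \<Longrightarrow> open (map_of_chart c ` U)"
    using homeomorphism_imp_open_map[OF h open_subset] openin_open_trans o(2) by blast
qed

lemma smooth_on_change_chart:
  fixes c d :: "('m::topological_space, 'e::euclidean_space) chart"
    and f :: "'m \<Rightarrow> 'b::real_normed_vector"
  assumes "is_chart c" "is_chart d" "smooth_on (overlap c d) (transition c d)"
    and "open N" "N \<subseteq> dom_of c" "N \<subseteq> dom_of d"
    and "smooth_on (map_of_chart d ` N) (f \<circ> chart_inv d)"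
  shows "smooth_on (map_of_chart c ` N) (f \<circ> chart_inv c)"
proof -
  have o: "open (map_of_chart c ` N)" by (rule open_chart_image[OF assms(1,4,5)])
  have inv: "chart_inv c (map_of_chart c x) = x" "chart_inv d (map_of_chart d x) = x" if "x \<in> N" for x
    using that assms chart_inv_map by blast+
  have "smooth_on (map_of_chart c ` N) (\<lambda>p. (f \<circ> chart_inv d) (transition c d p))"
  proof (rule smooth_on_compose[OF o assms(7)])
    show "smooth_on (map_of_chart c ` N) (transition c d)"
      by (rule smooth_on_subset[OF assms(3)]) (use assms in \<open>auto simp: overlap_def\<close>)
  qed (auto simp: transition_def inv)
  then show ?thesis
    by (rule smooth_on_cong[OF o]) (auto simp: transition_def inv)
qed

locale smooth_manifold =
  fixes A :: "('m::{t2_space, second_countable_topology}, 'e::euclidean_space) chart set"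
  assumes atlas: "smooth_atlas A"
begin

abbreviation chart_near :: "'m \<Rightarrow> ('m, 'e) chart" where "chart_near \<equiv> chart_at A"

lemma compat_atlas: "c \<in> A \<Longrightarrow> compat_chart A c"
  using atlas by (auto simp: smooth_atlas_def compat_chart_def)

lemma compat_is_chart: "compat_chart A c \<Longrightarrow> is_chart c"
  by (simp add: compat_chart_def)

lemmas chart_simps =
  chart_inv_map[OF compat_is_chart] open_chart_dom[OF compat_is_chart]

lemma chart_near: "chart_near x \<in> A" "x \<in> dom_of (chart_near x)"
proof -
  have "x \<in> (\<Union>c\<in>A. dom_of c)" using atlas by (simp add: smooth_atlas_def)
  then have "\<exists>c. c \<in> A \<and> x \<in> dom_of c" by blast
  from someI_ex[OF this] show "chart_near x \<in> A" "x \<in> dom_of (chart_near x)"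
    by (simp_all add: chart_at_def)
qed

lemma compat_chart_near: "compat_chart A (chart_near x)"
  using chart_near compat_atlas by blast

lemma open_chart_image_Int: "compat_chart A c \<Longrightarrow> open U \<Longrightarrow> open (map_of_chart c ` (dom_of c \<inter> U))"
  using open_chart_image open_chart_dom compat_is_chart by (metis inf_le1 open_Int)

definition msmooth :: "'m set \<Rightarrow> ('m \<Rightarrow> 'b::real_normed_vector) \<Rightarrow> bool" where
  "msmooth U f \<longleftrightarrow> (\<forall>c\<in>A. smooth_on (map_of_chart c ` (dom_of c \<inter> U)) (f \<circ> chart_inv c))"

lemma smooth_function_iff: "smooth_function A f \<longleftrightarrow> msmooth UNIV f"
  by (simp add: smooth_function_def msmooth_def)

lemma open_Int_chart: "open U \<Longrightarrow> c \<in> A \<Longrightarrow> open (U \<inter> dom_of c)"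
  by (intro open_Int chart_simps(2)[OF compat_atlas])

lemma msmooth_subset: "msmooth U f \<Longrightarrow> T \<subseteq> U \<Longrightarrow> msmooth T f"
  unfolding msmooth_def by (meson image_mono inf_mono order_refl smooth_on_subset)

text \<open>\<open>msmooth\<close> tests the charts of the atlas only; near each point the given
  chart is compared with the selected one.\<close>

lemma msmooth_compat:
  assumes "msmooth U f" "open U" "compat_chart A c"
  shows "smooth_on (map_of_chart c ` (dom_of c \<inter> U)) (f \<circ> chart_inv c)"
proof (rule smooth_on_local)
  fix p assume "p \<in> map_of_chart c ` (dom_of c \<inter> U)"
  then obtain x where x: "x \<in> dom_of c" "x \<in> U" "p = map_of_chart c x" by auto
  let ?d = "chart_near x"
  let ?N = "dom_of c \<inter> (dom_of ?d \<inter> U)"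
  have o: "open ?N" using assms compat_chart_near chart_simps(2) by (intro open_Int) blast+
  have "smooth_on (map_of_chart c ` ?N) (f \<circ> chart_inv c)"
  proof (rule smooth_on_change_chart[OF _ _ _ o])
    show "smooth_on (overlap c ?d) (transition c ?d)"
      using assms(3) chart_near(1) by (simp add: compat_chart_def smoothly_related_def)
    show "smooth_on (map_of_chart ?d ` ?N) (f \<circ> chart_inv ?d)"
      by (rule smooth_on_subset[of "map_of_chart ?d ` (dom_of ?d \<inter> U)"])
        (use assms(1) chart_near(1) in \<open>auto simp: msmooth_def\<close>)
  qed (use assms compat_chart_near compat_is_chart in auto)
  moreover have "p \<in> map_of_chart c ` ?N" using x chart_near(2) by auto
  moreover have "open (map_of_chart c ` ?N)"
    using assms(2,3) compat_chart_near by (intro open_chart_image_Int open_Int chart_simps(2))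
  ultimately show "\<exists>T. open T \<and> p \<in> T \<and> smooth_on T (f \<circ> chart_inv c)" by blast
qed

lemma msmoothI_local:
  assumes "\<And>x. x \<in> U \<Longrightarrow> \<exists>c N. compat_chart A c \<and> open N \<and> x \<in> N \<and> N \<subseteq> dom_of c \<and>
    smooth_on (map_of_chart c ` N) (f \<circ> chart_inv c)"
  shows "msmooth U f"
  unfolding msmooth_def
proof (intro ballI smooth_on_local)
  fix d p assume d: "d \<in> A" and "p \<in> map_of_chart d ` (dom_of d \<inter> U)"
  then obtain x where x: "x \<in> dom_of d" "x \<in> U" "p = map_of_chart d x" by auto
  obtain c N where N: "compat_chart A c" "open N" "x \<in> N" "N \<subseteq> dom_of c"
    "smooth_on (map_of_chart c ` N) (f \<circ> chart_inv c)"
    using assms[OF x(2)] by blast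
  have od: "open (dom_of d)" using d compat_atlas chart_simps(2) by blast
  have "smooth_on (map_of_chart d ` (dom_of d \<inter> N)) (f \<circ> chart_inv d)"
  proof (rule smooth_on_change_chart)
    show "is_chart d" "is_chart c" using N d compat_is_chart compat_atlas by blast+
    show "smooth_on (overlap d c) (transition d c)"
      using N d by (simp add: compat_chart_def smoothly_related_def)
    show "smooth_on (map_of_chart c ` (dom_of d \<inter> N)) (f \<circ> chart_inv c)"
      by (rule smooth_on_subset[OF N(5)]) auto
  qed (use N od in auto)
  moreover have "open (map_of_chart d ` (dom_of d \<inter> N))"
    using d N compat_atlas by (intro open_chart_image_Int) auto
  ultimately show "\<exists>T. open T \<and> p \<in> T \<and> smooth_on T (f \<circ> chart_inv d)" using x N(3) by blast
qed

lemma msmooth_local: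
  assumes "\<And>x. x \<in> U \<Longrightarrow> \<exists>N. open N \<and> x \<in> N \<and> msmooth N f"
  shows "msmooth U f"
proof (rule msmoothI_local)
  fix x assume "x \<in> U"
  then obtain N where N: "open N" "x \<in> N" "msmooth N f" using assms by blast
  have "smooth_on (map_of_chart (chart_near x) ` (dom_of (chart_near x) \<inter> N)) (f \<circ> chart_inv (chart_near x))"
    using N(3) chart_near(1) by (simp add: msmooth_def)
  moreover have "open (dom_of (chart_near x) \<inter> N)" "x \<in> dom_of (chart_near x) \<inter> N"
    using N chart_near(2) chart_simps(2)[OF compat_chart_near] by auto
  ultimately show "\<exists>c N. compat_chart A c \<and> open N \<and> x \<in> N \<and> N \<subseteq> dom_of c \<and>
    smooth_on (map_of_chart c ` N) (f \<circ> chart_inv c)"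
    using compat_chart_near by blast
qed

lemma msmooth_cong:
  assumes "open U" "msmooth U f" "\<And>x. x \<in> U \<Longrightarrow> f x = g x"
  shows "msmooth U g"
  unfolding msmooth_def
proof
  fix c assume c: "c \<in> A"
  show "smooth_on (map_of_chart c ` (dom_of c \<inter> U)) (g \<circ> chart_inv c)"
  proof (rule smooth_on_cong)
    show "smooth_on (map_of_chart c ` (dom_of c \<inter> U)) (f \<circ> chart_inv c)"
      using assms(2) c by (simp add: msmooth_def)
  qed (use assms c compat_atlas open_chart_image_Int chart_simps(1)[OF compat_atlas[OF c]] in auto)
qed

lemma msmooth_const: "open U \<Longrightarrow> msmooth U (\<lambda>x. a)"
  unfolding msmooth_def o_def by (auto intro!: smooth_on_const open_chart_image_Int compat_atlas)

lemma msmooth_add: "open U \<Longrightarrow> msmooth U f \<Longrightarrow> msmooth U g \<Longrightarrow> msmooth U (\<lambda>x. f x + g x)"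
  unfolding msmooth_def o_def by (auto intro!: smooth_on_add open_chart_image_Int compat_atlas)

lemma msmooth_diff: "open U \<Longrightarrow> msmooth U f \<Longrightarrow> msmooth U g \<Longrightarrow> msmooth U (\<lambda>x. f x - g x)"
  unfolding msmooth_def o_def by (auto intro!: smooth_on_diff open_chart_image_Int compat_atlas)

lemma msmooth_scaleR: "open U \<Longrightarrow> msmooth U f \<Longrightarrow> msmooth U g \<Longrightarrow> msmooth U (\<lambda>x. f x *\<^sub>R g x)"
  unfolding msmooth_def o_def by (auto intro!: smooth_on_scaleR open_chart_image_Int compat_atlas)

lemma msmooth_mult:
  fixes f g :: "'m \<Rightarrow> real"
  shows "open U \<Longrightarrow> msmooth U f \<Longrightarrow> msmooth U g \<Longrightarrow> msmooth U (\<lambda>x. f x * g x)"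
  using msmooth_scaleR[of U f g] by simp

lemma msmooth_prod:
  fixes f :: "'i \<Rightarrow> 'm \<Rightarrow> real"
  shows "open U \<Longrightarrow> (\<And>i. i \<in> I \<Longrightarrow> msmooth U (f i)) \<Longrightarrow> msmooth U (\<lambda>x. \<Prod>i\<in>I. f i x)"
  by (induction I rule: infinite_finite_induct) (auto intro: msmooth_const msmooth_mult)

lemma msmooth_bounded_linear:
  "open U \<Longrightarrow> bounded_linear L \<Longrightarrow> msmooth U f \<Longrightarrow> msmooth U (\<lambda>x. L (f x))"
  unfolding msmooth_def o_def
  by (rule ballI, rule smooth_on_bounded_linear_comp[where L = L]) (simp_all add: open_chart_image_Int compat_atlas)

lemma msmooth_compose:
  fixes f :: "'m \<Rightarrow> 'b::euclidean_space" and k :: "'b \<Rightarrow> 'c::real_normed_vector"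
  assumes "open U" "msmooth U f" "smooth_on T k" "f ` U \<subseteq> T"
  shows "msmooth U (\<lambda>x. k (f x))"
  unfolding msmooth_def
proof
  fix c assume c: "c \<in> A"
  have f: "smooth_on (map_of_chart c ` (dom_of c \<inter> U)) (f \<circ> chart_inv c)"
    using assms(2) c by (simp add: msmooth_def)
  have "smooth_on (map_of_chart c ` (dom_of c \<inter> U)) (\<lambda>p. k ((f \<circ> chart_inv c) p))"
    by (rule smooth_on_compose[OF open_chart_image_Int[OF compat_atlas[OF c] assms(1)] assms(3) f])
      (use assms(4) chart_simps(1)[OF compat_atlas[OF c]] in auto)
  then show "smooth_on (map_of_chart c ` (dom_of c \<inter> U)) ((\<lambda>x. k (f x)) \<circ> chart_inv c)"
    by (simp add: o_def)
qed

lemma msmooth_inverse: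
  fixes f :: "'m \<Rightarrow> real"
  assumes "open U" "msmooth U f" "\<And>x. x \<in> U \<Longrightarrow> f x \<noteq> 0"
  shows "msmooth U (\<lambda>x. inverse (f x))"
proof (rule msmooth_compose[OF assms(1,2)])
  have "open (- {0::real})" by (simp add: open_Compl)
  from smooth_on_inverse[OF this smooth_on_bounded_linear[OF this bounded_linear_ident]]
  show "smooth_on (- {0}) (inverse :: real \<Rightarrow> real)" by simp
qed (use assms(3) in auto)

lemma msmooth_chart:
  assumes "compat_chart A c"
  shows "msmooth (dom_of c) (map_of_chart c)"
  using assms by (auto simp: msmooth_def compat_chart_def smoothly_related_def overlap_def transition_def)

section \<open>Differentials\<close>

lemma differential_apply:
  assumes "msmooth U f" "open U" "x \<in> U"
  shows "blinfun_apply (differential A f x) =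
    fd (f \<circ> chart_inv (chart_near x)) (map_of_chart (chart_near x) x)"
    and "(f \<circ> chart_inv (chart_near x)) differentiable (at (map_of_chart (chart_near x) x))"
proof -
  have "map_of_chart (chart_near x) x \<in> map_of_chart (chart_near x) ` (dom_of (chart_near x) \<inter> U)"
    using assms(3) chart_near(2) by auto
  note d = smooth_on_has_derivative[OF msmooth_compat[OF assms(1,2) compat_chart_near] this]
  show "(f \<circ> chart_inv (chart_near x)) differentiable (at (map_of_chart (chart_near x) x))"
    using d by (auto simp: differentiable_def)
  show "blinfun_apply (differential A f x) =
    fd (f \<circ> chart_inv (chart_near x)) (map_of_chart (chart_near x) x)"
    unfolding differential_def
    by (rule bounded_linear_Blinfun_apply[OF has_derivative_bounded_linear[OF d]])
qed

lemma differential_eqI: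
  assumes "((f \<circ> chart_inv (chart_near x)) has_derivative f') (at (map_of_chart (chart_near x) x))"
  shows "blinfun_apply (differential A f x) = f'"
  unfolding differential_def fd_eq[OF assms]
  by (rule bounded_linear_Blinfun_apply[OF has_derivative_bounded_linear[OF assms]])

lemma differential_cong:
  assumes "open N" "x \<in> N" "\<And>y. y \<in> N \<Longrightarrow> f y = g y"
  shows "differential A f x = differential A g x"
  unfolding differential_def
  by (rule arg_cong[where f = Blinfun],
      rule fd_eq_on_open[OF open_chart_image_Int[OF compat_chart_near assms(1)]])
    (use assms chart_near(2) chart_simps(1)[OF compat_chart_near] in auto)

lemma chart_compose_near:
  assumes "compat_chart A c" "x \<in> dom_of c" "open U" "x \<in> U"
  obtains T where "open T" "map_of_chart (chart_near x) x \<in> T"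
    "\<And>p. p \<in> T \<Longrightarrow> chart_inv (chart_near x) p \<in> U \<inter> dom_of c \<inter> dom_of (chart_near x)"
    "\<And>p. p \<in> T \<Longrightarrow> map_of_chart (chart_near x) (chart_inv (chart_near x) p) = p"
    "\<And>p. p \<in> T \<Longrightarrow> chart_inv c (map_of_chart c (chart_inv (chart_near x) p)) = chart_inv (chart_near x) p"
  by (rule that[OF open_chart_image_Int[OF compat_chart_near open_Int[OF assms(3) chart_simps(2)[OF assms(1)]]]])
    (use assms chart_near(2) chart_simps(1)[OF compat_chart_near] chart_simps(1)[OF assms(1)] in auto)

lemma differential_chart:
  fixes f :: "'m \<Rightarrow> 'b::real_normed_vector"
  assumes "msmooth U f" "open U" "x \<in> U" "compat_chart A c" "x \<in> dom_of c"
  shows "differential A f x v = fd (f \<circ> chart_inv c) (map_of_chart c x) (differential A (map_of_chart c) x v)"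
proof -
  let ?d = "chart_near x"
  obtain T where T: "open T" "map_of_chart ?d x \<in> T"
    "\<And>p. p \<in> T \<Longrightarrow> chart_inv c (map_of_chart c (chart_inv ?d p)) = chart_inv ?d p"
    using chart_compose_near[OF assms(4,5,2,3)] by metis
  have inv: "chart_inv ?d (map_of_chart ?d x) = x"
    using chart_simps(1)[OF compat_chart_near chart_near(2)] .
  have "differential A f x v = fd (f \<circ> chart_inv ?d) (map_of_chart ?d x) v"
    using differential_apply[OF assms(1-3)] by simp
  also have "\<dots> = fd (\<lambda>p. (f \<circ> chart_inv c) ((map_of_chart c \<circ> chart_inv ?d) p)) (map_of_chart ?d x) v"
    by (rule fun_cong[OF fd_eq_on_open[OF T(1,2)]]) (simp add: T(3))
  also have "\<dots> = fd (f \<circ> chart_inv c) (map_of_chart c x) (fd (map_of_chart c \<circ> chart_inv ?d) (map_of_chart ?d x) v)"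
  proof (subst fd_compose)
    have "map_of_chart c x \<in> map_of_chart c ` (dom_of c \<inter> U)" using assms by auto
    then show "f \<circ> chart_inv c differentiable at ((map_of_chart c \<circ> chart_inv ?d) (map_of_chart ?d x))"
      using smooth_on_differentiable[OF msmooth_compat[OF assms(1,2,4)]] by (simp add: inv)
    show "map_of_chart c \<circ> chart_inv ?d differentiable at (map_of_chart ?d x)"
      by (rule differential_apply(2)[OF msmooth_chart[OF assms(4)] chart_simps(2)[OF assms(4)] assms(5)])
  qed (simp add: inv)
  also have "fd (map_of_chart c \<circ> chart_inv ?d) (map_of_chart ?d x) v = differential A (map_of_chart c) x v"
    using differential_apply(1)[OF msmooth_chart[OF assms(4)] chart_simps(2)[OF assms(4)] assms(5)] by simp
  finally show ?thesis .
qed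

text \<open>Tangent vectors at \<open>x\<close> are their own components in the selected chart. This
  turns statements about components back into statements about vectors.\<close>

lemma differential_chart_near: "differential A (map_of_chart (chart_near x)) x v = v"
proof -
  let ?d = "chart_near x"
  obtain T where T: "open T" "map_of_chart ?d x \<in> T"
    "\<And>p. p \<in> T \<Longrightarrow> map_of_chart ?d (chart_inv ?d p) = p"
    using chart_compose_near[OF compat_chart_near chart_near(2) open_UNIV UNIV_I] by metis
  have "((\<lambda>p. p) has_derivative (\<lambda>v. v)) (at (map_of_chart ?d x))" by (rule has_derivative_ident)
  then have "((map_of_chart ?d \<circ> chart_inv ?d) has_derivative (\<lambda>v. v)) (at (map_of_chart ?d x))"
    by (rule has_derivative_transform_within_open[OF _ T(1,2)]) (simp add: T(3))
  from differential_eqI[OF this] show ?thesis by simp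
qed

text \<open>The tangent vector at \<open>x\<close> with components \<open>w\<close> in
  \<open>c\<close>. It serves to continue a single vector to a field with constant
  components.\<close>

definition chart_vec :: "('m, 'e) chart \<Rightarrow> 'm \<Rightarrow> 'e \<Rightarrow> 'e" where
  "chart_vec c x w = fd (map_of_chart (chart_near x) \<circ> chart_inv c) (map_of_chart c x) w"

lemma chart_vec_differential:
  assumes "compat_chart A c" "x \<in> dom_of c"
  shows "chart_vec c x (differential A (map_of_chart c) x v) = v"
  using differential_chart[OF msmooth_chart[OF compat_chart_near] chart_simps(2)[OF compat_chart_near] chart_near(2) assms]
  by (simp add: chart_vec_def differential_chart_near)

lemma differential_chart_vec:
  assumes "compat_chart A c" "x \<in> dom_of c"
  shows "differential A (map_of_chart c) x (chart_vec c x w) = w"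
proof -
  \<comment> \<open>\<open>chart_vec\<close> is already known to be a left inverse, and an injective
    endomorphism of the finite-dimensional model space is surjective, so it is a right inverse
    too.\<close>
  have s: "surj (differential A (map_of_chart c) x)"
    using linear_injective_imp_surjective[of "differential A (map_of_chart c) x"]
    by (metis assms blinfun.bounded_linear_right bounded_linear.linear chart_vec_differential injI)
  then obtain v where "w = differential A (map_of_chart c) x v" by (metis surjD)
  then show ?thesis using chart_vec_differential[OF assms] by simp
qed

lemma differential_bounded_linear:
  assumes "bounded_linear L" "msmooth U f" "open U" "x \<in> U"
  shows "differential A (\<lambda>y. L (f y)) x v = L (differential A f x v)"
proof -
  have "((\<lambda>p. L ((f \<circ> chart_inv (chart_near x)) p)) has_derivative (\<lambda>v. L (differential A f x v)))
     (at (map_of_chart (chart_near x) x))"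
    unfolding differential_apply(1)[OF assms(2-4)]
    by (rule bounded_linear.has_derivative[OF assms(1)])
      (use differential_apply(2)[OF assms(2-4)] frechet_derivative_works in blast)
  then show ?thesis by (subst differential_eqI) (auto simp: o_def)
qed

lemma differential_add:
  assumes "msmooth U f" "msmooth U g" "open U" "x \<in> U"
  shows "differential A (\<lambda>y. f y + g y) x v = differential A f x v + differential A g x v"
proof -
  have "((\<lambda>p. (f \<circ> chart_inv (chart_near x)) p + (g \<circ> chart_inv (chart_near x)) p) has_derivative
      (\<lambda>v. differential A f x v + differential A g x v)) (at (map_of_chart (chart_near x) x))"
    unfolding differential_apply(1)[OF assms(1,3,4)] differential_apply(1)[OF assms(2-4)]
    by (rule has_derivative_add)
      (use differential_apply(2)[OF assms(1,3,4)] differential_apply(2)[OF assms(2-4)] frechet_derivative_works in blast)+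
  then show ?thesis by (subst differential_eqI) (auto simp: o_def)
qed

lemma msmooth_differential_chart:
  fixes f :: "'m \<Rightarrow> 'b::real_normed_vector"
  assumes "compat_chart A c" "open N" "N \<subseteq> dom_of c" "msmooth N f"
    and "msmooth N (\<lambda>x. differential A (map_of_chart c) x (Y x))"
  shows "msmooth N (\<lambda>x. differential A f x (Y x))"
proof (rule msmoothI_local)
  fix x assume x: "x \<in> N"
  let ?w = "(\<lambda>x. differential A (map_of_chart c) x (Y x)) \<circ> chart_inv c"
  have N: "dom_of c \<inter> N = N" using assms(3) by auto
  have o: "open (map_of_chart c ` N)" using open_chart_image_Int[OF assms(1,2)] N by simp
  have "smooth_on (map_of_chart c ` N) (\<lambda>p. fd (f \<circ> chart_inv c) p (?w p))"
    by (rule smooth_on_fd_apply[OF o msmooth_compat[OF assms(4,2,1)] smooth_on_bounded_linear[OF o bounded_linear_ident]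
          _ msmooth_compat[OF assms(5,2,1), unfolded N]]) (simp add: N)
  then have "smooth_on (map_of_chart c ` N) ((\<lambda>x. differential A f x (Y x)) \<circ> chart_inv c)"
    by (rule smooth_on_cong[OF o])
      (use assms(3) chart_simps(1)[OF assms(1)] differential_chart[OF assms(4,2) _ assms(1)] in auto)
  then show "\<exists>c N. compat_chart A c \<and> open N \<and> x \<in> N \<and> N \<subseteq> dom_of c \<and>
    smooth_on (map_of_chart c ` N) ((\<lambda>x. differential A f x (Y x)) \<circ> chart_inv c)"
    using assms x by blast
qed

section \<open>Smooth vector fields\<close>

definition smooth_vf :: "'m set \<Rightarrow> ('m \<Rightarrow> 'e) \<Rightarrow> bool" where
  "smooth_vf U Y \<longleftrightarrow> (\<forall>c\<in>A. msmooth (U \<inter> dom_of c) (\<lambda>x. differential A (map_of_chart c) x (Y x)))"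

lemma smooth_vf_subset: "smooth_vf U Y \<Longrightarrow> T \<subseteq> U \<Longrightarrow> smooth_vf T Y"
  unfolding smooth_vf_def by (meson inf_mono msmooth_subset order_refl)

lemma smooth_vfI:
  assumes "\<And>x. x \<in> U \<Longrightarrow> \<exists>c N. compat_chart A c \<and> open N \<and> x \<in> N \<and> N \<subseteq> dom_of c \<and>
    msmooth N (\<lambda>x. differential A (map_of_chart c) x (Y x))"
  shows "smooth_vf U Y"
  unfolding smooth_vf_def
proof (intro ballI msmooth_local)
  fix d x assume d: "d \<in> A" and x: "x \<in> U \<inter> dom_of d"
  then obtain c N where N: "compat_chart A c" "open N" "x \<in> N" "N \<subseteq> dom_of c"
    "msmooth N (\<lambda>x. differential A (map_of_chart c) x (Y x))"
    using assms by blast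
  have o: "open (N \<inter> dom_of d)" using N(2) chart_simps(2)[OF compat_atlas[OF d]] by auto
  have "msmooth (N \<inter> dom_of d) (\<lambda>x. differential A (map_of_chart d) x (Y x))"
  proof (rule msmooth_differential_chart[OF N(1) o])
    show "msmooth (N \<inter> dom_of d) (map_of_chart d)"
      by (rule msmooth_subset[OF msmooth_chart[OF compat_atlas[OF d]]]) auto
    show "msmooth (N \<inter> dom_of d) (\<lambda>x. differential A (map_of_chart c) x (Y x))"
      by (rule msmooth_subset[OF N(5)]) auto
  qed (use N in auto)
  then show "\<exists>N. open N \<and> x \<in> N \<and> msmooth N (\<lambda>x. differential A (map_of_chart d) x (Y x))"
    using o N(3) x by blast
qed

lemma smooth_vf_local:
  assumes "\<And>x. x \<in> U \<Longrightarrow> \<exists>N. open N \<and> x \<in> N \<and> smooth_vf N Y"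
  shows "smooth_vf U Y"
  unfolding smooth_vf_def
proof (intro ballI msmooth_local)
  fix c x assume c: "c \<in> A" and x: "x \<in> U \<inter> dom_of c"
  then obtain N where N: "open N" "x \<in> N" "smooth_vf N Y" using assms by blast
  then show "\<exists>N. open N \<and> x \<in> N \<and> msmooth N (\<lambda>x. differential A (map_of_chart c) x (Y x))"
    using c x chart_simps(2)[OF compat_atlas[OF c]] by (auto simp: smooth_vf_def)
qed

lemma msmooth_differential_vf:
  assumes "open U" "msmooth U f" "smooth_vf U Y"
  shows "msmooth U (\<lambda>x. differential A f x (Y x))"
proof (rule msmooth_local)
  fix x assume x: "x \<in> U"
  let ?c = "chart_near x" and ?N = "U \<inter> dom_of (chart_near x)"
  have o: "open ?N" using assms(1) chart_simps(2)[OF compat_chart_near] by auto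
  have "msmooth ?N (\<lambda>x. differential A f x (Y x))"
    by (rule msmooth_differential_chart[OF compat_chart_near o])
      (use assms chart_near(1) msmooth_subset[OF assms(2), of ?N] in \<open>auto simp: smooth_vf_def\<close>)
  then show "\<exists>N. open N \<and> x \<in> N \<and> msmooth N (\<lambda>x. differential A f x (Y x))"
    using o x chart_near(2) by blast
qed

lemma smooth_vf_cong:
  assumes "open U" "smooth_vf U Y" "\<And>x. x \<in> U \<Longrightarrow> Y x = Z x"
  shows "smooth_vf U Z"
  unfolding smooth_vf_def
proof
  fix c assume c: "c \<in> A"
  show "msmooth (U \<inter> dom_of c) (\<lambda>x. differential A (map_of_chart c) x (Z x))"
  proof (rule msmooth_cong)
    show "msmooth (U \<inter> dom_of c) (\<lambda>x. differential A (map_of_chart c) x (Y x))"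
      using assms(2) c by (simp add: smooth_vf_def)
  qed (use assms chart_simps(2)[OF compat_atlas[OF c]] in auto)
qed

lemma smooth_vf_zero: "open U \<Longrightarrow> smooth_vf U (\<lambda>x. 0)"
  unfolding smooth_vf_def blinfun.zero_right by (intro ballI msmooth_const open_Int_chart)

lemma smooth_vf_scaleR: "open U \<Longrightarrow> msmooth U f \<Longrightarrow> smooth_vf U Y \<Longrightarrow> smooth_vf U (\<lambda>x. f x *\<^sub>R Y x)"
  unfolding smooth_vf_def blinfun.scaleR_right
  by (intro ballI msmooth_scaleR open_Int_chart) (auto elim: msmooth_subset)

lemma smooth_vf_add: "open U \<Longrightarrow> smooth_vf U Y \<Longrightarrow> smooth_vf U Z \<Longrightarrow> smooth_vf U (\<lambda>x. Y x + Z x)"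
  unfolding smooth_vf_def blinfun.add_right
  by (intro ballI msmooth_add open_Int_chart) auto

lemma smooth_vf_sum:
  "open U \<Longrightarrow> (\<And>i. i \<in> I \<Longrightarrow> smooth_vf U (Y i)) \<Longrightarrow> smooth_vf U (\<lambda>x. \<Sum>i\<in>I. Y i x)"
  by (induction I rule: infinite_finite_induct) (auto intro: smooth_vf_zero smooth_vf_add)

section \<open>Gluing local sections\<close>

lemma msmooth_imp_continuous_on:
  assumes "open U" "msmooth U f"
  shows "continuous_on U f"
proof (rule continuous_at_imp_continuous_on, rule ballI)
  fix x assume x: "x \<in> U"
  let ?c = "chart_near x" and ?N = "dom_of (chart_near x) \<inter> U"
  have c: "is_chart ?c" by (rule compat_is_chart[OF compat_chart_near])
  have o: "open ?N" using open_chart_dom[OF c] assms(1) by auto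
  have "continuous_on ?N (\<lambda>y. (f \<circ> chart_inv ?c) (map_of_chart ?c y))"
    by (rule continuous_on_compose2[OF smooth_on_imp_continuous_on[OF msmooth_compat[OF assms(2,1) compat_chart_near]]
          continuous_on_subset[OF continuous_on_chart[OF c]]]) auto
  then have "continuous_on ?N f"
    by (rule continuous_on_eq) (simp add: chart_inv_map[OF c])
  then show "isCont f x"
    using o x chart_near(2) by (simp add: continuous_on_eq_continuous_at)
qed

lemma manifold_bump:
  assumes "open U" "x \<in> U"
  obtains \<phi> :: "'m \<Rightarrow> real" and N K where "msmooth UNIV \<phi>" "open N" "x \<in> N" "\<And>y. y \<in> N \<Longrightarrow> \<phi> y = 1"
    "closed K" "K \<subseteq> U" "\<And>y. y \<notin> K \<Longrightarrow> \<phi> y = 0"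
proof -
  define c where "c = chart_near x"
  have cc: "compat_chart A c" and c: "is_chart c" and x: "x \<in> dom_of c"
    using compat_chart_near compat_is_chart chart_near(2) by (auto simp: c_def)
  have "open (map_of_chart c ` (dom_of c \<inter> U))" by (rule open_chart_image_Int[OF cc assms(1)])
  then obtain e where e: "e > 0" "cball (map_of_chart c x) e \<subseteq> map_of_chart c ` (dom_of c \<inter> U)"
    using x assms(2) open_contains_cball by blast
  then have "e / 2 > 0" by simp
  from bump_function[OF this, of "map_of_chart c x"] obtain \<phi>0 :: "'e \<Rightarrow> real" where \<phi>0: "smooth_on UNIV \<phi>0"
    "\<And>q. dist (map_of_chart c x) q \<le> e / 2 \<Longrightarrow> \<phi>0 q = 1" "\<And>q. 2 * (e / 2) \<le> dist (map_of_chart c x) q \<Longrightarrow> \<phi>0 q = 0"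
    by blast
  define \<phi> where "\<phi> = (\<lambda>y. if y \<in> dom_of c then \<phi>0 (map_of_chart c y) else 0)"
  define K where "K = chart_inv c ` cball (map_of_chart c x) e"
  define N where "N = dom_of c \<inter> map_of_chart c -` ball (map_of_chart c x) (e / 2)"
  \<comment> \<open>A compact set is closed because the manifold is Hausdorff. Closedness in the
    whole manifold, not just in the chart domain, makes the extension by zero smooth at the boundary
    of the domain.\<close>
  have "compact K"
    unfolding K_def using e(2)
    by (intro compact_continuous_image continuous_on_subset[OF continuous_on_chart_inv[OF c]]) auto
  then have K: "closed K" by (rule compact_imp_closed)
  have "K \<subseteq> chart_inv c ` map_of_chart c ` (dom_of c \<inter> U)"
    unfolding K_def using e(2) by (rule image_mono)
  also have "\<dots> \<subseteq> U" using chart_inv_map[OF c] by auto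
  finally have KU: "K \<subseteq> U" .
  have 0: "\<phi> y = 0" if "y \<notin> K" for y
  proof (cases "y \<in> dom_of c")
    case True
    then have "map_of_chart c y \<notin> cball (map_of_chart c x) e"
      using that chart_inv_map[OF c True] unfolding K_def by (metis image_eqI)
    then show ?thesis by (auto simp: \<phi>_def intro: \<phi>0(3))
  qed (simp add: \<phi>_def)
  have "msmooth UNIV \<phi>"
  proof (rule msmooth_local)
    fix y :: 'm
    show "\<exists>N. open N \<and> y \<in> N \<and> msmooth N \<phi>"
    proof (cases "y \<in> dom_of c")
      case True
      have o: "open (dom_of c)" by (rule open_chart_dom[OF c])
      have "msmooth (dom_of c) (\<lambda>y. \<phi>0 (map_of_chart c y))"
        by (rule msmooth_compose[OF o msmooth_chart[OF cc] \<phi>0(1)]) simp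
      then have "msmooth (dom_of c) \<phi>"
        by (rule msmooth_cong[OF o]) (simp add: \<phi>_def)
      then show ?thesis using o True by blast
    next
      case False
      have "K \<subseteq> dom_of c"
        using \<open>K \<subseteq> chart_inv c ` map_of_chart c ` (dom_of c \<inter> U)\<close> chart_inv_map[OF c] by auto
      then have y: "y \<in> - K" using False by auto
      have o: "open (- K)" using K by auto
      have "msmooth (- K) \<phi>"
        by (rule msmooth_cong[OF o msmooth_const[OF o, of 0]]) (simp add: 0)
      then show ?thesis using y o by blast
    qed
  qed
  moreover have "open N"
    unfolding N_def
    by (rule continuous_open_preimage[OF continuous_on_chart[OF c] open_chart_dom[OF c] open_ball])
  moreover have "x \<in> N" using x e by (simp add: N_def)
  moreover have "\<phi> y = 1" if "y \<in> N" for y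
    using that by (auto simp: N_def \<phi>_def intro: \<phi>0(2))
  ultimately show thesis using K KU 0 that by blast
qed

text \<open>Gluing forms finite combinations of total weight 1, with weights of either sign, as the
  bump functions come without bounds. The indices are natural numbers because the cover will be
  enumerated.\<close>

definition affine_family :: "'e set \<Rightarrow> bool" where
  "affine_family C \<longleftrightarrow> (\<forall>(I::nat set) w Z. finite I \<longrightarrow> (\<forall>i\<in>I. Z i \<in> C) \<longrightarrow> sum w I = 1 \<longrightarrow> (\<Sum>i\<in>I. w i *\<^sub>R Z i) \<in> C)"

text \<open>Each summand is the difference of two consecutive products.\<close>

lemma sum_telescoping_partition:
  fixes f :: "nat \<Rightarrow> real"
  shows "(\<Sum>k<n. f k * (\<Prod>j<k. 1 - f j)) = 1 - (\<Prod>j<n. 1 - f j)"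
  by (induction n) (auto simp: algebra_simps)

text \<open>The weights \<open>\<phi>\<^sub>k \<Prod>\<^sub>j\<^sub><\<^sub>k (1 - \<phi>\<^sub>j)\<close> form a partition of unity which is locally finite for free:
  where \<open>\<phi>\<^sub>n = 1\<close>, all weights with index beyond \<open>n\<close> vanish.\<close>

lemma glue_sections:
  assumes V: "open V"
    and C: "\<And>x. x \<in> V \<Longrightarrow> affine_family (C x)"
    and local: "\<And>x. x \<in> V \<Longrightarrow> \<exists>U Z. open U \<and> x \<in> U \<and> U \<subseteq> V \<and> smooth_vf U Z \<and> (\<forall>y\<in>U. Z y \<in> C y)"
  shows "\<exists>Y. smooth_vf V Y \<and> (\<forall>y\<in>V. Y y \<in> C y)"
proof (cases "V = {}")
  case True
  then show ?thesis using smooth_vf_zero[of "{}"] by auto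
next
  case False
  have "\<exists>U Z N K. \<exists>\<phi> :: 'm \<Rightarrow> real. open U \<and> U \<subseteq> V \<and> smooth_vf U Z \<and> (\<forall>y\<in>U. Z y \<in> C y) \<and>
      msmooth UNIV \<phi> \<and> open N \<and> x \<in> N \<and> N \<subseteq> V \<and> (\<forall>y\<in>N. \<phi> y = 1) \<and> closed K \<and> K \<subseteq> U \<and> (\<forall>y. y \<notin> K \<longrightarrow> \<phi> y = 0)"
    if "x \<in> V" for x
  proof -
    obtain U Z where U: "open U" "x \<in> U" "U \<subseteq> V" "smooth_vf U Z" "\<forall>y\<in>U. Z y \<in> C y"
      using local[OF \<open>x \<in> V\<close>] by blast
    from manifold_bump[OF U(1,2)] obtain \<phi> :: "'m \<Rightarrow> real" and N K where
      \<phi>: "msmooth UNIV \<phi>" "open N" "x \<in> N" "\<And>y. y \<in> N \<Longrightarrow> \<phi> y = 1"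
        "closed K" "K \<subseteq> U" "\<And>y. y \<notin> K \<Longrightarrow> \<phi> y = 0"
      by metis
    have "N \<subseteq> V" using \<phi> U(3) by (metis subset_iff zero_neq_one)
    then show ?thesis using U \<phi> by blast
  qed
  then obtain U Z N K and \<phi> :: "'m \<Rightarrow> 'm \<Rightarrow> real" where *: "\<And>x. x \<in> V \<Longrightarrow> open (U x) \<and> U x \<subseteq> V \<and>
      smooth_vf (U x) (Z x) \<and> (\<forall>y\<in>U x. Z x y \<in> C y) \<and>
      msmooth UNIV (\<phi> x) \<and> open (N x) \<and> x \<in> N x \<and> N x \<subseteq> V \<and> (\<forall>y\<in>N x. \<phi> x y = 1) \<and>
      closed (K x) \<and> K x \<subseteq> U x \<and> (\<forall>y. y \<notin> K x \<longrightarrow> \<phi> x y = 0)"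
    by metis
  \<comment> \<open>Second countability reduces the sets \<open>N x\<close> to countably many, so
    that the weights can be built along an enumeration.\<close>
  obtain \<F> where \<F>: "\<F> \<subseteq> N ` V" "countable \<F>" "\<Union>\<F> = \<Union>(N ` V)"
    using Lindelof[of "N ` V"] * by (metis imageE)
  obtain S where S: "countable S" "S \<subseteq> V" "\<F> = N ` S"
    using \<F>(1,2) countable_subset_image by metis
  have "x \<in> N x" "N x \<subseteq> V" if "x \<in> V" for x using *[OF that] by simp_all
  then have "\<Union>(N ` V) = V" by blast
  then have cover: "\<Union>(N ` S) = V" using \<F>(3) S(3) by simp
  then have "S \<noteq> {}" using False by auto
  define s where "s = from_nat_into S"
  have s: "s n \<in> V" for n using from_nat_into[OF \<open>S \<noteq> {}\<close>] S(2) by (auto simp: s_def)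
  have range: "range s = S" unfolding s_def by (rule range_from_nat_into[OF \<open>S \<noteq> {}\<close> S(1)])
  define \<psi> where "\<psi> = (\<lambda>n y. \<phi> (s n) y * (\<Prod>j<n. 1 - \<phi> (s j) y))"
  have \<psi>_smooth: "msmooth UNIV (\<psi> n)" for n
    unfolding \<psi>_def using *[OF s]
    by (intro msmooth_mult msmooth_prod msmooth_diff msmooth_const open_UNIV) auto
  have \<psi>0: "\<psi> n y = 0" if "y \<notin> K (s n)" for n y using *[OF s] that by (simp add: \<psi>_def)
  have \<psi>_after: "\<psi> k y = 0" if "y \<in> N (s n)" "n < k" for n k y
  proof -
    have "(\<Prod>j<k. 1 - \<phi> (s j) y) = 0"
      by (rule prod_zero) (use that *[OF s] in \<open>auto intro!: bexI[of _ n]\<close>)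
    then show ?thesis by (simp add: \<psi>_def)
  qed
  have \<psi>_sum: "(\<Sum>k\<le>n. \<psi> k y) = 1" if "y \<in> N (s n)" for n y
  proof -
    have "(\<Prod>j<Suc n. 1 - \<phi> (s j) y) = 0"
      by (rule prod_zero) (use that *[OF s] in \<open>auto intro!: bexI[of _ n]\<close>)
    then show ?thesis
      using sum_telescoping_partition[of "\<lambda>k. \<phi> (s k) y" "Suc n"] by (simp add: \<psi>_def lessThan_Suc_atMost)
  qed
  \<comment> \<open>Morally the sum over all \<open>k\<close>, cut at the first index whose set
    \<open>N\<close> contains the point. By \<open>\<psi>_after\<close> any other such index gives
    the same value, so on \<open>N (s n)\<close> the cut at the fixed \<open>n\<close> may be used,
    and smoothness follows.\<close>
  define Y where "Y = (\<lambda>y. \<Sum>k\<le>(LEAST n. y \<in> N (s n)). \<psi> k y *\<^sub>R Z (s k) y)"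
  have Y: "Y y = (\<Sum>k\<le>n. \<psi> k y *\<^sub>R Z (s k) y)" if "y \<in> N (s n)" for n y
  proof -
    have "y \<in> N (s (LEAST n. y \<in> N (s n)))" by (rule LeastI[of "\<lambda>n. y \<in> N (s n)", OF that])
    moreover have "(LEAST n. y \<in> N (s n)) \<le> n" by (rule Least_le[of "\<lambda>n. y \<in> N (s n)", OF that])
    ultimately show ?thesis
      unfolding Y_def by (intro sum.mono_neutral_left) (auto simp: \<psi>_after)
  qed
  \<comment> \<open>\<open>Z (s k)\<close> is smooth on \<open>U (s k)\<close> only; off the closed
    set \<open>K (s k)\<close> the weight vanishes, and these two open sets cover
    \<open>V\<close>.\<close>
  have ZV: "smooth_vf V (\<lambda>y. \<psi> k y *\<^sub>R Z (s k) y)" for k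
  proof (rule smooth_vf_local)
    fix y assume y: "y \<in> V"
    note k = *[OF s[of k]]
    show "\<exists>N. open N \<and> y \<in> N \<and> smooth_vf N (\<lambda>y. \<psi> k y *\<^sub>R Z (s k) y)"
    proof (cases "y \<in> U (s k)")
      case True
      have "smooth_vf (U (s k)) (\<lambda>y. \<psi> k y *\<^sub>R Z (s k) y)"
        using k by (intro smooth_vf_scaleR msmooth_subset[OF \<psi>_smooth]) auto
      then show ?thesis using True k by blast
    next
      case False
      have o: "open (- K (s k))" using k by auto
      have "smooth_vf (- K (s k)) (\<lambda>y. \<psi> k y *\<^sub>R Z (s k) y)"
        by (rule smooth_vf_cong[OF o smooth_vf_zero[OF o]]) (simp add: \<psi>0)
      moreover have "y \<in> - K (s k)" using False k by auto
      ultimately show ?thesis using o by blast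
    qed
  qed
  have near: "\<exists>n. y \<in> N (s n)" if "y \<in> V" for y
    using that cover range by (metis UN_E rangeE)
  have "smooth_vf V Y"
  proof (rule smooth_vf_local)
    fix y assume y: "y \<in> V"
    then obtain n where n: "y \<in> N (s n)" using near by blast
    have o: "open (N (s n))" using *[OF s] by blast
    have "smooth_vf (N (s n)) (\<lambda>y. \<Sum>k\<le>n. \<psi> k y *\<^sub>R Z (s k) y)"
      by (rule smooth_vf_sum[OF o], rule smooth_vf_subset[OF ZV]) (use * s in blast)
    then have "smooth_vf (N (s n)) Y"
      by (rule smooth_vf_cong[OF o]) (simp add: Y)
    then show "\<exists>N. open N \<and> y \<in> N \<and> smooth_vf N Y" using o n by blast
  qed
  moreover have "Y y \<in> C y" if y: "y \<in> V" for y
  proof -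
    obtain n where n: "y \<in> N (s n)" using near y by blast
    \<comment> \<open>\<open>Z (s k) y\<close> is known to lie in \<open>C y\<close> only if
      \<open>y\<close> is in \<open>U (s k)\<close>. The discarded indices have weight 0, so the
      total remains 1.\<close>
    let ?I = "{k \<in> {..n}. y \<in> U (s k)}"
    have out: "\<psi> k y = 0" if "k \<in> {..n} - ?I" for k
    proof (rule \<psi>0)
      have "K (s k) \<subseteq> U (s k)" using *[OF s] by blast
      then show "y \<notin> K (s k)" using that by auto
    qed
    have "sum (\<lambda>k. \<psi> k y) ?I = (\<Sum>k\<le>n. \<psi> k y)"
      by (rule sum.mono_neutral_left) (use out in auto)
    then have "sum (\<lambda>k. \<psi> k y) ?I = 1" using \<psi>_sum[OF n] by simp
    moreover have "\<forall>k\<in>?I. Z (s k) y \<in> C y" using *[OF s] by auto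
    ultimately have "(\<Sum>k\<in>?I. \<psi> k y *\<^sub>R Z (s k) y) \<in> C y"
      using C[OF y] unfolding affine_family_def by simp
    moreover have "(\<Sum>k\<in>?I. \<psi> k y *\<^sub>R Z (s k) y) = Y y"
      unfolding Y[OF n] by (rule sum.mono_neutral_left) (use out in auto)
    ultimately show ?thesis by simp
  qed
  ultimately show ?thesis by blast
qed

end

section \<open>Sections of the foliation\<close>

text \<open>Describes \<open>W\<close> by linear equations, so that membership can be tested with
  derivatives of scalar functions.\<close>

lemma mem_subspace_iff_inner:
  fixes W :: "'e::euclidean_space set"
  assumes "subspace W"
  shows "v \<in> W \<longleftrightarrow> (\<forall>l\<in>W\<^sup>\<bottom>. l \<bullet> v = 0)"
proof -
  have "v \<in> W \<longleftrightarrow> v \<in> W\<^sup>\<bottom>\<^sup>\<bottom>" using orthogonal_comp_self[OF assms] by simp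
  then show ?thesis by (simp add: orthogonal_comp_def[of "W\<^sup>\<bottom>"] orthogonal_def)
qed

locale foliated_manifold = smooth_manifold +
  fixes V :: "'a set" and W :: "'b set" and F :: "('a, 'b) chart set"
  assumes foliation: "regular_foliation A V W F"
begin

abbreviation TS :: "'a \<Rightarrow> 'b set" where "TS \<equiv> foliation_tangent A W F"

lemma W: "subspace W" using foliation by (simp add: regular_foliation_def)

lemma foliated_chart:
  assumes "c \<in> F"
  shows "compat_chart A c" "dom_of c \<subseteq> V"
  using foliation assms by (auto simp: regular_foliation_def compat_chart_def)

lemma foliated_cover: "x \<in> V \<Longrightarrow> \<exists>c\<in>F. x \<in> dom_of c"
  using foliation unfolding regular_foliation_def by blast

text \<open>Along a line through \<open>map_of_chart d x\<close> in a direction of \<open>W\<close>,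
  the transition map stays in one translate of \<open>W\<close> near the point. Functionals
  orthogonal to \<open>W\<close> are therefore constant along its image, and their derivatives
  vanish.\<close>

lemma foliated_transition_derivative:
  assumes "c \<in> F" "d \<in> F" "x \<in> dom_of c" "x \<in> dom_of d"
    and "differential A (map_of_chart d) x v \<in> W"
  shows "differential A (map_of_chart c) x v \<in> W"
proof -
  note cc = foliated_chart(1)[OF assms(1)] and dd = foliated_chart(1)[OF assms(2)]
  let ?T = "map_of_chart c \<circ> chart_inv d" and ?p = "map_of_chart d x"
  define w where "w = differential A (map_of_chart d) x v"
  have "?p \<in> overlap d c" using assms by (auto simp: overlap_def)
  then obtain M where M: "open M" "?p \<in> M" "M \<subseteq> overlap d c"
    "\<forall>q\<in>M. \<forall>r\<in>M. q - r \<in> W \<longrightarrow> ?T q - ?T r \<in> W"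
    using foliation assms(1,2) unfolding regular_foliation_def transition_def by blast
  note Tsm = msmooth_compat[OF msmooth_chart[OF cc] chart_simps(2)[OF cc] dd]
  have "?p \<in> map_of_chart d ` (dom_of d \<inter> dom_of c)" using assms by auto
  note dT = smooth_on_has_derivative[OF Tsm this]
  have "l \<bullet> fd ?T ?p w = 0" if l: "l \<in> W\<^sup>\<bottom>" for l
  proof -
    let ?L = "(\<lambda>t::real. ?p + t *\<^sub>R w) -` M"
    have o: "open ?L" by (rule open_vimage[OF M(1)]) (intro continuous_intros)
    have "((\<lambda>t. ?p + t *\<^sub>R w) has_derivative (\<lambda>t. t *\<^sub>R w)) (at 0)"
      by (auto intro!: derivative_eq_intros)
    moreover have "(?T has_derivative fd ?T ?p) (at (?p + 0 *\<^sub>R w))" using dT by simp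
    ultimately have "((\<lambda>t. ?T (?p + t *\<^sub>R w)) has_derivative (\<lambda>t. fd ?T ?p (t *\<^sub>R w))) (at 0)"
      by (rule has_derivative_compose)
    then have "((\<lambda>t. l \<bullet> ?T (?p + t *\<^sub>R w)) has_derivative (\<lambda>t. l \<bullet> fd ?T ?p (t *\<^sub>R w))) (at 0)"
      by (rule bounded_linear.has_derivative[OF bounded_linear_inner_right])
    moreover have "((\<lambda>t. l \<bullet> ?T (?p + t *\<^sub>R w)) has_derivative (\<lambda>t. 0)) (at 0)"
    proof (rule has_derivative_transform_within_open[OF has_derivative_const o])
      fix t assume "t \<in> ?L"
      moreover have "?p + t *\<^sub>R w - ?p \<in> W"
        using assms(5) subspace_scale[OF W] by (simp add: w_def)
      ultimately have "?T (?p + t *\<^sub>R w) - ?T ?p \<in> W" using M by blast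
      then have "l \<bullet> (?T (?p + t *\<^sub>R w) - ?T ?p) = 0"
        using l mem_subspace_iff_inner[OF W] by blast
      then show "l \<bullet> ?T ?p = l \<bullet> ?T (?p + t *\<^sub>R w)" by (simp add: inner_diff_right)
    qed (use M in simp)
    ultimately have "(\<lambda>t. l \<bullet> fd ?T ?p (t *\<^sub>R w)) = (\<lambda>t. 0)" by (rule has_derivative_unique)
    from fun_cong[OF this, of 1] show ?thesis by simp
  qed
  then have "fd ?T ?p w \<in> W" using mem_subspace_iff_inner[OF W] by blast
  then show ?thesis
    using differential_chart[OF msmooth_chart[OF cc] chart_simps(2)[OF cc] assms(3) dd assms(4)]
    by (simp add: w_def)
qed

text \<open>\<open>foliation_tangent\<close> asks for some foliated chart; the transition condition
  makes the answer the same in all of them.\<close>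

lemma TS_iff:
  assumes "c \<in> F" "x \<in> dom_of c"
  shows "v \<in> TS x \<longleftrightarrow> differential A (map_of_chart c) x v \<in> W"
  using assms foliated_transition_derivative unfolding foliation_tangent_def by blast

text \<open>The functions \<open>l \<bullet> map_of_chart c\<close> with \<open>l\<close> in
  \<open>W\<^sup>\<bottom>\<close> are first integrals of the foliation on \<open>dom_of c\<close>.
  This is the form of tangency used for flows, averages and brackets.\<close>

lemma TS_iff_inner:
  assumes "c \<in> F" "x \<in> dom_of c"
  shows "v \<in> TS x \<longleftrightarrow> (\<forall>l\<in>W\<^sup>\<bottom>. differential A (\<lambda>y. l \<bullet> map_of_chart c y) x v = 0)"
proof -
  note cc = foliated_chart(1)[OF assms(1)]
  have "differential A (\<lambda>y. l \<bullet> map_of_chart c y) x v = l \<bullet> differential A (map_of_chart c) x v" for l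
    by (rule differential_bounded_linear[OF bounded_linear_inner_right msmooth_chart[OF cc] chart_simps(2)[OF cc] assms(2)])
  then show ?thesis
    using TS_iff[OF assms] mem_subspace_iff_inner[OF W] by simp
qed

lemma subspace_TS:
  assumes "x \<in> V"
  shows "subspace (TS x)"
proof -
  obtain c where c: "c \<in> F" "x \<in> dom_of c" using foliated_cover[OF assms] by blast
  show ?thesis
    by (rule subspaceI)
      (use W in \<open>auto simp: TS_iff[OF c] blinfun.zero_right blinfun.add_right blinfun.scaleR_right
        intro: subspace_0 subspace_add subspace_scale\<close>)
qed

text \<open>By transversality the pair (dh1, dh2) keeps rank 2 on the tangent space of the
  foliation. Two tangent vectors with nonzero determinant are continued with constant components in
  a foliated chart, where they remain tangent, and Cramer's rule solves for the values
  \<open>a\<close>, \<open>b\<close> wherever the determinant \<open>\<Delta>\<close> is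
  nonzero.\<close>

lemma local_transverse_section:
  assumes h: "msmooth UNIV h1" "msmooth UNIV h2"
    and ind: "independent_functions_on A V h1 h2"
    and trans: "\<forall>x\<in>V. {s + l |s l. s \<in> TS x \<and> l \<in> level_tangent A h1 h2 x} = UNIV"
    and x: "x \<in> V"
  shows "\<exists>U Z. open U \<and> x \<in> U \<and> U \<subseteq> V \<and> smooth_vf U Z \<and>
    (\<forall>y\<in>U. Z y \<in> {v \<in> TS y. differential A h1 y v = a \<and> differential A h2 y v = b})"
proof -
  obtain c where c: "c \<in> F" "x \<in> dom_of c" using foliated_cover[OF x] by blast
  note cc = foliated_chart(1)[OF c(1)]
  have o: "open (dom_of c)" by (rule chart_simps(2)[OF cc])
  have "wedge_covectors (differential A h1 x) (differential A h2 x) \<noteq> (\<lambda>v w. 0)"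
    using ind x unfolding independent_functions_on_def by blast
  then obtain v w where vw:
    "differential A h1 x v * differential A h2 x w - differential A h1 x w * differential A h2 x v \<noteq> 0"
    unfolding wedge_covectors_def by (metis (no_types, lifting))
  \<comment> \<open>The summand tangent to the level sets is annihilated by both differentials, so
    the other summand takes the same values as \<open>v\<close>.\<close>
  have split: "\<exists>s\<in>TS x. differential A h1 x s = differential A h1 x v \<and> differential A h2 x s = differential A h2 x v" for v
  proof -
    have "v \<in> {s + l |s l. s \<in> TS x \<and> l \<in> level_tangent A h1 h2 x}" using trans x by simp
    then obtain s l where "v = s + l" "s \<in> TS x" "l \<in> level_tangent A h1 h2 x" by blast
    then show ?thesis by (auto simp: level_tangent_def blinfun.add_right)
  qed
  obtain s t where st: "s \<in> TS x" "t \<in> TS x"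
    "differential A h1 x s * differential A h2 x t - differential A h1 x t * differential A h2 x s \<noteq> 0"
    using split[of v] split[of w] vw by metis
  define e where "e = (\<lambda>v y. chart_vec c y (differential A (map_of_chart c) x v))"
  have ce: "differential A (map_of_chart c) y (e v y) = differential A (map_of_chart c) x v" if "y \<in> dom_of c" for v y
    unfolding e_def by (rule differential_chart_vec[OF cc that])
  have ex: "e v x = v" for v unfolding e_def by (rule chart_vec_differential[OF cc c(2)])
  have e_smooth: "smooth_vf (dom_of c) (e v)" for v
  proof (rule smooth_vfI)
    have "msmooth (dom_of c) (\<lambda>y. differential A (map_of_chart c) y (e v y))"
      by (rule msmooth_cong[OF o msmooth_const[OF o]]) (rule ce[symmetric])
    then show "\<exists>d N. compat_chart A d \<and> open N \<and> y \<in> N \<and> N \<subseteq> dom_of d \<and>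
      msmooth N (\<lambda>y. differential A (map_of_chart d) y (e v y))" if "y \<in> dom_of c" for y
      using cc o that by blast
  qed
  have eTS: "e v y \<in> TS y" if "v \<in> TS x" "y \<in> dom_of c" for v y
    using that TS_iff[OF c] TS_iff[OF c(1)] ce by simp
  define M where "M = (\<lambda>(h :: 'a \<Rightarrow> real) v y. blinfun_apply (differential A h y) (e v y))"
  have M_smooth: "msmooth (dom_of c) (M h v)" if "msmooth UNIV h" for h :: "'a \<Rightarrow> real" and v
    unfolding M_def by (rule msmooth_differential_vf[OF o msmooth_subset[OF that] e_smooth]) simp
  define \<Delta> where "\<Delta> = (\<lambda>y. M h1 s y * M h2 t y - M h1 t y * M h2 s y)"
  have \<Delta>_smooth: "msmooth (dom_of c) \<Delta>"
    unfolding \<Delta>_def by (intro msmooth_diff msmooth_mult o M_smooth h)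
  define U where "U = dom_of c \<inter> \<Delta> -` (- {0})"
  have oU: "open U"
    unfolding U_def by (rule continuous_open_preimage[OF msmooth_imp_continuous_on[OF o \<Delta>_smooth] o]) (simp add: open_Compl)
  have Uc: "U \<subseteq> dom_of c" by (auto simp: U_def)
  define Z where "Z = (\<lambda>y. inverse (\<Delta> y) *\<^sub>R ((a * M h2 t y - b * M h1 t y) *\<^sub>R e s y + (b * M h1 s y - a * M h2 s y) *\<^sub>R e t y))"
  have "smooth_vf U Z"
    unfolding Z_def
    by (intro smooth_vf_scaleR smooth_vf_add msmooth_inverse msmooth_diff msmooth_mult msmooth_const oU
        msmooth_subset[OF M_smooth Uc] msmooth_subset[OF \<Delta>_smooth Uc] smooth_vf_subset[OF e_smooth Uc] h)
      (simp add: U_def)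
  moreover have "x \<in> U" using st(3) c(2) by (simp add: U_def \<Delta>_def M_def ex)
  moreover have "Z y \<in> {v \<in> TS y. differential A h1 y v = a \<and> differential A h2 y v = b}" if y: "y \<in> U" for y
  proof -
    have yc: "y \<in> dom_of c" "\<Delta> y \<noteq> 0" using y by (auto simp: U_def)
    have "subspace (TS y)" using subspace_TS yc(1) foliated_chart(2)[OF c(1)] by blast
    then have "Z y \<in> TS y"
      unfolding Z_def by (intro subspace_scale subspace_add eTS st yc(1))
    moreover have "differential A h y (Z y) = inverse (\<Delta> y) * ((a * M h2 t y - b * M h1 t y) * M h s y + (b * M h1 s y - a * M h2 s y) * M h t y)" for h
      by (simp add: Z_def M_def blinfun.add_right blinfun.scaleR_right)
    moreover have "(a * M h2 t y - b * M h1 t y) * M h1 s y + (b * M h1 s y - a * M h2 s y) * M h1 t y = a * \<Delta> y"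
      "(a * M h2 t y - b * M h1 t y) * M h2 s y + (b * M h1 s y - a * M h2 s y) * M h2 t y = b * \<Delta> y"
      by (simp_all add: \<Delta>_def algebra_simps)
    ultimately show ?thesis using yc(2) by simp
  qed
  ultimately show ?thesis using oU Uc foliated_chart(2)[OF c(1)] by blast
qed

lemma transverse_section:
  assumes "open V" "msmooth UNIV h1" "msmooth UNIV h2"
    and "independent_functions_on A V h1 h2"
    and "\<forall>x\<in>V. {s + l |s l. s \<in> TS x \<and> l \<in> level_tangent A h1 h2 x} = UNIV"
  shows "\<exists>Y. smooth_vf V Y \<and> (\<forall>x\<in>V. Y x \<in> TS x \<and> differential A h1 x (Y x) = a \<and> differential A h2 x (Y x) = b)"
proof -
  have aff: "affine_family {v \<in> TS x. differential A h1 x v = a \<and> differential A h2 x v = b}" if "x \<in> V" for x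
    unfolding affine_family_def
    by (auto simp: blinfun.sum_right blinfun.scaleR_right sum_distrib_right[symmetric]
        intro!: subspace_sum subspace_scale subspace_TS that)
  from glue_sections[OF assms(1) aff local_transverse_section[OF assms(2-)]] show ?thesis
    by (auto simp: Ball_def)
qed

end

section \<open>Torus actions\<close>

text \<open>Integrals over periods starting at \<open>u\<close> and at \<open>v\<close> are compared
  by splitting the interval from \<open>u\<close> to \<open>v + T\<close> in two ways; the leftover
  pieces are translates of each other by \<open>T\<close>.\<close>

lemma integral_periodic_shift:
  fixes f :: "real \<Rightarrow> 'b::banach"
  assumes f: "continuous_on UNIV f" and per: "\<And>t. f (t + T) = f t" and T: "0 \<le> T"
  shows "integral {0..T} (\<lambda>t. f (t - s)) = integral {0..T} f"
proof -
  have cont: "continuous_on S f" for S using f by (rule continuous_on_subset) simp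
  have int: "f integrable_on {a..b}" for a b by (rule integrable_continuous_real[OF cont])
  have le: "integral {u..u + T} f = integral {v..v + T} f" if "u \<le> v" for u v
  proof -
    have "integral {u..v} f + integral {v..v + T} f = integral {u..v + T} f"
      by (rule Henstock_Kurzweil_Integration.integral_combine[OF that _ int]) (use T in simp)
    moreover have "integral {u..u + T} f + integral {u + T..v + T} f = integral {u..v + T} f"
      by (rule Henstock_Kurzweil_Integration.integral_combine[OF _ _ int]) (use T that in simp_all)
    moreover have "integral {u + T..v + T} f = integral {u..v} f"
      using integral_shift_real_ivl[of "u + T" T "v + T" f] by (simp add: per)
    ultimately have "integral {u..v} f + integral {u..u + T} f = integral {u..v} f + integral {v..v + T} f"
      by (simp add: add.commute)
    then show ?thesis by (rule add_left_imp_eq)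
  qed
  have "integral {0..T} (\<lambda>t. f (t - s)) = integral {- s..- s + T} f"
    using integral_shift_real_ivl[of "- s" "- s" "- s + T" f] by simp
  also have "\<dots> = integral {0..0 + T} f"
    using le[of "- s" 0] le[of 0 "- s"] by (cases "- s \<le> 0") auto
  finally show ?thesis by simp
qed

lemma torus_exp_in_torus: "torus_exp \<xi> \<in> torus"
  by (simp add: torus_def torus_exp_def)

lemma torus_exp_add: "torus_exp (\<xi> + \<eta>) = torus_mult (torus_exp \<xi>) (torus_exp \<eta>)"
  by (simp add: torus_mult_def torus_exp_def cis_mult)

lemma torus_exp_0: "torus_exp 0 = (1, 1)"
  by (simp add: torus_exp_def)

context smooth_manifold
begin

lemma differential_compose:
  fixes g :: "'m \<Rightarrow> 'b::euclidean_space" and k :: "'b \<Rightarrow> 'c::real_normed_vector"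
  assumes "k differentiable (at (g x))" "msmooth U g" "open U" "x \<in> U"
  shows "differential A (\<lambda>y. k (g y)) x v = fd k (g x) (differential A g x v)"
proof -
  let ?c = "chart_near x"
  have inv: "chart_inv ?c (map_of_chart ?c x) = x"
    using chart_simps(1)[OF compat_chart_near chart_near(2)] .
  have "((g \<circ> chart_inv ?c) has_derivative differential A g x) (at (map_of_chart ?c x))"
    using differential_apply[OF assms(2-4)] frechet_derivative_works by metis
  moreover have "(k has_derivative fd k (g x)) (at ((g \<circ> chart_inv ?c) (map_of_chart ?c x)))"
    using assms(1) frechet_derivative_works[of k "at (g x)"] by (simp add: inv)
  ultimately have "((\<lambda>p. k ((g \<circ> chart_inv ?c) p)) has_derivative (\<lambda>v. fd k (g x) (differential A g x v)))
     (at (map_of_chart ?c x))"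
    by (rule has_derivative_compose)
  then show ?thesis by (subst differential_eqI) (auto simp: o_def)
qed

lemma vec_eqI:
  "differential A (map_of_chart (chart_near x)) x v = differential A (map_of_chart (chart_near x)) x w \<Longrightarrow> v = w"
  by (simp add: differential_chart_near)

definition vf_in_chart :: "('m, 'e) chart \<Rightarrow> ('m \<Rightarrow> 'e) \<Rightarrow> 'e \<Rightarrow> 'e" where
  "vf_in_chart c Y p = differential A (map_of_chart c) (chart_inv c p) (Y (chart_inv c p))"

lemma smooth_on_vf_in_chart:
  assumes "open U" "smooth_vf U Y" "c \<in> A"
  shows "smooth_on (map_of_chart c ` (dom_of c \<inter> U)) (vf_in_chart c Y)"
proof -
  have "smooth_on (map_of_chart c ` (dom_of c \<inter> (U \<inter> dom_of c)))
      ((\<lambda>x. differential A (map_of_chart c) x (Y x)) \<circ> chart_inv c)"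
    using assms by (intro msmooth_compat open_Int_chart compat_atlas) (simp_all add: smooth_vf_def)
  moreover have "dom_of c \<inter> (U \<inter> dom_of c) = dom_of c \<inter> U" by auto
  ultimately show ?thesis by (simp add: vf_in_chart_def[abs_def] o_def)
qed

end

locale torus_manifold = smooth_manifold A
  for A :: "('m::{t2_space, second_countable_topology}, 'e::euclidean_space) chart set" +
  fixes act :: "complex \<times> complex \<Rightarrow> 'm \<Rightarrow> 'm"
  assumes action: "smooth_torus_action A act"
begin

text \<open>The action of the covering group of the torus: one-parameter subgroups become lines
  through 0, and the group law becomes addition.\<close>

definition tact :: "real \<times> real \<Rightarrow> 'm \<Rightarrow> 'm" where
  "tact \<xi> x = act (torus_exp \<xi>) x"

lemma tact_0: "tact 0 x = x"
  using action by (simp add: tact_def torus_exp_0 smooth_torus_action_def)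

lemma tact_add: "tact (\<xi> + \<eta>) x = tact \<xi> (tact \<eta> x)"
  using action torus_exp_in_torus by (simp add: tact_def torus_exp_add smooth_torus_action_def)

lemma tact_commute: "tact \<xi> (tact \<eta> x) = tact \<eta> (tact \<xi> x)"
  by (metis tact_add add.commute)

lemma tact_minus: "tact (- \<xi>) (tact \<xi> x) = x" "tact \<xi> (tact (- \<xi>) x) = x"
  by (metis tact_0 tact_add add.left_inverse, metis tact_0 tact_add add.right_inverse)

lemma continuous_on_tact: "continuous_on UNIV (\<lambda>z. tact (fst z) (snd z))"
proof -
  have "continuous_on (torus \<times> UNIV) (\<lambda>z. act (fst z) (snd z))"
    using action by (simp add: smooth_torus_action_def case_prod_beta')
  moreover have "continuous_on UNIV (\<lambda>z. (torus_exp (fst z), snd z))"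
    unfolding torus_exp_def by (intro continuous_intros)
  ultimately have "continuous_on UNIV (\<lambda>z. act (fst (torus_exp (fst z), snd z)) (snd (torus_exp (fst z), snd z)))"
    by (rule continuous_on_compose2) (auto simp: torus_exp_in_torus)
  then show ?thesis by (simp add: tact_def)
qed

lemma open_tact_vimage: "open U \<Longrightarrow> open (tact \<xi> -` U)"
  by (intro open_vimage continuous_on_compose2[OF continuous_on_tact, of _ "\<lambda>x. (\<xi>, x)", simplified])
    (auto intro!: continuous_intros)

abbreviation lift_dom :: "('m, 'e) chart \<Rightarrow> 'm set \<Rightarrow> ((real \<times> real) \<times> 'e) set" where
  "lift_dom c U \<equiv> {z. snd z \<in> map_of_chart c ` dom_of c \<and> tact (fst z) (chart_inv c (snd z)) \<in> U}"

lemma open_lift_dom: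
  assumes "c \<in> A" "open U"
  shows "open (lift_dom c U)"
proof -
  have c: "is_chart c" using assms(1) compat_atlas compat_is_chart by blast
  have o: "open (map_of_chart c ` dom_of c)"
    using open_chart_image[OF c open_chart_dom[OF c]] by simp
  have "continuous_on (UNIV \<times> map_of_chart c ` dom_of c) (\<lambda>z. tact (fst z) (chart_inv c (snd z)))"
  proof (rule continuous_on_compose2[OF continuous_on_tact, of _ "\<lambda>z. (fst z, chart_inv c (snd z))", simplified])
    show "continuous_on (UNIV \<times> map_of_chart c ` dom_of c) (\<lambda>z. (fst z, chart_inv c (snd z)))"
      by (intro continuous_on_Pair continuous_on_fst continuous_on_id
          continuous_on_compose2[OF continuous_on_chart_inv[OF c] continuous_on_snd[OF continuous_on_id]]) auto
  qed
  then have "open ((UNIV \<times> map_of_chart c ` dom_of c) \<inter> (\<lambda>z. tact (fst z) (chart_inv c (snd z))) -` U)"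
    by (rule continuous_open_preimage[OF _ open_Times[OF open_UNIV o] assms(2)])
  moreover have "(UNIV \<times> map_of_chart c ` dom_of c) \<inter> (\<lambda>z. tact (fst z) (chart_inv c (snd z))) -` U = lift_dom c U"
    by auto
  ultimately show ?thesis by simp
qed

text \<open>Joint smoothness in group parameter and coordinates. The smoothness of translations,
  generators and pulled back fields is drawn from here.\<close>

lemma smooth_on_lift:
  assumes "c \<in> A" "open U" "msmooth U f"
  shows "smooth_on (lift_dom c U) (\<lambda>z. f (tact (fst z) (chart_inv c (snd z))))"
proof (rule smooth_on_local)
  fix z0 assume z0: "z0 \<in> lift_dom c U"
  define d where "d = chart_near (tact (fst z0) (chart_inv c (snd z0)))"
  have d: "d \<in> A" "tact (fst z0) (chart_inv c (snd z0)) \<in> dom_of d" using chart_near by (auto simp: d_def)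
  have dd: "compat_chart A d" by (rule compat_atlas[OF d(1)])
  let ?S = "lift_dom c (dom_of d \<inter> U)"
  have o: "open ?S"
    by (rule open_lift_dom[OF assms(1)]) (use assms(2) chart_simps(2)[OF dd] in auto)
  have eq: "{(\<xi>, p). p \<in> map_of_chart c ` dom_of c \<and> act (torus_exp \<xi>) (chart_inv c p) \<in> dom_of d} = lift_dom c (dom_of d)"
    "(\<lambda>(\<xi>, p). map_of_chart d (act (torus_exp \<xi>) (chart_inv c p))) = (\<lambda>z. map_of_chart d (tact (fst z) (chart_inv c (snd z))))"
    by (auto simp: tact_def)
  have "smooth_on (lift_dom c (dom_of d)) (\<lambda>z. map_of_chart d (tact (fst z) (chart_inv c (snd z))))"
    using action assms(1) d(1) unfolding smooth_torus_action_def eq[symmetric] by blast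
  then have 1: "smooth_on ?S (\<lambda>z. map_of_chart d (tact (fst z) (chart_inv c (snd z))))"
    by (rule smooth_on_subset) auto
  have "smooth_on ?S (\<lambda>z. (f \<circ> chart_inv d) (map_of_chart d (tact (fst z) (chart_inv c (snd z)))))"
    by (rule smooth_on_compose[OF o msmooth_compat[OF assms(3,2) dd] 1]) auto
  then have "smooth_on ?S (\<lambda>z. f (tact (fst z) (chart_inv c (snd z))))"
    by (rule smooth_on_cong[OF o]) (simp add: chart_simps(1)[OF dd])
  then show "\<exists>S. open S \<and> z0 \<in> S \<and> smooth_on S (\<lambda>z. f (tact (fst z) (chart_inv c (snd z))))"
    using o z0 d(2) by (intro exI[of _ ?S]) auto
qed

lemma msmooth_tact:
  assumes "open U" "msmooth U f"
  shows "msmooth (tact \<xi> -` U) (\<lambda>x. f (tact \<xi> x))"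
  unfolding msmooth_def
proof
  fix c assume c: "c \<in> A"
  have o: "open (map_of_chart c ` (dom_of c \<inter> tact \<xi> -` U))"
    by (rule open_chart_image_Int[OF compat_atlas[OF c] open_tact_vimage[OF assms(1)]])
  have 1: "smooth_on (map_of_chart c ` (dom_of c \<inter> tact \<xi> -` U)) (\<lambda>p. (\<xi>, p))"
    by (rule smooth_on_Pair[OF o smooth_on_const[OF o] smooth_on_bounded_linear[OF o bounded_linear_ident]])
  have "smooth_on (map_of_chart c ` (dom_of c \<inter> tact \<xi> -` U)) (\<lambda>p. f (tact (fst (\<xi>, p)) (chart_inv c (snd (\<xi>, p)))))"
    by (rule smooth_on_compose[OF o smooth_on_lift[OF c assms] 1])
      (use chart_simps(1)[OF compat_atlas[OF c]] in auto)
  then show "smooth_on (map_of_chart c ` (dom_of c \<inter> tact \<xi> -` U)) ((\<lambda>x. f (tact \<xi> x)) \<circ> chart_inv c)"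
    by (simp add: o_def)
qed

section \<open>Pushforward by the action, and generators as derivations along its orbits\<close>

definition Dact :: "real \<times> real \<Rightarrow> 'm \<Rightarrow> 'e \<Rightarrow>\<^sub>L 'e" where
  "Dact \<xi> x = differential A (\<lambda>y. map_of_chart (chart_near (tact \<xi> x)) (tact \<xi> y)) x"

lemma differential_Dact:
  assumes "open U" "msmooth U f" "tact \<xi> x \<in> U"
  shows "differential A f (tact \<xi> x) (Dact \<xi> x v) = differential A (\<lambda>y. f (tact \<xi> y)) x v"
proof -
  define d where "d = chart_near (tact \<xi> x)"
  have dd: "compat_chart A d" and dx: "tact \<xi> x \<in> dom_of d"
    using compat_chart_near chart_near(2) by (auto simp: d_def)
  have od: "open (dom_of d)" by (rule chart_simps(2)[OF dd])
  have "map_of_chart d (tact \<xi> x) \<in> map_of_chart d ` (dom_of d \<inter> U)" using dx assms(3) by auto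
  note k = smooth_on_differentiable[OF msmooth_compat[OF assms(2,1) dd] this]
  have "differential A f (tact \<xi> x) (Dact \<xi> x v) = fd (f \<circ> chart_inv d) (map_of_chart d (tact \<xi> x)) (Dact \<xi> x v)"
    using differential_chart[OF assms(2,1,3) dd dx] differential_chart_near by (simp add: d_def)
  also have "\<dots> = differential A (\<lambda>y. (f \<circ> chart_inv d) (map_of_chart d (tact \<xi> y))) x v"
    unfolding Dact_def d_def[symmetric]
    by (rule differential_compose[where g = "\<lambda>y. map_of_chart d (tact \<xi> y)" and k = "f \<circ> chart_inv d",
        OF k msmooth_tact[OF od msmooth_chart[OF dd]] open_tact_vimage[OF od], symmetric]) (use dx in simp)
  also have "differential A (\<lambda>y. (f \<circ> chart_inv d) (map_of_chart d (tact \<xi> y))) x = differential A (\<lambda>y. f (tact \<xi> y)) x"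
    by (rule differential_cong[OF open_tact_vimage[OF od]]) (use dx chart_simps(1)[OF dd] in auto)
  finally show ?thesis .
qed

lemma Dact_add: "Dact (\<xi> + \<eta>) x v = Dact \<xi> (tact \<eta> x) (Dact \<eta> x v)"
proof (rule vec_eqI)
  let ?y = "tact (\<xi> + \<eta>) x"
  define d where "d = chart_near ?y"
  have dd: "compat_chart A d" and dx: "?y \<in> dom_of d"
    using compat_chart_near chart_near(2) by (auto simp: d_def)
  have od: "open (dom_of d)" by (rule chart_simps(2)[OF dd])
  note m = msmooth_chart[OF dd]
  have "differential A (map_of_chart d) ?y (Dact \<xi> (tact \<eta> x) (Dact \<eta> x v)) =
      differential A (\<lambda>y. map_of_chart d (tact \<xi> y)) (tact \<eta> x) (Dact \<eta> x v)"
    using differential_Dact[OF od m, of \<xi> "tact \<eta> x"] dx by (simp add: tact_add)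
  also have "\<dots> = differential A (\<lambda>y. map_of_chart d (tact \<xi> (tact \<eta> y))) x v"
    using differential_Dact[OF open_tact_vimage[OF od] msmooth_tact[OF od m], of \<eta> x] dx by (simp add: tact_add)
  also have "\<dots> = differential A (map_of_chart d) ?y (Dact (\<xi> + \<eta>) x v)"
    using differential_Dact[OF od m dx] by (simp add: tact_add)
  finally show "differential A (map_of_chart (chart_near ?y)) ?y (Dact (\<xi> + \<eta>) x v) =
    differential A (map_of_chart (chart_near ?y)) ?y (Dact \<xi> (tact \<eta> x) (Dact \<eta> x v))"
    by (simp add: d_def)
qed

lemma Dact_0: "Dact 0 x v = v"
  by (simp add: Dact_def tact_0 differential_chart_near)

lemma Dact_cong: "(\<And>x. tact \<xi> x = tact \<eta> x) \<Longrightarrow> Dact \<xi> x = Dact \<eta> x"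
  by (simp add: Dact_def)

text \<open>Presents the pushforward as a derivative of the lifted action in the coordinates at
  frozen group parameter. In this form it is seen to depend smoothly on the parameter as
  well.\<close>

lemma differential_tact_lift:
  assumes "c \<in> A" "d \<in> A" "y \<in> dom_of d" "tact \<xi> y \<in> dom_of c"
  shows "differential A (\<lambda>z. map_of_chart c (tact \<xi> z)) y v =
    fd (\<lambda>z. map_of_chart c (tact (fst z) (chart_inv d (snd z)))) (\<xi>, map_of_chart d y) (0, differential A (map_of_chart d) y v)"
proof -
  note cc = compat_atlas[OF assms(1)] and dd = compat_atlas[OF assms(2)]
  have oc: "open (dom_of c)" by (rule chart_simps(2)[OF cc])
  let ?G = "\<lambda>z. map_of_chart c (tact (fst z) (chart_inv d (snd z)))"
  have S: "(\<xi>, map_of_chart d y) \<in> lift_dom d (dom_of c)"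
    using assms chart_simps(1)[OF dd assms(3)] by simp
  have "differential A (\<lambda>z. map_of_chart c (tact \<xi> z)) y v =
      fd ((\<lambda>z. map_of_chart c (tact \<xi> z)) \<circ> chart_inv d) (map_of_chart d y) (differential A (map_of_chart d) y v)"
    by (rule differential_chart[OF msmooth_tact[OF oc msmooth_chart[OF cc]] open_tact_vimage[OF oc] _ dd assms(3)])
      (use assms in simp)
  also have "(\<lambda>z. map_of_chart c (tact \<xi> z)) \<circ> chart_inv d = (\<lambda>p. ?G (\<xi>, p))" by (simp add: o_def)
  also have "fd (\<lambda>p. ?G (\<xi>, p)) (map_of_chart d y) = (\<lambda>w. fd ?G (\<xi>, map_of_chart d y) (0, w))"
    by (rule fd_eq[OF has_derivative_compose[OF has_derivative_Pair[OF has_derivative_const has_derivative_ident]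
            smooth_on_has_derivative[OF smooth_on_lift[OF assms(2) oc msmooth_chart[OF cc]] S]]])
  finally show ?thesis .
qed

abbreviation X :: "real \<times> real \<Rightarrow> 'm \<Rightarrow> 'e" where "X \<zeta> \<equiv> generator A act \<zeta>"

lemma smooth_on_line:
  fixes f :: "'n::euclidean_space \<Rightarrow> 'b::real_normed_vector"
  assumes "smooth_on S f" "a \<in> S"
  shows "((\<lambda>t. f (a + t *\<^sub>R v)) has_vector_derivative fd f a v) (at 0)"
proof -
  note D = smooth_on_has_derivative[OF assms]
  have "((\<lambda>t. a + t *\<^sub>R v) has_derivative (\<lambda>t. t *\<^sub>R v)) (at 0)"
    by (auto intro!: derivative_eq_intros)
  moreover have "(f has_derivative fd f a) (at (a + 0 *\<^sub>R v))" using D by simp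
  ultimately have "((\<lambda>t. f (a + t *\<^sub>R v)) has_derivative (\<lambda>t. fd f a (t *\<^sub>R v))) (at 0)"
    by (rule has_derivative_compose)
  then show ?thesis
    by (simp only: has_vector_derivative_def linear_scale[OF has_derivative_linear[OF D]])
qed

lemma lift_line:
  assumes "c \<in> A" "x \<in> dom_of c" "open U" "msmooth U f" "x \<in> U"
  shows "((\<lambda>t. f (tact (t *\<^sub>R \<zeta>) x)) has_vector_derivative
    fd (\<lambda>z. f (tact (fst z) (chart_inv c (snd z)))) (0, map_of_chart c x) (\<zeta>, 0)) (at 0)"
  using smooth_on_line[OF smooth_on_lift[OF assms(1,3,4)], of "(0, map_of_chart c x)" "(\<zeta>, 0)"] assms
    chart_simps(1)[OF compat_atlas[OF assms(1)] assms(2)]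
  by (simp add: tact_0)

lemma flow_derivative_0:
  assumes "open U" "msmooth U f" "x \<in> U"
  shows "((\<lambda>t. f (tact (t *\<^sub>R \<zeta>) x)) has_vector_derivative differential A f x (X \<zeta> x)) (at 0)"
proof -
  define c where "c = chart_near x"
  have c: "c \<in> A" "x \<in> dom_of c" using chart_near by (auto simp: c_def)
  have cc: "compat_chart A c" by (rule compat_atlas[OF c(1)])
  have oc: "open (dom_of c)" by (rule chart_simps(2)[OF cc])
  have Xc: "((\<lambda>t. map_of_chart c (tact (t *\<^sub>R \<zeta>) x)) has_vector_derivative X \<zeta> x) (at 0)"
  proof -
    note L = lift_line[OF c oc msmooth_chart[OF cc] c(2), of \<zeta>]
    show ?thesis
      unfolding generator_def c_def[symmetric] tact_def[symmetric] vector_derivative_at[OF L] by (rule L)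
  qed
  have "map_of_chart c x \<in> map_of_chart c ` (dom_of c \<inter> U)" using c assms(3) by auto
  note k = smooth_on_has_derivative[OF msmooth_compat[OF assms(2,1) cc] this]
  have "((\<lambda>t. (f \<circ> chart_inv c) (map_of_chart c (tact (t *\<^sub>R \<zeta>) x))) has_derivative
      (\<lambda>t. fd (f \<circ> chart_inv c) (map_of_chart c x) (t *\<^sub>R X \<zeta> x))) (at 0)"
    by (rule has_derivative_compose[OF Xc[unfolded has_vector_derivative_def]]) (use k in \<open>simp only: scaleR_zero_left tact_0\<close>)
  then have "((\<lambda>t. (f \<circ> chart_inv c) (map_of_chart c (tact (t *\<^sub>R \<zeta>) x))) has_vector_derivative
      fd (f \<circ> chart_inv c) (map_of_chart c x) (X \<zeta> x)) (at 0)"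
    by (simp only: has_vector_derivative_def linear_scale[OF has_derivative_linear[OF k]])
  moreover have "fd (f \<circ> chart_inv c) (map_of_chart c x) (X \<zeta> x) = differential A f x (X \<zeta> x)"
    using differential_chart[OF assms(2,1,3) cc c(2)] differential_chart_near by (simp add: c_def)
  moreover have o: "open ((\<lambda>t. tact (t *\<^sub>R \<zeta>) x) -` dom_of c)"
    by (intro open_vimage[OF oc] continuous_on_compose2[OF continuous_on_tact, of _ "\<lambda>t. (t *\<^sub>R \<zeta>, x)", simplified])
      (auto intro!: continuous_intros)
  ultimately have "((\<lambda>t. (f \<circ> chart_inv c) (map_of_chart c (tact (t *\<^sub>R \<zeta>) x))) has_vector_derivative
      differential A f x (X \<zeta> x)) (at 0)"
    by simp
  then show ?thesis
    by (rule has_vector_derivative_transform_within_open[OF _ o])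
      (use c(2) chart_simps(1)[OF cc] in \<open>auto simp: tact_0\<close>)
qed

lemma flow_derivative:
  assumes "open U" "msmooth U f" "tact (s *\<^sub>R \<zeta>) x \<in> U"
  shows "((\<lambda>t. f (tact (t *\<^sub>R \<zeta>) x)) has_vector_derivative
    differential A f (tact (s *\<^sub>R \<zeta>) x) (X \<zeta> (tact (s *\<^sub>R \<zeta>) x))) (at s)"
proof -
  let ?D = "\<lambda>t. t *\<^sub>R differential A f (tact (s *\<^sub>R \<zeta>) x) (X \<zeta> (tact (s *\<^sub>R \<zeta>) x))"
  have 1: "((\<lambda>t. f (tact (t *\<^sub>R \<zeta>) (tact (s *\<^sub>R \<zeta>) x))) has_derivative ?D) (at (s - s))"
    using flow_derivative_0[OF assms] by (simp add: has_vector_derivative_def)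
  have 2: "((\<lambda>t. t - s) has_derivative (\<lambda>t. t)) (at s)"
    by (auto intro!: derivative_eq_intros)
  have "((\<lambda>t. f (tact ((t - s) *\<^sub>R \<zeta>) (tact (s *\<^sub>R \<zeta>) x))) has_derivative ?D) (at s)"
    by (rule has_derivative_compose[OF 2 1])
  then show ?thesis
    by (simp add: has_vector_derivative_def tact_add[symmetric] scaleR_add_left[symmetric])
qed

text \<open>The components of the generator in \<open>c\<close> are the derivative of the lifted
  action at group parameter 0 in the direction \<open>(\<zeta>, 0)\<close>.\<close>

lemma smooth_vf_generator: "smooth_vf UNIV (X \<zeta>)"
  unfolding smooth_vf_def
proof (intro ballI msmoothI_local)
  fix c x assume c: "c \<in> A" and x: "x \<in> UNIV \<inter> dom_of c"
  note cc = compat_atlas[OF c]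
  have oc: "open (dom_of c)" by (rule chart_simps(2)[OF cc])
  have o: "open (map_of_chart c ` dom_of c)" using open_chart_image_Int[OF cc open_UNIV] by simp
  let ?G = "\<lambda>z. map_of_chart c (tact (fst z) (chart_inv c (snd z)))"
  have "smooth_on (map_of_chart c ` dom_of c) (\<lambda>p. fd ?G (0, p) (\<zeta>, 0))"
    by (rule smooth_on_fd_apply[OF o smooth_on_lift[OF c oc msmooth_chart[OF cc]]
          smooth_on_Pair[OF o smooth_on_const[OF o] smooth_on_bounded_linear[OF o bounded_linear_ident]]
          _ smooth_on_const[OF o]])
      (use chart_simps(1)[OF cc] in \<open>auto simp: tact_0\<close>)
  then have "smooth_on (map_of_chart c ` dom_of c) ((\<lambda>x. differential A (map_of_chart c) x (X \<zeta> x)) \<circ> chart_inv c)"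
  proof (rule smooth_on_cong[OF o])
    fix p assume "p \<in> map_of_chart c ` dom_of c"
    then obtain y where y: "y \<in> dom_of c" "p = map_of_chart c y" by auto
    show "fd ?G (0, p) (\<zeta>, 0) = ((\<lambda>x. differential A (map_of_chart c) x (X \<zeta> x)) \<circ> chart_inv c) p"
      using vector_derivative_unique_at[OF lift_line[OF c y(1) oc msmooth_chart[OF cc] y(1)]
          flow_derivative_0[OF oc msmooth_chart[OF cc] y(1)]]
      by (simp add: y chart_simps(1)[OF cc])
  qed
  then show "\<exists>d N. compat_chart A d \<and> open N \<and> x \<in> N \<and> N \<subseteq> dom_of d \<and>
     smooth_on (map_of_chart d ` N) ((\<lambda>x. differential A (map_of_chart c) x (X \<zeta> x)) \<circ> chart_inv d)"
    using cc oc x by blast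
qed

text \<open>Stated for a single one-parameter subgroup, because the averaging treats the two circles
  separately.\<close>

definition vf_invariant :: "real \<times> real \<Rightarrow> 'm set \<Rightarrow> ('m \<Rightarrow> 'e) \<Rightarrow> bool" where
  "vf_invariant \<zeta> V Y \<longleftrightarrow> (\<forall>t. \<forall>x\<in>V. Y (tact (t *\<^sub>R \<zeta>) x) = Dact (t *\<^sub>R \<zeta>) x (Y x))"

text \<open>The torus is abelian, so translation by \<open>t *\<^sub>R \<zeta>\<close> maps orbit
  curves of \<open>\<eta>\<close> to orbit curves of \<open>\<eta>\<close>.\<close>

lemma generator_invariant: "vf_invariant \<zeta> V (X \<eta>)"
  unfolding vf_invariant_def
proof (intro allI ballI, rule vec_eqI)
  fix t x
  let ?\<xi> = "t *\<^sub>R \<zeta>"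
  let ?y = "tact ?\<xi> x"
  define d where "d = chart_near ?y"
  have dd: "compat_chart A d" and dx: "?y \<in> dom_of d"
    using compat_chart_near chart_near(2) by (auto simp: d_def)
  have od: "open (dom_of d)" by (rule chart_simps(2)[OF dd])
  have "((\<lambda>t. map_of_chart d (tact ?\<xi> (tact (t *\<^sub>R \<eta>) x))) has_vector_derivative
      differential A (\<lambda>y. map_of_chart d (tact ?\<xi> y)) x (X \<eta> x)) (at 0)"
    by (rule flow_derivative_0[OF open_tact_vimage[OF od] msmooth_tact[OF od msmooth_chart[OF dd]]])
      (use dx in simp)
  moreover have "((\<lambda>t. map_of_chart d (tact (t *\<^sub>R \<eta>) ?y)) has_vector_derivative
      differential A (map_of_chart d) ?y (X \<eta> ?y)) (at 0)"
    by (rule flow_derivative_0[OF od msmooth_chart[OF dd] dx])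
  ultimately have "differential A (map_of_chart d) ?y (X \<eta> ?y) = differential A (\<lambda>y. map_of_chart d (tact ?\<xi> y)) x (X \<eta> x)"
    by (simp add: tact_commute[of ?\<xi>] vector_derivative_unique_at)
  then show "differential A (map_of_chart (chart_near ?y)) ?y (X \<eta> ?y) =
      differential A (map_of_chart (chart_near ?y)) ?y (Dact ?\<xi> x (X \<eta> x))"
    using differential_Dact[OF od msmooth_chart[OF dd] dx] by (simp add: d_def)
qed

text \<open>Differentiate the invariance of \<open>Y\<close> along the flow at time \<open>0\<close> and exchange the mixed partial
  derivatives of the flow.\<close>

lemma invariant_commutes:
  assumes V: "open V" "x \<in> V" and Y: "smooth_vf V Y" "vf_invariant \<zeta> V Y" and c: "c \<in> A" "x \<in> dom_of c"
  shows "fd (vf_in_chart c Y) (map_of_chart c x) (vf_in_chart c (X \<zeta>) (map_of_chart c x)) =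
    fd (vf_in_chart c (X \<zeta>)) (map_of_chart c x) (vf_in_chart c Y (map_of_chart c x))"
proof -
  note cc = compat_atlas[OF c(1)]
  have oc: "open (dom_of c)" by (rule chart_simps(2)[OF cc])
  let ?p = "map_of_chart c x"
  let ?G = "\<lambda>z. map_of_chart c (tact (fst z) (chart_inv c (snd z)))"
  let ?S = "lift_dom c (dom_of c)"
  let ?w = "vf_in_chart c Y ?p"
  have inv: "chart_inv c ?p = x" by (rule chart_simps(1)[OF cc c(2)])
  have G: "smooth_on ?S ?G" by (rule smooth_on_lift[OF c(1) oc msmooth_chart[OF cc]])
  have oS: "open ?S" by (rule open_lift_dom[OF c(1) oc])
  have p0: "(0, q) \<in> ?S" if "q \<in> map_of_chart c ` dom_of c" for q
    using that chart_simps(1)[OF cc] by (auto simp: tact_0)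
  have pS: "(0, ?p) \<in> ?S" by (rule p0) (use c in simp)
  have Xp: "vf_in_chart c (X \<zeta>) q = fd ?G (0, q) (\<zeta>, 0)" if q: "q \<in> map_of_chart c ` dom_of c" for q
  proof -
    obtain y where y: "y \<in> dom_of c" "q = map_of_chart c y" using q by auto
    show ?thesis
      using vector_derivative_unique_at[OF lift_line[OF c(1) y(1) oc msmooth_chart[OF cc] y(1)]
          flow_derivative_0[OF oc msmooth_chart[OF cc] y(1)]]
      by (simp add: y vf_in_chart_def chart_simps(1)[OF cc])
  qed
  have "?p \<in> map_of_chart c ` (dom_of c \<inter> V)" using V(2) c by auto
  note Yd = smooth_on_has_derivative[OF smooth_on_vf_in_chart[OF V(1) Y(1) c(1)] this]
  have "((\<lambda>t. map_of_chart c (tact (t *\<^sub>R \<zeta>) x)) has_vector_derivative fd ?G (0, ?p) (\<zeta>, 0)) (at 0)"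
    by (rule lift_line[OF c oc msmooth_chart[OF cc] c(2)])
  then have "((\<lambda>t. vf_in_chart c Y (map_of_chart c (tact (t *\<^sub>R \<zeta>) x))) has_derivative
      (\<lambda>t. fd (vf_in_chart c Y) ?p (t *\<^sub>R fd ?G (0, ?p) (\<zeta>, 0)))) (at 0)"
    unfolding has_vector_derivative_def by (rule has_derivative_compose) (use Yd in \<open>simp only: scaleR_zero_left tact_0\<close>)
  then have 1: "((\<lambda>t. vf_in_chart c Y (map_of_chart c (tact (t *\<^sub>R \<zeta>) x))) has_vector_derivative
      fd (vf_in_chart c Y) ?p (vf_in_chart c (X \<zeta>) ?p)) (at 0)"
    using Xp[of ?p] c(2) by (simp only: has_vector_derivative_def linear_scale[OF has_derivative_linear[OF Yd]] imageI)
  let ?L = "(\<lambda>t. tact (t *\<^sub>R \<zeta>) x) -` dom_of c"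
  have oL: "open ?L"
    by (intro open_vimage[OF oc] continuous_on_compose2[OF continuous_on_tact, of _ "\<lambda>t. (t *\<^sub>R \<zeta>, x)", simplified])
      (auto intro!: continuous_intros)
  \<comment> \<open>Invariance transports \<open>Y\<close> along the orbit by the coordinate
    derivative of \<open>?G\<close>, applied to the fixed vector \<open>?w\<close>. By
    \<open>Xp\<close> the generator is the derivative of \<open>?G\<close> in the group direction.
    Both sides of the claim thus become mixed second derivatives of \<open>?G\<close>.\<close>
  have 2: "vf_in_chart c Y (map_of_chart c (tact (t *\<^sub>R \<zeta>) x)) = fd ?G ((0, ?p) + t *\<^sub>R (\<zeta>, 0)) (0, ?w)"
    if t: "t \<in> ?L" for t
  proof -
    let ?\<xi> = "t *\<^sub>R \<zeta>"
    have tS: "(?\<xi>, ?p) \<in> ?S" using t c(2) by (simp add: inv)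
    have "vf_in_chart c Y (map_of_chart c (tact ?\<xi> x)) = differential A (map_of_chart c) (tact ?\<xi> x) (Dact ?\<xi> x (Y x))"
      using t Y(2) V(2) by (simp add: vf_in_chart_def chart_simps(1)[OF cc] vf_invariant_def)
    also have "\<dots> = differential A (\<lambda>y. map_of_chart c (tact ?\<xi> y)) x (Y x)"
      by (rule differential_Dact[OF oc msmooth_chart[OF cc]]) (use t in simp)
    also have "\<dots> = fd ?G (?\<xi>, ?p) (0, ?w)"
      using differential_tact_lift[OF c(1) c(1) c(2), of ?\<xi>] t by (simp add: vf_in_chart_def inv)
    finally show ?thesis by simp
  qed
  have "((\<lambda>t. fd ?G ((0, ?p) + t *\<^sub>R (\<zeta>, 0)) (0, ?w)) has_vector_derivative
      fd (\<lambda>z. fd ?G z (0, ?w)) (0, ?p) (\<zeta>, 0)) (at 0)"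
    by (rule smooth_on_line[OF smooth_on_fd[OF G] pS])
  then have "((\<lambda>t. vf_in_chart c Y (map_of_chart c (tact (t *\<^sub>R \<zeta>) x))) has_vector_derivative
      fd (\<lambda>z. fd ?G z (0, ?w)) (0, ?p) (\<zeta>, 0)) (at 0)"
    by (rule has_vector_derivative_transform_within_open[OF _ oL]) (use c(2) 2 in \<open>auto simp: tact_0\<close>)
  then have "fd (vf_in_chart c Y) ?p (vf_in_chart c (X \<zeta>) ?p) = fd (\<lambda>z. fd ?G z (0, ?w)) (0, ?p) (\<zeta>, 0)"
    using 1 vector_derivative_unique_at by blast
  also have "\<dots> = fd (\<lambda>z. fd ?G z (\<zeta>, 0)) (0, ?p) (0, ?w)"
    by (rule smooth_on_fd_commute[OF oS G pS])
  also have "\<dots> = fd (vf_in_chart c (X \<zeta>)) ?p ?w"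
  proof -
    have "((\<lambda>q. fd ?G (0, q) (\<zeta>, 0)) has_derivative (\<lambda>v. fd (\<lambda>z. fd ?G z (\<zeta>, 0)) (0, ?p) (0, v))) (at ?p)"
      by (rule has_derivative_compose[OF has_derivative_Pair[OF has_derivative_const has_derivative_ident]
            smooth_on_has_derivative[OF smooth_on_fd[OF G] pS]])
    then have "(vf_in_chart c (X \<zeta>) has_derivative (\<lambda>v. fd (\<lambda>z. fd ?G z (\<zeta>, 0)) (0, ?p) (0, v))) (at ?p)"
      by (rule has_derivative_transform_within_open[where s = "map_of_chart c ` dom_of c"])
        (use Xp c(2) open_chart_image_Int[OF cc open_UNIV] in auto)
    from fd_eq[OF this] show ?thesis by simp
  qed
  finally show ?thesis .
qed

section \<open>Averaging over a circle subgroup\<close>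

text \<open>The pullback of \<open>Y\<close> under the flow at time \<open>t\<close>. As
  \<open>t\<close> varies it stays in the tangent space at \<open>x\<close>, so it can be
  integrated.\<close>

definition orbit_pull :: "real \<times> real \<Rightarrow> ('m \<Rightarrow> 'e) \<Rightarrow> 'm \<Rightarrow> real \<Rightarrow> 'e" where
  "orbit_pull \<zeta> Y x t = Dact (- (t *\<^sub>R \<zeta>)) (tact (t *\<^sub>R \<zeta>) x) (Y (tact (t *\<^sub>R \<zeta>) x))"

text \<open>\<open>2 * pi\<close> is the period of \<open>torus_exp\<close> in the directions
  \<open>(1, 0)\<close> and \<open>(0, 1)\<close>; for these the formula is the mean over the
  corresponding circle.\<close>

definition average :: "real \<times> real \<Rightarrow> ('m \<Rightarrow> 'e) \<Rightarrow> 'm \<Rightarrow> 'e" where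
  "average \<zeta> Y x = (1 / (2 * pi)) *\<^sub>R integral {0..2 * pi} (orbit_pull \<zeta> Y x)"

lemma differential_orbit_pull:
  assumes "open U" "msmooth U f" "x \<in> U"
  shows "differential A f x (orbit_pull \<zeta> Y x t) =
    differential A (\<lambda>y. f (tact (- (t *\<^sub>R \<zeta>)) y)) (tact (t *\<^sub>R \<zeta>) x) (Y (tact (t *\<^sub>R \<zeta>) x))"
  using differential_Dact[OF assms(1,2), of "- (t *\<^sub>R \<zeta>)" "tact (t *\<^sub>R \<zeta>) x"] assms(3)
  by (simp add: orbit_pull_def tact_minus)

end

locale saturated_open = torus_manifold A act
  for A :: "('m::{t2_space, second_countable_topology}, 'e::euclidean_space) chart set" and act +
  fixes V :: "'m set"
  assumes open_V: "open V" and saturated: "torus_saturated act V"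
begin

lemma tact_V: "x \<in> V \<Longrightarrow> tact \<xi> x \<in> V"
  using saturated torus_exp_in_torus by (simp add: torus_saturated_def tact_def)

text \<open>Joint smoothness in time and point permits differentiation under the integral. Near a
  given pair, read \<open>Y\<close> in a chart \<open>d\<close> around the transported point; the
  pullback is then the derivative of the lifted action from \<open>d\<close> to \<open>c\<close>, at
  the inverse group parameter, applied to the components of \<open>Y\<close>.\<close>

lemma smooth_orbit_pull:
  assumes Y: "smooth_vf V Y" and c: "c \<in> A"
  shows "smooth_on (UNIV \<times> map_of_chart c ` (dom_of c \<inter> V))
    (\<lambda>z. vf_in_chart c (\<lambda>x. orbit_pull \<zeta> Y x (fst z)) (snd z))"
proof (rule smooth_on_local)
  fix z0 :: "real \<times> 'e" assume z0: "z0 \<in> UNIV \<times> map_of_chart c ` (dom_of c \<inter> V)"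
  note cc = compat_atlas[OF c]
  have oc: "open (dom_of c)" by (rule chart_simps(2)[OF cc])
  let ?y = "\<lambda>z. tact (fst z *\<^sub>R \<zeta>) (chart_inv c (snd z))"
  define d where "d = chart_near (?y z0)"
  have d: "d \<in> A" "?y z0 \<in> dom_of d" using chart_near by (auto simp: d_def)
  note dd = compat_atlas[OF d(1)]
  have od: "open (dom_of d)" by (rule chart_simps(2)[OF dd])
  let ?j = "\<lambda>z::real \<times> 'e. (fst z *\<^sub>R \<zeta>, snd z)"
  define M where "M = ?j -` lift_dom c (dom_of d \<inter> V) \<inter> (UNIV \<times> map_of_chart c ` (dom_of c \<inter> V))"
  have j: "bounded_linear ?j"
    by (intro bounded_linear_Pair bounded_linear_compose[OF bounded_linear_scaleR_left bounded_linear_fst] bounded_linear_snd)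
  have "open (?j -` lift_dom c (dom_of d \<inter> V))"
    by (rule open_vimage[OF open_lift_dom[OF c open_Int[OF od open_V]] linear_continuous_on[OF j]])
  then have oM: "open M"
    unfolding M_def using open_chart_image_Int[OF cc open_V] by (intro open_Int open_Times) auto
  have jM: "?j ` M \<subseteq> lift_dom c (dom_of d \<inter> V)" by (auto simp: M_def)
  note j_smooth = smooth_on_bounded_linear[OF oM j]
  have lift: "smooth_on M (\<lambda>z. f (?y z))" if "msmooth (dom_of d \<inter> V) f" for f :: "'m \<Rightarrow> 'e"
    using smooth_on_compose[OF oM smooth_on_lift[OF c open_Int[OF od open_V] that] j_smooth jM] by simp
  have 1: "smooth_on M (\<lambda>z. map_of_chart d (?y z))"
    by (rule lift, rule msmooth_subset[OF msmooth_chart[OF dd]]) simp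
  have 2: "smooth_on M (\<lambda>z. differential A (map_of_chart d) (?y z) (Y (?y z)))"
    by (rule lift[of "\<lambda>y. differential A (map_of_chart d) y (Y y)"])
      (use Y d(1) in \<open>simp add: smooth_vf_def Int_commute\<close>)
  let ?u = "\<lambda>z::real \<times> 'e. (- (fst z *\<^sub>R \<zeta>), map_of_chart d (?y z))"
  let ?w = "\<lambda>z. (0, differential A (map_of_chart d) (?y z) (Y (?y z)))"
  let ?G = "\<lambda>z. map_of_chart c (tact (fst z) (chart_inv d (snd z)))"
  have bl: "bounded_linear (\<lambda>z::real \<times> 'e. - (fst z *\<^sub>R \<zeta>))"
    by (intro bounded_linear_minus bounded_linear_compose[OF bounded_linear_scaleR_left bounded_linear_fst])
  have in_M: "snd z \<in> map_of_chart c ` dom_of c" "chart_inv c (snd z) \<in> dom_of c \<inter> V"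
    "map_of_chart c (chart_inv c (snd z)) = snd z" "?y z \<in> dom_of d \<inter> V" if "z \<in> M" for z
  proof -
    obtain x where x: "x \<in> dom_of c" "x \<in> V" "snd z = map_of_chart c x"
      using \<open>z \<in> M\<close> by (auto simp: M_def)
    then show "snd z \<in> map_of_chart c ` dom_of c" "chart_inv c (snd z) \<in> dom_of c \<inter> V"
      "map_of_chart c (chart_inv c (snd z)) = snd z" "?y z \<in> dom_of d \<inter> V"
      using \<open>z \<in> M\<close> chart_simps(1)[OF cc x(1)] by (auto simp: M_def)
  qed
  have "smooth_on M (\<lambda>z. fd ?G (?u z) (?w z))"
  proof (rule smooth_on_fd_apply[OF oM smooth_on_lift[OF d(1) oc msmooth_chart[OF cc]]
        smooth_on_Pair[OF oM smooth_on_bounded_linear[OF oM bl] 1] _ smooth_on_Pair[OF oM smooth_on_const[OF oM] 2]])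
    show "?u ` M \<subseteq> lift_dom d (dom_of c)"
    proof (rule image_subsetI)
      fix z assume z: "z \<in> M"
      show "?u z \<in> lift_dom d (dom_of c)"
        using in_M[OF z] by (simp add: chart_simps(1)[OF dd] tact_minus)
    qed
  qed
  then have "smooth_on M (\<lambda>z. vf_in_chart c (\<lambda>x. orbit_pull \<zeta> Y x (fst z)) (snd z))"
  proof (rule smooth_on_cong[OF oM])
    fix z assume z: "z \<in> M"
    let ?x = "chart_inv c (snd z)"
    have "vf_in_chart c (\<lambda>x. orbit_pull \<zeta> Y x (fst z)) (snd z) =
        differential A (\<lambda>y. map_of_chart c (tact (- (fst z *\<^sub>R \<zeta>)) y)) (?y z) (Y (?y z))"
      unfolding vf_in_chart_def
      by (rule differential_orbit_pull[OF oc msmooth_chart[OF cc]]) (use in_M[OF z] in simp)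
    also have "\<dots> = fd ?G (?u z) (?w z)"
      by (rule differential_tact_lift[OF c d(1)]) (use in_M[OF z] in \<open>simp_all add: tact_minus\<close>)
    finally show "fd ?G (?u z) (?w z) = vf_in_chart c (\<lambda>x. orbit_pull \<zeta> Y x (fst z)) (snd z)" by simp
  qed
  moreover have "z0 \<in> M"
    using z0 d(2) chart_simps(1)[OF cc] tact_V[of _ "fst z0 *\<^sub>R \<zeta>"] by (auto simp: M_def)
  ultimately show "\<exists>U. open U \<and> z0 \<in> U \<and> smooth_on U (\<lambda>z. vf_in_chart c (\<lambda>x. orbit_pull \<zeta> Y x (fst z)) (snd z))"
    using oM by blast
qed

lemma continuous_orbit_pull:
  assumes "smooth_vf V Y" "x \<in> V"
  shows "continuous_on S (orbit_pull \<zeta> Y x)"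
proof -
  let ?c = "chart_near x"
  have inv: "chart_inv ?c (map_of_chart ?c x) = x"
    by (rule chart_simps(1)[OF compat_chart_near chart_near(2)])
  have "continuous_on UNIV (\<lambda>t. vf_in_chart ?c (\<lambda>y. orbit_pull \<zeta> Y y (fst (t, map_of_chart ?c x))) (snd (t, map_of_chart ?c x)))"
    by (rule continuous_on_compose2[OF smooth_on_imp_continuous_on[OF smooth_orbit_pull[OF assms(1) chart_near(1)]]
          continuous_on_Pair[OF continuous_on_id continuous_on_const]])
      (use assms(2) chart_near(2) in auto)
  then have "continuous_on UNIV (orbit_pull \<zeta> Y x)"
    by (simp add: vf_in_chart_def inv differential_chart_near)
  then show ?thesis by (rule continuous_on_subset) simp
qed

lemma blinfun_average:
  fixes L :: "'e \<Rightarrow>\<^sub>L 'b::banach"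
  assumes "smooth_vf V Y" "x \<in> V"
  shows "L (average \<zeta> Y x) = (1 / (2 * pi)) *\<^sub>R integral {0..2 * pi} (\<lambda>t. L (orbit_pull \<zeta> Y x t))"
  using integral_blinfun_apply[OF integrable_continuous_real[OF continuous_orbit_pull[OF assms]], of 0 "2 * pi" L \<zeta>]
  by (simp add: average_def blinfun.scaleR_right)

text \<open>Linear equations satisfied by every pullback pass to the average. Tangency and the
  prescribed values of dh1 and dh2 are both of this kind.\<close>

lemma blinfun_average_const:
  fixes L :: "'e \<Rightarrow>\<^sub>L real"
  assumes "smooth_vf V Y" "x \<in> V" "\<And>t. L (orbit_pull \<zeta> Y x t) = b"
  shows "L (average \<zeta> Y x) = b"
  using blinfun_average[OF assms(1,2), of L \<zeta>] by (simp add: assms(3))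

lemma smooth_average:
  assumes Y: "smooth_vf V Y"
  shows "smooth_vf V (average \<zeta> Y)"
proof (rule smooth_vfI)
  fix x assume x: "x \<in> V"
  define c where "c = chart_near x"
  have c: "c \<in> A" "x \<in> dom_of c" using chart_near by (auto simp: c_def)
  note cc = compat_atlas[OF c(1)]
  let ?N = "dom_of c \<inter> V"
  have oN: "open ?N" using chart_simps(2)[OF cc] open_V by auto
  have o: "open (map_of_chart c ` ?N)" by (rule open_chart_image_Int[OF cc open_V])
  have "smooth_on (map_of_chart c ` ?N)
      (\<lambda>p. integral {0..2 * pi} (\<lambda>t. vf_in_chart c (\<lambda>x. orbit_pull \<zeta> Y x (fst (t, p))) (snd (t, p))))"
    by (rule smooth_on_integral[OF open_Times[OF open_UNIV o] o smooth_orbit_pull[OF Y c(1)]]) auto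
  from smooth_on_scaleR[OF o smooth_on_const[OF o] this, of "1 / (2 * pi)"]
  have "smooth_on (map_of_chart c ` ?N) ((\<lambda>x. differential A (map_of_chart c) x (average \<zeta> Y x)) \<circ> chart_inv c)"
  proof (rule smooth_on_cong[OF o])
    fix p assume "p \<in> map_of_chart c ` ?N"
    then have "chart_inv c p \<in> V" using chart_simps(1)[OF cc] by auto
    from blinfun_average[OF Y this, of "differential A (map_of_chart c) (chart_inv c p)" \<zeta>]
    show "(1 / (2 * pi)) *\<^sub>R integral {0..2 * pi} (\<lambda>t. vf_in_chart c (\<lambda>x. orbit_pull \<zeta> Y x (fst (t, p))) (snd (t, p))) =
      ((\<lambda>x. differential A (map_of_chart c) x (average \<zeta> Y x)) \<circ> chart_inv c) p"
      by (simp add: vf_in_chart_def)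
  qed
  then have "msmooth ?N (\<lambda>x. differential A (map_of_chart c) x (average \<zeta> Y x))"
    by (intro msmoothI_local exI[of _ c] exI[of _ ?N]) (use cc oN in auto)
  then show "\<exists>c N. compat_chart A c \<and> open N \<and> x \<in> N \<and> N \<subseteq> dom_of c \<and>
      msmooth N (\<lambda>x. differential A (map_of_chart c) x (average \<zeta> Y x))"
    using cc oN x c by blast
qed

text \<open>Since the group is abelian, the pushforward carries the pullback at \<open>x\<close> to
  the pullback at the translated point. Averaging over the second circle therefore does not spoil
  invariance under the first.\<close>

lemma average_invariant_other:
  assumes Y: "smooth_vf V Y" "vf_invariant \<eta> V Y"
  shows "vf_invariant \<eta> V (average \<zeta> Y)"
  unfolding vf_invariant_def
proof (intro allI ballI)
  fix s x assume x: "x \<in> V"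
  let ?g = "s *\<^sub>R \<eta>"
  have "Dact ?g x (orbit_pull \<zeta> Y x t) = orbit_pull \<zeta> Y (tact ?g x) t" for t
  proof -
    let ?y = "tact (t *\<^sub>R \<zeta>) x"
    have "Dact ?g x (orbit_pull \<zeta> Y x t) = Dact (?g + - (t *\<^sub>R \<zeta>)) ?y (Y ?y)"
      by (simp only: Dact_add orbit_pull_def tact_minus)
    also have "\<dots> = Dact (- (t *\<^sub>R \<zeta>)) (tact ?g ?y) (Dact ?g ?y (Y ?y))"
      by (simp only: Dact_add[symmetric] add.commute)
    also have "Dact ?g ?y (Y ?y) = Y (tact ?g ?y)"
      using Y(2) tact_V[OF x] by (simp add: vf_invariant_def)
    finally show ?thesis by (simp add: orbit_pull_def tact_commute[of ?g])
  qed
  then show "average \<zeta> Y (tact ?g x) = Dact ?g x (average \<zeta> Y x)"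
    using blinfun_average[OF Y(1) x, of "Dact ?g x" \<zeta>] by (simp add: average_def)
qed

text \<open>Translating the point by time \<open>s\<close> shifts the variable of integration by
  \<open>s\<close>, which a periodic integrand does not notice.\<close>

lemma average_invariant:
  assumes Y: "smooth_vf V Y" and period: "torus_exp ((2 * pi) *\<^sub>R \<zeta>) = (1, 1)"
  shows "vf_invariant \<zeta> V (average \<zeta> Y)"
  unfolding vf_invariant_def
proof (intro allI ballI)
  fix s x assume x: "x \<in> V"
  let ?g = "s *\<^sub>R \<zeta>"
  have "Dact ?g x (orbit_pull \<zeta> Y x t) = orbit_pull \<zeta> Y (tact ?g x) (t - s)" for t
  proof -
    let ?y = "tact (t *\<^sub>R \<zeta>) x"
    have "Dact ?g x (orbit_pull \<zeta> Y x t) = Dact (?g + - (t *\<^sub>R \<zeta>)) ?y (Y ?y)"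
      by (simp only: Dact_add orbit_pull_def tact_minus)
    moreover have "?g + - (t *\<^sub>R \<zeta>) = - ((t - s) *\<^sub>R \<zeta>)" by (simp add: algebra_simps)
    moreover have "?y = tact ((t - s) *\<^sub>R \<zeta>) (tact ?g x)"
      by (simp add: tact_add[symmetric] scaleR_add_left[symmetric])
    ultimately show ?thesis by (simp only: orbit_pull_def)
  qed
  then have "Dact ?g x (average \<zeta> Y x) = (1 / (2 * pi)) *\<^sub>R integral {0..2 * pi} (\<lambda>t. orbit_pull \<zeta> Y (tact ?g x) (t - s))"
    using blinfun_average[OF Y x, of "Dact ?g x" \<zeta>] by simp
  also have "integral {0..2 * pi} (\<lambda>t. orbit_pull \<zeta> Y (tact ?g x) (t - s)) = integral {0..2 * pi} (orbit_pull \<zeta> Y (tact ?g x))"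
  proof (rule integral_periodic_shift[OF continuous_orbit_pull[OF Y tact_V[OF x]]])
    have 1: "tact ((t + 2 * pi) *\<^sub>R \<zeta>) y = tact (t *\<^sub>R \<zeta>) y" for t y
    proof -
      have "tact ((2 * pi) *\<^sub>R \<zeta>) y = y" using tact_0 by (simp add: tact_def period torus_exp_0)
      then show ?thesis by (simp add: scaleR_add_left tact_add)
    qed
    have 2: "tact (- ((t + 2 * pi) *\<^sub>R \<zeta>)) y = tact (- (t *\<^sub>R \<zeta>)) y" for t y
      using 1[of "- t - 2 * pi" y] by (simp add: algebra_simps)
    show "orbit_pull \<zeta> Y (tact ?g x) (t + 2 * pi) = orbit_pull \<zeta> Y (tact ?g x) t" for t
      unfolding orbit_pull_def 1 Dact_cong[OF 2] ..
  qed simp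
  finally show "average \<zeta> Y (tact ?g x) = Dact ?g x (average \<zeta> Y x)" by (simp add: average_def)
qed

end

section \<open>Invariance of the tangent spaces of the foliation under flows tangent to it\<close>

locale foliated_torus_manifold = saturated_open A act V + foliated_manifold A V W F
  for A :: "('m::{t2_space, second_countable_topology}, 'e::euclidean_space) chart set" and act V W F
begin

text \<open>Where \<open>X \<zeta>\<close> is tangent to the foliation, its flow preserves the local first integrals
  \<open>l \<bullet> c\<close> of the foliation, hence the tangent spaces.\<close>

lemma TS_flow_local:
  assumes X: "\<And>x. x \<in> V \<Longrightarrow> X \<zeta> x \<in> TS x" and y: "y \<in> V"
  shows "\<exists>\<epsilon>>0. \<forall>s w. \<bar>s\<bar> < \<epsilon> \<longrightarrow> (Dact (s *\<^sub>R \<zeta>) y w \<in> TS (tact (s *\<^sub>R \<zeta>) y) \<longleftrightarrow> w \<in> TS y)"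
proof -
  obtain c where c: "c \<in> F" "y \<in> dom_of c" using foliated_cover[OF y] by blast
  note cc = foliated_chart(1)[OF c(1)]
  have oc: "open (dom_of c)" by (rule chart_simps(2)[OF cc])
  \<comment> \<open>A product neighbourhood is wanted: equality of differentials at \<open>y\<close>
    requires the first integrals to be preserved for all starting points in an open set
    \<open>N\<close> and the same short times.\<close>
  let ?D = "(\<lambda>z::real \<times> 'm. tact (fst z *\<^sub>R \<zeta>) (snd z)) -` dom_of c"
  have "continuous_on UNIV (\<lambda>z::real \<times> 'm. tact (fst (fst z *\<^sub>R \<zeta>, snd z)) (snd (fst z *\<^sub>R \<zeta>, snd z)))"
    by (rule continuous_on_compose2[OF continuous_on_tact]) (auto intro!: continuous_intros)
  then have "open ?D" by (intro open_vimage[OF oc]) simp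
  moreover have "(0, y) \<in> ?D" using c(2) by (simp add: tact_0)
  ultimately obtain I N where IN: "open I" "open N" "(0, y) \<in> I \<times> N" "I \<times> N \<subseteq> ?D"
    by (rule open_prod_elim)
  then obtain \<epsilon> where e: "\<epsilon> > 0" "ball 0 \<epsilon> \<subseteq> I" by (auto simp: open_contains_ball)
  have dom: "tact (s *\<^sub>R \<zeta>) z \<in> dom_of c" if "\<bar>s\<bar> < \<epsilon>" "z \<in> N" for s z
  proof -
    have "(s, z) \<in> I \<times> N" using e that by (auto simp: subset_iff dist_norm)
    then show ?thesis using IN(4) by auto
  qed
  have "Dact (s *\<^sub>R \<zeta>) y w \<in> TS (tact (s *\<^sub>R \<zeta>) y) \<longleftrightarrow> w \<in> TS y" if s: "\<bar>s\<bar> < \<epsilon>" for s w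
  proof -
    have "differential A (\<lambda>y. l \<bullet> map_of_chart c y) (tact (s *\<^sub>R \<zeta>) y) (Dact (s *\<^sub>R \<zeta>) y w) =
        differential A (\<lambda>y. l \<bullet> map_of_chart c y) y w" if l: "l \<in> W\<^sup>\<bottom>" for l
    proof -
      let ?f = "\<lambda>y. l \<bullet> map_of_chart c y"
      have f: "msmooth (dom_of c) ?f"
        by (rule msmooth_bounded_linear[OF oc bounded_linear_inner_right msmooth_chart[OF cc]])
      have const: "?f (tact (s *\<^sub>R \<zeta>) z) = ?f z" if z: "z \<in> N" for z
      proof -
        have "((\<lambda>t. ?f (tact (t *\<^sub>R \<zeta>) z)) has_vector_derivative 0) (at t within ball 0 \<epsilon>)" if "t \<in> ball 0 \<epsilon>" for t
        proof -
          let ?p = "tact (t *\<^sub>R \<zeta>) z"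
          have p: "?p \<in> dom_of c" using dom[OF _ z] that by (simp add: dist_norm)
          then have "X \<zeta> ?p \<in> TS ?p" using X foliated_chart(2)[OF c(1)] by blast
          then have "differential A ?f ?p (X \<zeta> ?p) = 0" using TS_iff_inner[OF c(1) p] l by blast
          then show ?thesis
            using flow_derivative[OF oc f p] by (simp add: has_vector_derivative_at_within)
        qed
        from has_vector_derivative_zero_constant[OF convex_ball this]
        obtain k where k: "\<And>t. t \<in> ball 0 \<epsilon> \<Longrightarrow> ?f (tact (t *\<^sub>R \<zeta>) z) = k" by blast
        then show ?thesis using k[of s] k[of 0] s e(1) by (simp add: dist_norm tact_0)
      qed
      have "differential A ?f (tact (s *\<^sub>R \<zeta>) y) (Dact (s *\<^sub>R \<zeta>) y w) = differential A (\<lambda>z. ?f (tact (s *\<^sub>R \<zeta>) z)) y w"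
        by (rule differential_Dact[OF oc f]) (use dom s IN(3) in auto)
      also have "differential A (\<lambda>z. ?f (tact (s *\<^sub>R \<zeta>) z)) y = differential A ?f y"
        by (rule differential_cong[OF IN(2)]) (use IN(3) const in auto)
      finally show ?thesis .
    qed
    moreover have "tact (s *\<^sub>R \<zeta>) y \<in> dom_of c" using dom s IN(3) by auto
    ultimately show ?thesis
      using TS_iff_inner[OF c] TS_iff_inner[OF c(1)] by simp
  qed
  then show ?thesis using e(1) by blast
qed

text \<open>\<open>TS_flow_local\<close> is an equivalence, so the truth value of tangency is
  locally constant in time, hence constant on the connected real line. This passes from short times,
  spent in one foliated chart, to all times.\<close>

lemma TS_flow:
  assumes X: "\<And>x. x \<in> V \<Longrightarrow> X \<zeta> x \<in> TS x" and x: "x \<in> V" and v: "v \<in> TS x"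
  shows "Dact (t *\<^sub>R \<zeta>) x v \<in> TS (tact (t *\<^sub>R \<zeta>) x)"
proof -
  define Q where "Q = (\<lambda>t. Dact (t *\<^sub>R \<zeta>) x v \<in> TS (tact (t *\<^sub>R \<zeta>) x))"
  have "Q 0 = Q t"
  proof (rule connected_local_const[where A = UNIV and f = Q and a = 0 and b = t])
    show "\<forall>a\<in>UNIV. \<forall>\<^sub>F b in at a. Q a = Q b"
    proof
      fix a :: real
      obtain \<epsilon> where e: "\<epsilon> > 0" "\<And>s w. \<bar>s\<bar> < \<epsilon> \<Longrightarrow>
        (Dact (s *\<^sub>R \<zeta>) (tact (a *\<^sub>R \<zeta>) x) w \<in> TS (tact (s *\<^sub>R \<zeta>) (tact (a *\<^sub>R \<zeta>) x)) \<longleftrightarrow> w \<in> TS (tact (a *\<^sub>R \<zeta>) x))"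
        using TS_flow_local[of \<zeta>, OF X tact_V[OF x]] by blast
      have "Q a = Q b" if b: "dist b a < \<epsilon>" for b
      proof -
        have "b *\<^sub>R \<zeta> = (b - a) *\<^sub>R \<zeta> + a *\<^sub>R \<zeta>" by (simp add: algebra_simps)
        then show ?thesis
          using e(2)[of "b - a" "Dact (a *\<^sub>R \<zeta>) x v"] b
          by (simp only: Q_def Dact_add tact_add dist_real_def)
      qed
      then show "\<forall>\<^sub>F b in at a. Q a = Q b"
        using e(1) by (auto simp: eventually_at)
    qed
  qed auto
  moreover have "Q 0" using v by (simp add: Q_def Dact_0 tact_0)
  ultimately show ?thesis by (simp add: Q_def)
qed

lemma average_TS:
  assumes X: "\<And>x. x \<in> V \<Longrightarrow> X \<zeta> x \<in> TS x"
    and Y: "smooth_vf V Y" "\<And>x. x \<in> V \<Longrightarrow> Y x \<in> TS x" and x: "x \<in> V"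
  shows "average \<zeta> Y x \<in> TS x"
proof -
  obtain c where c: "c \<in> F" "x \<in> dom_of c" using foliated_cover[OF x] by blast
  have pull: "orbit_pull \<zeta> Y x t \<in> TS x" for t
  proof -
    have "Dact ((- t) *\<^sub>R \<zeta>) (tact (t *\<^sub>R \<zeta>) x) (Y (tact (t *\<^sub>R \<zeta>) x)) \<in> TS (tact ((- t) *\<^sub>R \<zeta>) (tact (t *\<^sub>R \<zeta>) x))"
      by (rule TS_flow[OF X tact_V[OF x] Y(2)[OF tact_V[OF x]]])
    then show ?thesis by (simp add: orbit_pull_def tact_minus)
  qed
  show ?thesis
    unfolding TS_iff_inner[OF c]
  proof
    fix l assume "l \<in> W\<^sup>\<bottom>"
    then show "differential A (\<lambda>y. l \<bullet> map_of_chart c y) x (average \<zeta> Y x) = 0"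
      using pull TS_iff_inner[OF c] by (intro blinfun_average_const[OF Y(1) x]) blast
  qed
qed

end

context saturated_open
begin

text \<open>Translations preserve \<open>h\<close>, so dh takes on the pullback at \<open>x\<close>
  the value it takes on \<open>Y\<close> at the transported point, which is again
  \<open>a\<close>.\<close>

lemma average_invariant_function:
  assumes h: "msmooth UNIV h" "torus_invariant act h"
    and Y: "smooth_vf V Y" "\<And>x. x \<in> V \<Longrightarrow> differential A h x (Y x) = a" and x: "x \<in> V"
  shows "differential A h x (average \<zeta> Y x) = a"
proof (rule blinfun_average_const[OF Y(1) x])
  fix t
  have "(\<lambda>y. h (tact (- (t *\<^sub>R \<zeta>)) y)) = h"
    using h(2) torus_exp_in_torus by (auto simp: torus_invariant_def tact_def)
  then show "differential A h x (orbit_pull \<zeta> Y x t) = a"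
    using differential_orbit_pull[OF open_UNIV h(1) UNIV_I, of x \<zeta> Y t] Y(2)[OF tact_V[OF x]] by simp
qed

end

context torus_manifold
begin

lemma generator_invariant_function:
  assumes h: "msmooth UNIV h" "torus_invariant act h"
  shows "differential A h x (X \<zeta> x) = 0"
proof -
  have "(\<lambda>t. h (tact (t *\<^sub>R \<zeta>) x)) = (\<lambda>t. h x)"
    using h(2) torus_exp_in_torus by (auto simp: torus_invariant_def tact_def)
  then have "((\<lambda>t::real. h x) has_vector_derivative differential A h x (X \<zeta> x)) (at 0)"
    using flow_derivative_0[OF open_UNIV h(1) UNIV_I, of \<zeta> x] by simp
  then show ?thesis using vector_derivative_unique_at[OF _ has_vector_derivative_const] by blast
qed

end

section \<open>Brackets of vector fields annihilated by a function\<close>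

text \<open>Product rule for a derivative applied to a moving direction; the term with
  \<open>Y\<close> frozen at \<open>p\<close> carries the second derivative of
  \<open>u\<close>.\<close>

lemma fd_contraction:
  fixes u :: "'a::euclidean_space \<Rightarrow> 'b::real_normed_vector" and Y :: "'a \<Rightarrow> 'a"
  assumes "open S" "smooth_on S u" "smooth_on S Y" "p \<in> S"
  shows "fd (\<lambda>q. fd u q (Y q)) p w = fd (\<lambda>q. fd u q (Y p)) p w + fd u p (fd Y p w)"
proof -
  \<comment> \<open>Stated for an arbitrary field because it is applied twice, to \<open>Y\<close>
    and to the constant field \<open>Y p\<close>; the basis sums agree, and the term with the
    derivative of \<open>Y\<close> is left over.\<close>
  have expand: "fd (\<lambda>q. fd u q (Z q)) p w =
      (\<Sum>b\<in>Basis. (Z p \<bullet> b) *\<^sub>R fd (\<lambda>q. fd u q b) p w) + fd u p (fd Z p w)"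
    if Z: "smooth_on S Z" for Z :: "'a \<Rightarrow> 'a"
  proof -
    have "((\<lambda>q. \<Sum>b\<in>Basis. (Z q \<bullet> b) *\<^sub>R fd u q b) has_derivative
        (\<lambda>w. \<Sum>b\<in>Basis. (Z p \<bullet> b) *\<^sub>R fd (\<lambda>q. fd u q b) p w + (fd Z p w \<bullet> b) *\<^sub>R fd u p b)) (at p)"
      by (intro has_derivative_sum has_derivative_scaleR
          bounded_linear.has_derivative[OF bounded_linear_inner_left]
          smooth_on_has_derivative[OF Z assms(4)] smooth_on_has_derivative[OF smooth_on_fd[OF assms(2)] assms(4)])
    then have "((\<lambda>q. fd u q (Z q)) has_derivative
        (\<lambda>w. \<Sum>b\<in>Basis. (Z p \<bullet> b) *\<^sub>R fd (\<lambda>q. fd u q b) p w + (fd Z p w \<bullet> b) *\<^sub>R fd u p b)) (at p)"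
      by (rule has_derivative_transform_within_open[OF _ assms(1,4)])
        (rule linear_basis_expansion[OF has_derivative_linear[OF smooth_on_has_derivative[OF assms(2)]], symmetric])
    from fd_eq[OF this] show ?thesis
      using linear_basis_expansion[OF has_derivative_linear[OF smooth_on_has_derivative[OF assms(2,4)]], of "fd Z p w"]
      by (simp add: sum.distrib)
  qed
  show ?thesis
    unfolding expand[OF assms(3)] expand[OF smooth_on_const[OF assms(1), of "Y p"]]
    using linear_0[OF has_derivative_linear[OF smooth_on_has_derivative[OF assms(2,4)]]] by simp
qed

text \<open>Differentiating the first constant along \<open>Y2\<close> and the second along
  \<open>Y1\<close> produces second derivatives of \<open>u\<close> in the same two directions, in
  opposite order. By symmetry they cancel on subtraction.\<close>

lemma bracket_annihilated:
  fixes u :: "'a::euclidean_space \<Rightarrow> 'b::banach"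
  assumes S: "open S" "p \<in> S" and u: "smooth_on S u" and Y: "smooth_on S Y1" "smooth_on S Y2"
    and const: "\<And>q. q \<in> S \<Longrightarrow> fd u q (Y1 q) = a" "\<And>q. q \<in> S \<Longrightarrow> fd u q (Y2 q) = b"
  shows "fd u p (fd Y2 p (Y1 p) - fd Y1 p (Y2 p)) = 0"
proof -
  have "fd (\<lambda>q. fd u q (Y1 q)) p w = 0" "fd (\<lambda>q. fd u q (Y2 q)) p w = 0" for w
    using fd_eq_on_open[OF S, of "\<lambda>q. fd u q (Y1 q)" "\<lambda>q. a"] fd_eq_on_open[OF S, of "\<lambda>q. fd u q (Y2 q)" "\<lambda>q. b"]
      const by simp_all
  then have "fd (\<lambda>q. fd u q (Y1 p)) p (Y2 p) + fd u p (fd Y1 p (Y2 p)) = 0"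
    "fd (\<lambda>q. fd u q (Y2 p)) p (Y1 p) + fd u p (fd Y2 p (Y1 p)) = 0"
    using fd_contraction[OF S(1) u Y(1) S(2), of "Y2 p"] fd_contraction[OF S(1) u Y(2) S(2), of "Y1 p"] by simp_all
  then have "fd u p (fd Y2 p (Y1 p)) = fd u p (fd Y1 p (Y2 p))"
    using smooth_on_fd_commute[OF S(1) u S(2), of "Y1 p" "Y2 p"] by (metis add_left_cancel)
  then show ?thesis
    using linear_diff[OF has_derivative_linear[OF smooth_on_has_derivative[OF u S(2)]]] by simp
qed

context smooth_manifold
begin

text \<open>The coordinate formula for the Lie bracket, in the selected chart at \<open>x\<close>,
  where components and vector coincide.\<close>

definition bracket :: "('m \<Rightarrow> 'e) \<Rightarrow> ('m \<Rightarrow> 'e) \<Rightarrow> 'm \<Rightarrow> 'e" where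
  "bracket Y1 Y2 x = (let c = chart_near x; p = map_of_chart c x in
     fd (vf_in_chart c Y2) p (vf_in_chart c Y1 p) - fd (vf_in_chart c Y1) p (vf_in_chart c Y2 p))"

text \<open>Serves twice: with first integrals of the foliation and a = b = 0 it makes the bracket
  tangent to the leaves, with \<open>h1\<close> and \<open>h2\<close> it makes it tangent to the
  level sets.\<close>

lemma bracket_annihilated_function:
  fixes f :: "'m \<Rightarrow> real"
  assumes U: "open U" "x \<in> U" and f: "msmooth U f" and Y: "smooth_vf U Y1" "smooth_vf U Y2"
    and const: "\<And>y. y \<in> U \<Longrightarrow> differential A f y (Y1 y) = a" "\<And>y. y \<in> U \<Longrightarrow> differential A f y (Y2 y) = b"
  shows "differential A f x (bracket Y1 Y2 x) = 0"
proof -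
  define c where "c = chart_near x"
  have c: "c \<in> A" "x \<in> dom_of c" using chart_near by (auto simp: c_def)
  note cc = compat_atlas[OF c(1)]
  let ?S = "map_of_chart c ` (dom_of c \<inter> U)" and ?p = "map_of_chart c x"
  have o: "open ?S" by (rule open_chart_image_Int[OF cc U(1)])
  have p: "?p \<in> ?S" using c U by auto
  have eq: "fd (f \<circ> chart_inv c) q (vf_in_chart c Y q) = differential A f (chart_inv c q) (Y (chart_inv c q))"
    "chart_inv c q \<in> U" if "q \<in> ?S" for q Y
    using that chart_simps(1)[OF cc] differential_chart[OF f U(1) _ cc] by (auto simp: vf_in_chart_def)
  have "fd (f \<circ> chart_inv c) ?p (bracket Y1 Y2 x) = 0"
    unfolding bracket_def Let_def c_def[symmetric]
    by (rule bracket_annihilated[OF o p msmooth_compat[OF f U(1) cc] smooth_on_vf_in_chart[OF U(1) Y(1) c(1)]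
          smooth_on_vf_in_chart[OF U(1) Y(2) c(1)]])
      (simp_all add: eq const)
  then show ?thesis
    using differential_chart[OF f U cc c(2)] differential_chart_near by (simp add: c_def)
qed

section \<open>The bivector field \<open>Y\<^sub>1 \<and> X\<^sub>1 + Y\<^sub>2 \<and> X\<^sub>2\<close>\<close>

text \<open>The transverse fields are controlled on \<open>V\<close> only, hence the explicit value
  0 elsewhere.\<close>

definition restricted_wedge_sum where
  "restricted_wedge_sum V X1 X2 Y1 Y2 x (\<alpha> :: 'e \<Rightarrow>\<^sub>L real) (\<beta> :: 'e \<Rightarrow>\<^sub>L real) =
     (if x \<in> V then wedge_sum X1 X2 Y1 Y2 (x::'m) \<alpha> \<beta> else 0)"

lemma vf_support_zero: "x \<notin> vf_support Z \<Longrightarrow> Z x = 0"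
  using closure_subset[of "{x. Z x \<noteq> 0}"] by (auto simp: vf_support_def)

text \<open>Two open sets cover the manifold: \<open>V\<close>, where all four fields are smooth,
  and the complement of the supports, where every term contains a vanishing \<open>X1\<close> or
  \<open>X2\<close>.\<close>

lemma bivector_field_restricted_wedge_sum:
  assumes V: "open V" "vf_support X1 \<union> vf_support X2 \<subseteq> V"
    and X: "smooth_vf V X1" "smooth_vf V X2" and Y: "smooth_vf V Y1" "smooth_vf V Y2"
  shows "bivector_field A (restricted_wedge_sum V X1 X2 Y1 Y2)"
  unfolding bivector_field_def
proof (intro conjI allI ballI)
  let ?P = "restricted_wedge_sum V X1 X2 Y1 Y2"
  show "bilinear (?P x)" for x
    unfolding bilinear_def restricted_wedge_sum_def wedge_sum_def
    by (auto intro!: linearI simp: blinfun.add_left blinfun.scaleR_left algebra_simps)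
  show "?P x \<alpha> \<alpha> = 0" for x \<alpha> by (simp add: restricted_wedge_sum_def wedge_sum_def)
  fix c and \<alpha> \<beta> :: "'e \<Rightarrow>\<^sub>L real" assume c: "c \<in> A"
  note cc = compat_atlas[OF c]
  let ?f = "\<lambda>x. ?P x (\<alpha> o\<^sub>L differential A (map_of_chart c) x) (\<beta> o\<^sub>L differential A (map_of_chart c) x)"
  have oc: "open (dom_of c)" by (rule chart_simps(2)[OF cc])
  have "msmooth (dom_of c) ?f"
  proof (rule msmooth_local)
    fix x assume x: "x \<in> dom_of c"
    show "\<exists>N. open N \<and> x \<in> N \<and> msmooth N ?f"
    proof (cases "x \<in> V")
      case True
      have o: "open (V \<inter> dom_of c)" using V(1) oc by auto
      have comp: "msmooth (V \<inter> dom_of c) (\<lambda>x. \<gamma> (differential A (map_of_chart c) x (Z x)))"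
        if "smooth_vf V Z" for Z and \<gamma> :: "'e \<Rightarrow>\<^sub>L real"
        by (rule msmooth_bounded_linear[OF o blinfun.bounded_linear_right])
          (use that c in \<open>simp add: smooth_vf_def\<close>)
      have "msmooth (V \<inter> dom_of c) (\<lambda>x. wedge_sum X1 X2 Y1 Y2 x
          (\<lambda>v. \<alpha> (differential A (map_of_chart c) x v)) (\<lambda>v. \<beta> (differential A (map_of_chart c) x v)))"
        unfolding wedge_sum_def by (intro msmooth_add msmooth_diff msmooth_mult comp o X Y)
      then have "msmooth (V \<inter> dom_of c) ?f"
        by (rule msmooth_cong[OF o]) (simp add: restricted_wedge_sum_def wedge_sum_def)
      then show ?thesis using o x True by blast
    next
      case False
      let ?N = "- (vf_support X1 \<union> vf_support X2)"
      have o: "open ?N" by (auto simp: vf_support_def)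
      have "X1 y = 0" "X2 y = 0" if "y \<in> ?N" for y
        using that by (auto intro: vf_support_zero)
      then have "msmooth ?N ?f"
        by (intro msmooth_cong[OF o msmooth_const[OF o, of 0]])
          (simp add: restricted_wedge_sum_def wedge_sum_def blinfun.zero_right)
      then show ?thesis using o V(2) False by blast
    qed
  qed
  from msmooth_compat[OF this oc cc] show "smooth_on (map_of_chart c ` dom_of c) (?f \<circ> chart_inv c)" by simp
qed

lemma poisson_restricted_wedge_sum:
  assumes V: "open V" "vf_support X1 \<union> vf_support X2 \<subseteq> V"
    and X: "smooth_vf V X1" "smooth_vf V X2" and Y: "smooth_vf V Y1" "smooth_vf V Y2"
    and comm: "\<And>x. x \<in> V \<Longrightarrow> bracket X1 X2 x = 0"
      "\<And>x. x \<in> V \<Longrightarrow> bracket X1 Y1 x = 0" "\<And>x. x \<in> V \<Longrightarrow> bracket X2 Y1 x = 0"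
      "\<And>x. x \<in> V \<Longrightarrow> bracket X1 Y2 x = 0" "\<And>x. x \<in> V \<Longrightarrow> bracket X2 Y2 x = 0"
    and span: "\<And>x. x \<in> V \<Longrightarrow> wedge_vectors (X1 x) (X2 x) \<noteq> (\<lambda>\<alpha> \<beta>. 0) \<Longrightarrow> bracket Y1 Y2 x \<in> span {X1 x, X2 x}"
  shows "poisson_structure A (restricted_wedge_sum V X1 X2 Y1 Y2)"
  unfolding poisson_structure_def
proof (intro conjI ext)
  let ?P = "restricted_wedge_sum V X1 X2 Y1 Y2"
  show "bivector_field A ?P" by (rule bivector_field_restricted_wedge_sum[OF V X Y])
  fix x and \<alpha> \<beta> \<gamma> :: "'e \<Rightarrow>\<^sub>L real"
  define c where "c = chart_near x"
  have c: "c \<in> A" "x \<in> dom_of c" using chart_near by (auto simp: c_def)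
  note cc = compat_atlas[OF c(1)]
  have oc: "open (dom_of c)" by (rule chart_simps(2)[OF cc])
  let ?p = "map_of_chart c x" and ?v = "vf_in_chart c"
  \<comment> \<open>For equal arguments the Schouten bracket is twice this cyclic sum.\<close>
  have "pairing A ?P (pairing A ?P (blinfun_apply \<alpha> \<circ> map_of_chart c) (blinfun_apply \<beta> \<circ> map_of_chart c)) (blinfun_apply \<gamma> \<circ> map_of_chart c) x
      + pairing A ?P (pairing A ?P (blinfun_apply \<beta> \<circ> map_of_chart c) (blinfun_apply \<gamma> \<circ> map_of_chart c)) (blinfun_apply \<alpha> \<circ> map_of_chart c) x
      + pairing A ?P (pairing A ?P (blinfun_apply \<gamma> \<circ> map_of_chart c) (blinfun_apply \<alpha> \<circ> map_of_chart c)) (blinfun_apply \<beta> \<circ> map_of_chart c) x = 0"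
  proof (cases "x \<in> V")
    case False
    then show ?thesis by (simp add: pairing_def restricted_wedge_sum_def)
  next
    case True
    let ?S = "map_of_chart c ` (dom_of c \<inter> V)"
    have oS: "open ?S" by (rule open_chart_image_Int[OF cc V(1)])
    have pS: "?p \<in> ?S" using c True by auto
    have oN: "open (dom_of c \<inter> V)" using oc V(1) by auto
    note smooth = smooth_on_vf_in_chart[OF V(1) X(1) c(1)] smooth_on_vf_in_chart[OF V(1) X(2) c(1)]
      smooth_on_vf_in_chart[OF V(1) Y(1) c(1)] smooth_on_vf_in_chart[OF V(1) Y(2) c(1)]
    define Q where "Q = wedge_sum (?v X1) (?v X2) (?v Y1) (?v Y2)"
    have lin: "differential A (blinfun_apply a \<circ> map_of_chart c) y v = a (differential A (map_of_chart c) y v)"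
      if "y \<in> dom_of c" for a :: "'e \<Rightarrow>\<^sub>L real" and y v
      using differential_bounded_linear[OF blinfun.bounded_linear_right msmooth_chart[OF cc] oc that] by (simp add: o_def)
    have vx: "?v Z ?p = Z x" for Z
      unfolding vf_in_chart_def chart_simps(1)[OF cc c(2)] by (simp add: c_def differential_chart_near)
    have inner: "pairing A ?P (blinfun_apply a \<circ> map_of_chart c) (blinfun_apply b \<circ> map_of_chart c) y = Q (map_of_chart c y) a b"
      if "y \<in> dom_of c \<inter> V" for a b y
      using that by (simp add: pairing_def restricted_wedge_sum_def Q_def wedge_sum_def lin vf_in_chart_def chart_simps(1)[OF cc])
    have Q_smooth: "smooth_on ?S (\<lambda>q. Q q a b)" for a b :: "'e \<Rightarrow>\<^sub>L real"
      unfolding Q_def wedge_sum_def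
      by (intro smooth_on_add smooth_on_diff smooth_on_mult oS smooth_on_bounded_linear_comp[OF oS blinfun.bounded_linear_right] smooth)
    \<comment> \<open>The inner pairing agrees with its coordinate expression on a neighbourhood of
      \<open>x\<close>, which is enough to compute its differential there.\<close>
    have outer: "pairing A ?P (pairing A ?P (blinfun_apply a \<circ> map_of_chart c) (blinfun_apply b \<circ> map_of_chart c))
        (blinfun_apply e \<circ> map_of_chart c) x = Q ?p (fd (\<lambda>q. Q q a b) ?p) e" for a b e :: "'e \<Rightarrow>\<^sub>L real"
    proof -
      let ?F = "pairing A ?P (blinfun_apply a \<circ> map_of_chart c) (blinfun_apply b \<circ> map_of_chart c)"
      have "differential A ?F x v = fd (\<lambda>q. Q q a b) ?p v" for v
      proof -
        have "differential A ?F x v = differential A (\<lambda>y. Q (map_of_chart c y) a b) x v"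
          using differential_cong[OF oN, of x ?F "\<lambda>y. Q (map_of_chart c y) a b"] inner c(2) True by auto
        also have "\<dots> = fd (\<lambda>q. Q q a b) ?p (differential A (map_of_chart c) x v)"
          by (rule differential_compose[OF smooth_on_differentiable[OF Q_smooth pS] msmooth_chart[OF cc] oc c(2)])
        finally show ?thesis by (simp add: c_def differential_chart_near)
      qed
      moreover have "differential A (blinfun_apply e \<circ> map_of_chart c) x v = e v" for v
        using lin[OF c(2)] by (simp add: c_def differential_chart_near)
      ultimately show ?thesis
        using True by (simp add: pairing_def[of A ?P ?F] restricted_wedge_sum_def Q_def wedge_sum_def vx)
    qed
    define R where "R = bracket Y1 Y2 x"
    have br: "fd (?v Z2) ?p (?v Z1 ?p) = fd (?v Z1) ?p (?v Z2 ?p) + bracket Z1 Z2 x" for Z1 Z2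
      by (simp add: bracket_def Let_def c_def)
    \<comment> \<open>The trivector R \<and> X1 \<and> X2 vanishes at \<open>x\<close> for one of
      two reasons: X1 \<and> X2 is zero there, or \<open>R\<close> is a combination of
      \<open>X1 x\<close> and \<open>X2 x\<close>.\<close>
    have R: "\<alpha> R * (\<beta> (?v X1 ?p) * \<gamma> (?v X2 ?p) - \<beta> (?v X2 ?p) * \<gamma> (?v X1 ?p))
      + \<beta> R * (\<gamma> (?v X1 ?p) * \<alpha> (?v X2 ?p) - \<gamma> (?v X2 ?p) * \<alpha> (?v X1 ?p))
      + \<gamma> R * (\<alpha> (?v X1 ?p) * \<beta> (?v X2 ?p) - \<alpha> (?v X2 ?p) * \<beta> (?v X1 ?p)) = 0"
    proof (cases "wedge_vectors (X1 x) (X2 x) = (\<lambda>\<alpha> \<beta>. 0)")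
      case True
      have "a (X1 x) * b (X2 x) - a (X2 x) * b (X1 x) = 0" for a b :: "'e \<Rightarrow>\<^sub>L real"
        using fun_cong[OF fun_cong[OF True, of a], of b] by (simp add: wedge_vectors_def)
      then show ?thesis by (simp add: vx)
    next
      case False
      then have "R \<in> span {X1 x, X2 x}" using span \<open>x \<in> V\<close> by (simp add: R_def)
      then obtain s t where "R = s *\<^sub>R X1 x + t *\<^sub>R X2 x"
        by (auto simp: span_insert span_singleton) (metis add.commute diff_add_cancel)
      then show ?thesis
        by (simp add: vx blinfun.add_right blinfun.scaleR_right algebra_simps)
    qed
    have comm': "fd (?v X2) ?p (?v X1 ?p) = fd (?v X1) ?p (?v X2 ?p)"
      "fd (?v Y1) ?p (?v X1 ?p) = fd (?v X1) ?p (?v Y1 ?p)" "fd (?v Y1) ?p (?v X2 ?p) = fd (?v X2) ?p (?v Y1 ?p)"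
      "fd (?v Y2) ?p (?v X1 ?p) = fd (?v X1) ?p (?v Y2 ?p)" "fd (?v Y2) ?p (?v X2 ?p) = fd (?v X2) ?p (?v Y2 ?p)"
      using br[of X2 X1] br[of Y1 X1] br[of Y1 X2] br[of Y2 X1] br[of Y2 X2] comm[OF True] by simp_all
    show ?thesis
      unfolding outer unfolding Q_def
      by (rule coord_jacobi[OF smooth[THEN smooth_on_differentiable, OF pS] comm' br[of Y2 Y1, folded R_def] R])
  qed
  then show "schouten_bracket A ?P ?P x \<alpha> \<beta> \<gamma> = 0"
    unfolding schouten_bracket_def Let_def c_def[symmetric] by linarith
qed

end

context saturated_open
begin

lemma bracket_generator:
  assumes "x \<in> V" "smooth_vf V Y" "vf_invariant \<zeta> V Y"
  shows "bracket (X \<zeta>) Y x = 0"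
  using invariant_commutes[OF open_V assms chart_near] by (simp add: bracket_def Let_def)

end

text \<open>Covectors separate vectors: two candidates are compared by the inner product with their
  difference.\<close>

lemma sharp_eqI:
  assumes "\<And>\<beta>. p \<alpha> \<beta> = blinfun_apply \<beta> v"
  shows "sharp p \<alpha> = v"
  unfolding sharp_def
proof (rule the_equality)
  fix w assume "\<forall>\<beta>. p \<alpha> \<beta> = blinfun_apply \<beta> w"
  then have "blinfun_inner_left (w - v) w = blinfun_inner_left (w - v) v" using assms by metis
  then have "(w - v) \<bullet> (w - v) = 0" by (simp add: inner_diff_left)
  then show "w = v" by simp
qed (use assms in simp)

section \<open>Invariant transverse fields and the resulting Poisson structure\<close>

context foliated_torus_manifold
begin

text \<open>Each averaging relies on the tangency of its own generator to keep the field tangent to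
  the foliation, and on the invariance of \<open>h1\<close> and \<open>h2\<close> to keep the values
  \<open>a\<close> and \<open>b\<close>.\<close>

lemma invariant_transverse_section:
  assumes h: "msmooth UNIV h1" "msmooth UNIV h2" "torus_invariant act h1" "torus_invariant act h2"
    and ind: "independent_functions_on A V h1 h2"
    and trans: "\<forall>x\<in>V. {s + l |s l. s \<in> TS x \<and> l \<in> level_tangent A h1 h2 x} = UNIV"
    and tangent: "\<And>x. x \<in> V \<Longrightarrow> X (1, 0) x \<in> TS x" "\<And>x. x \<in> V \<Longrightarrow> X (0, 1) x \<in> TS x"
  shows "\<exists>Y. smooth_vf V Y \<and> vf_invariant (1, 0) V Y \<and> vf_invariant (0, 1) V Y \<and>
    (\<forall>x\<in>V. Y x \<in> TS x \<and> differential A h1 x (Y x) = a \<and> differential A h2 x (Y x) = b)"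
proof -
  obtain Z where Z: "smooth_vf V Z" "\<And>x. x \<in> V \<Longrightarrow> Z x \<in> TS x"
    "\<And>x. x \<in> V \<Longrightarrow> differential A h1 x (Z x) = a" "\<And>x. x \<in> V \<Longrightarrow> differential A h2 x (Z x) = b"
    using transverse_section[OF open_V h(1,2) ind trans, of a b] by blast
  define Y1 where "Y1 = average (1, 0) Z"
  have Y1: "smooth_vf V Y1" unfolding Y1_def by (rule smooth_average[OF Z(1)])
  have Y1_TS: "Y1 x \<in> TS x" if "x \<in> V" for x
    unfolding Y1_def by (rule average_TS[OF tangent(1) Z(1,2) that])
  have Y1_h: "differential A h1 x (Y1 x) = a" "differential A h2 x (Y1 x) = b" if "x \<in> V" for x
    unfolding Y1_def
    by (rule average_invariant_function[OF h(1,3) Z(1,3) that], assumption)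
      (rule average_invariant_function[OF h(2,4) Z(1,4) that])
  have "vf_invariant (1, 0) V Y1"
    unfolding Y1_def by (rule average_invariant[OF Z(1)]) (simp add: torus_exp_def)
  then have "vf_invariant (1, 0) V (average (0, 1) Y1)"
    by (rule average_invariant_other[OF Y1])
  moreover have "vf_invariant (0, 1) V (average (0, 1) Y1)"
    by (rule average_invariant[OF Y1]) (simp add: torus_exp_def)
  moreover have "average (0, 1) Y1 x \<in> TS x" if "x \<in> V" for x
    by (rule average_TS[OF tangent(2) Y1 Y1_TS that])
  moreover have "differential A h1 x (average (0, 1) Y1 x) = a" if "x \<in> V" for x
    by (rule average_invariant_function[OF h(1,3) Y1 Y1_h(1) that])
  moreover have "differential A h2 x (average (0, 1) Y1 x) = b" if "x \<in> V" for x
    by (rule average_invariant_function[OF h(2,4) Y1 Y1_h(2) that])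
  ultimately show ?thesis
    using smooth_average[OF Y1] by blast
qed

lemma poisson_exists:
  assumes h: "msmooth UNIV h1" "msmooth UNIV h2" "torus_invariant act h1" "torus_invariant act h2"
    and ind: "independent_functions_on A V h1 h2"
    and compat: "compatible_foliation A V h1 h2 (X (1, 0)) (X (0, 1)) W F"
    and supp: "vf_support (X (1, 0)) \<union> vf_support (X (0, 1)) \<subseteq> V"
  shows "\<exists>P. poisson_structure A P \<and>
    hamiltonian_with_momentum A P act (\<lambda>x. Blinfun (\<lambda>\<xi>. fst \<xi> * h1 x + snd \<xi> * h2 x))"
proof -
  let ?X1 = "X (1, 0)" and ?X2 = "X (0, 1)"
  have trans: "\<forall>x\<in>V. {s + l |s l. s \<in> TS x \<and> l \<in> level_tangent A h1 h2 x} = UNIV"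
    and orb: "\<And>x. x \<in> V \<Longrightarrow> orbit_tangent ?X1 ?X2 x \<subseteq> TS x"
    and orb_eq: "\<And>x. x \<in> V \<Longrightarrow> wedge_vectors (?X1 x) (?X2 x) \<noteq> (\<lambda>\<alpha> \<beta>. 0) \<Longrightarrow>
      orbit_tangent ?X1 ?X2 x = TS x \<inter> level_tangent A h1 h2 x"
    using compat unfolding compatible_foliation_def by blast+
  have tangent: "?X1 x \<in> TS x" "?X2 x \<in> TS x" if "x \<in> V" for x
    using orb[OF that] unfolding orbit_tangent_def by (auto intro: span_base)
  have sections: "\<exists>Y. smooth_vf V Y \<and> vf_invariant (1, 0) V Y \<and> vf_invariant (0, 1) V Y \<and>
    (\<forall>x\<in>V. Y x \<in> TS x \<and> differential A h1 x (Y x) = a \<and> differential A h2 x (Y x) = b)" for a b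
    by (rule invariant_transverse_section[OF h ind trans tangent])
  obtain Y1 where Y1: "smooth_vf V Y1" "vf_invariant (1, 0) V Y1" "vf_invariant (0, 1) V Y1"
    "\<And>x. x \<in> V \<Longrightarrow> Y1 x \<in> TS x" "\<And>x. x \<in> V \<Longrightarrow> differential A h1 x (Y1 x) = 1"
    "\<And>x. x \<in> V \<Longrightarrow> differential A h2 x (Y1 x) = 0"
    using sections[of 1 0] by blast
  obtain Y2 where Y2: "smooth_vf V Y2" "vf_invariant (1, 0) V Y2" "vf_invariant (0, 1) V Y2"
    "\<And>x. x \<in> V \<Longrightarrow> Y2 x \<in> TS x" "\<And>x. x \<in> V \<Longrightarrow> differential A h1 x (Y2 x) = 0"
    "\<And>x. x \<in> V \<Longrightarrow> differential A h2 x (Y2 x) = 1"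
    using sections[of 0 1] by blast
  have bracket_tangent: "bracket Y1 Y2 x \<in> span {?X1 x, ?X2 x}"
    if x: "x \<in> V" and indep: "wedge_vectors (?X1 x) (?X2 x) \<noteq> (\<lambda>\<alpha> \<beta>. 0)" for x
  proof -
    obtain c where c: "c \<in> F" "x \<in> dom_of c" using foliated_cover[OF x] by blast
    note cc = foliated_chart(1)[OF c(1)]
    have oc: "open (dom_of c)" by (rule chart_simps(2)[OF cc])
    have cV: "dom_of c \<subseteq> V" by (rule foliated_chart(2)[OF c(1)])
    have "bracket Y1 Y2 x \<in> TS x"
      unfolding TS_iff_inner[OF c]
    proof
      fix l assume l: "l \<in> W\<^sup>\<bottom>"
      show "differential A (\<lambda>y. l \<bullet> map_of_chart c y) x (bracket Y1 Y2 x) = 0"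
      proof (rule bracket_annihilated_function[OF oc c(2)
            msmooth_bounded_linear[OF oc bounded_linear_inner_right msmooth_chart[OF cc]]
            smooth_vf_subset[OF Y1(1) cV] smooth_vf_subset[OF Y2(1) cV]])
        fix y assume y: "y \<in> dom_of c"
        show "differential A (\<lambda>y. l \<bullet> map_of_chart c y) y (Y1 y) = 0"
          using Y1(4)[of y] TS_iff_inner[OF c(1) y] l cV y by blast
        show "differential A (\<lambda>y. l \<bullet> map_of_chart c y) y (Y2 y) = 0"
          using Y2(4)[of y] TS_iff_inner[OF c(1) y] l cV y by blast
      qed
    qed
    moreover have "differential A h1 x (bracket Y1 Y2 x) = 0"
      by (rule bracket_annihilated_function[OF open_V x msmooth_subset[OF h(1)] Y1(1) Y2(1) Y1(5) Y2(5)]) simp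
    moreover have "differential A h2 x (bracket Y1 Y2 x) = 0"
      by (rule bracket_annihilated_function[OF open_V x msmooth_subset[OF h(2)] Y1(1) Y2(1) Y1(6) Y2(6)]) simp
    \<comment> \<open>The third compatibility condition applies, as the generators are independent
      at \<open>x\<close>.\<close>
    ultimately have "bracket Y1 Y2 x \<in> orbit_tangent ?X1 ?X2 x"
      unfolding orb_eq[OF x indep] by (simp add: level_tangent_def)
    then show ?thesis by (simp add: orbit_tangent_def)
  qed
  have smX: "smooth_vf V (X \<zeta>)" for \<zeta> by (rule smooth_vf_subset[OF smooth_vf_generator]) simp
  let ?P = "restricted_wedge_sum V ?X1 ?X2 Y1 Y2"
  have "poisson_structure A ?P"
    by (rule poisson_restricted_wedge_sum[OF open_V supp smX smX Y1(1) Y2(1)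
          bracket_generator[OF _ smX generator_invariant]
          bracket_generator[OF _ Y1(1,2)] bracket_generator[OF _ Y1(1,3)]
          bracket_generator[OF _ Y2(1,2)] bracket_generator[OF _ Y2(1,3)] bracket_tangent])
  moreover have "hamiltonian_with_momentum A ?P act (\<lambda>x. Blinfun (\<lambda>\<xi>. fst \<xi> * h1 x + snd \<xi> * h2 x))"
    unfolding hamiltonian_with_momentum_def
  proof (intro allI conjI)
    fix \<xi> :: "real \<times> real"
    \<comment> \<open>\<open>Blinfun\<close> returns the intended functional only for bounded linear
      arguments.\<close>
    have bl: "bounded_linear (\<lambda>\<xi>::real \<times> real. fst \<xi> * h1 x + snd \<xi> * h2 x)" for x
      by (intro bounded_linear_add bounded_linear_mult_const bounded_linear_fst bounded_linear_snd)
    have J: "(\<lambda>x. blinfun_apply (Blinfun (\<lambda>\<xi>. fst \<xi> * h1 x + snd \<xi> * h2 x)) \<xi>) = (\<lambda>x. fst \<xi> * h1 x + snd \<xi> * h2 x)"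
      by (simp add: bounded_linear_Blinfun_apply[OF bl])
    have sm: "msmooth UNIV (\<lambda>x. fst \<xi> * h1 x)" "msmooth UNIV (\<lambda>x. snd \<xi> * h2 x)"
      by (intro msmooth_mult msmooth_const open_UNIV h)+
    show "smooth_function A (\<lambda>x. blinfun_apply (Blinfun (\<lambda>\<xi>. fst \<xi> * h1 x + snd \<xi> * h2 x)) \<xi>)"
      unfolding J smooth_function_iff by (rule msmooth_add[OF open_UNIV sm])
    fix x
    have dJ: "differential A (\<lambda>x. fst \<xi> * h1 x + snd \<xi> * h2 x) x v =
        fst \<xi> * differential A h1 x v + snd \<xi> * differential A h2 x v" for v
      using differential_add[OF sm open_UNIV UNIV_I]
        differential_bounded_linear[OF bounded_linear_mult_right h(1) open_UNIV UNIV_I]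
        differential_bounded_linear[OF bounded_linear_mult_right h(2) open_UNIV UNIV_I] by simp
    show "sharp (?P x) (differential A (\<lambda>y. blinfun_apply (Blinfun (\<lambda>\<xi>. fst \<xi> * h1 y + snd \<xi> * h2 y)) \<xi>) x) = xi_M A act \<xi> x"
      unfolding J
    proof (rule sharp_eqI)
      fix \<beta> :: "'e \<Rightarrow>\<^sub>L real"
      show "?P x (differential A (\<lambda>x. fst \<xi> * h1 x + snd \<xi> * h2 x) x) \<beta> = \<beta> (xi_M A act \<xi> x)"
      proof (cases "x \<in> V")
        case True
        \<comment> \<open>The differential of the momentum component is \<open>fst \<xi>\<close> on
          \<open>Y1\<close>, \<open>snd \<xi>\<close> on \<open>Y2\<close> and 0 on both generators,
          so contracting leaves the combination of generators with these coefficients.\<close>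
        then show ?thesis
          by (simp add: restricted_wedge_sum_def wedge_sum_def dJ Y1 Y2 generator_invariant_function h xi_M_def
              blinfun.add_right blinfun.scaleR_right)
      next
        case False
        \<comment> \<open>Off \<open>V\<close> the generators vanish because their supports lie in
          \<open>V\<close>, so both sides are 0.\<close>
        then have "?X1 x = 0" "?X2 x = 0"
          using supp by (auto intro: vf_support_zero)
        then show ?thesis using False by (simp add: restricted_wedge_sum_def xi_M_def blinfun.zero_right)
      qed
    qed
  qed
  ultimately show ?thesis by blast
qed

end

theorem theorem5p10:
  fixes A :: "('m::{t2_space, second_countable_topology}, 'e::euclidean_space) chart set"
    and act :: "complex \<times> complex \<Rightarrow> 'm \<Rightarrow> 'm"
    and X1 X2 :: "'m \<Rightarrow> 'e"
    and h1 h2 :: "'m \<Rightarrow> real"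
    and V :: "'m set"
  assumes "smooth_atlas A"
    and "smooth_torus_action A act"
    and "X1 = generator A act (1, 0)"
    and "X2 = generator A act (0, 1)"
    and "smooth_function A h1" and "smooth_function A h2"
    and "torus_invariant act h1" and "torus_invariant act h2"
    and "open V" and "torus_saturated act V"
    and "vf_support X1 \<union> vf_support X2 \<subseteq> V"
    and "independent_functions_on A V h1 h2"
    and "\<exists>W F. regular_foliation A V W F \<and> compatible_foliation A V h1 h2 X1 X2 W F"
  shows "\<exists>P. poisson_structure A P \<and>
           hamiltonian_with_momentum A P act
             (\<lambda>x. Blinfun (\<lambda>\<xi>. fst \<xi> * h1 x + snd \<xi> * h2 x))"
proof -
  obtain W F where WF: "regular_foliation A V W F" "compatible_foliation A V h1 h2 X1 X2 W F"
    using assms(13) by blast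
  interpret foliated_torus_manifold A act V W F
    by unfold_locales (use assms WF in auto)
  show ?thesis
    by (rule poisson_exists) (use assms WF smooth_function_iff in auto)
qed

end
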